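(* Let $(E,d)$ be a metric space and let $T\in\mathbf{N}_{1,b}(E)$. Then there exist currents $S_i\in\mathbf{N}_{1,b}(E)$, $i=0,1,2,\dots$, such that $T=\sum_{i=0}^\infty S_i$, $\partial S_0=0$, and for all $m\in\mathbb{N}=\{0,1,2,\dots\}$ $$\|\partial S_m\|(E)<\infty,\qquad S_m\le T-\sum_{i<m}S_i,\qquad \partial S_m\le\partial T-\sum_{i<m}\partial S_i.$$
   Context: $\mathrm{Lip}(E)$ denotes the real-valued Lipschitz functions on $E$, $\mathrm{Lip}_{bs}(E)$ those with bounded support, $\mathrm{Lip}(\pi)$ the Lipschitz constant. $\mathbf{M}_0(E)$ is the set of finite signed Borel measures on $E$ concentrated on a $\sigma$-compact set; $\mathbf{M}_{0,b}(E)$ is the set of real set functions $\mu$ on bounded Borel sets such that $B\mapsto\mu(U\cap B)$ belongs to $\mathbf{M}_0(E)$ for every bounded Borel $U$ (nonnegative ones are extended canonically to measures on all Borel sets). A $0$-dimensional current with locally finite mass is a linear $T:\mathrm{Lip}_{bs}(E)\to\mathbb{R}$ with $|T(f)|\le\int|f|\,d\mu$ for some nonnegative $\mu\in\mathbf{M}_{0,b}(E)$; these are identified with elements of $\mathbf{M}_{0,b}(E)$. $\mathbf{M}_{1,b}(E)$ is the set of bilinear maps $(f,\pi)\mapsto T(f\,d\pi)$ on $\mathrm{Lip}_{bs}(E)\times\mathrm{Lip}(E)$ such that: (i) if $\pi^j\to\pi$ pointwise with $\sup_j\mathrm{Lip}(\pi^j)<\infty$ then $T(f\,d\pi^j)\to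 T(f\,d\pi)$; (ii) $T(f\,d\pi)=0$ if $\pi=0$ on $\mathrm{supp} f$; (iii) there is a nonnegative $\mu\in\mathbf{M}_{0,b}(E)$ with $|T(f\,d\pi)|\le\mathrm{Lip}(\pi)\int_E|f|\,d\mu$. In both dimensions the mass $\|T\|$ is the least such $\mu$. The boundary of $T\in\mathbf{M}_{1,b}(E)$ is $\partial T(f):=T(\sigma\,df)$, with $\sigma\in\mathrm{Lip}_{bs}(E)$ any function equal to $1$ on $\mathrm{supp} f$. $\mathbf{N}_{1,b}(E)$ is the set of $T\in\mathbf{M}_{1,b}(E)$ such that $\partial T$ has locally finite mass. For two currents $S,T$ of the same dimension ($0$ or $1$) with locally finite mass, $S\le T$ ($S$ is a subcurrent of $T$) means $\|T\|=\|S\|+\|T-S\|$ as measures. The series $\sum_i S_i$ is understood in the sense of weak convergence of partial sums, i.e. $T(f\,d\pi)=\sum_{i=0}^\infty S_i(f\,d\pi)$ for all $(f,\pi)\in\mathrm{Lip}_{bs}(E)\times\mathrm{Lip}(E)$. *)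

theory Defs
  imports "HOL-Analysis.Analysis"
begin

subsection \<open>Lipschitz functions\<close>

text \<open>The metric space \<open>E\<close> is the type \<open>'a\<close>.\<close>

definition Lip :: "('a::metric_space \<Rightarrow> real) set"
  where "Lip = {f. \<exists>L. L-lipschitz_on UNIV f}"

definition lip_const :: "('a::metric_space \<Rightarrow> real) \<Rightarrow> real"
  where "lip_const f = Inf {L. L-lipschitz_on UNIV f}"

definition supp :: "('a::metric_space \<Rightarrow> real) \<Rightarrow> 'a set"
  where "supp f = closure {x. f x \<noteq> 0}"

definition Lip_bs :: "('a::metric_space \<Rightarrow> real) set"
  where "Lip_bs = {f \<in> Lip. bounded (supp f)}"

subsection \<open>Measures\<close>

definition bounded_borel :: "'a::metric_space set set"
  where "bounded_borel = {B \<in> sets borel. bounded B}"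

definition sigma_compact :: "'a::metric_space set \<Rightarrow> bool"
  where "sigma_compact K \<longleftrightarrow> (\<exists>C :: nat \<Rightarrow> 'a set. (\<forall>n. compact (C n)) \<and> K = (\<Union>n. C n))"

text \<open>A set function is a total function on sets; only its values on the relevant
  \<open>\<sigma>\<close>-algebra or \<open>\<delta>\<close>-ring are meaningful.\<close>

definition finite_signed_borel_measure :: "('a::metric_space set \<Rightarrow> real) \<Rightarrow> bool"
  where "finite_signed_borel_measure \<nu> \<longleftrightarrow> \<nu> {} = 0 \<and>
    (\<forall>A :: nat \<Rightarrow> 'a set. range A \<subseteq> sets borel \<and> disjoint_family A
       \<longrightarrow> (\<lambda>n. \<nu> (A n)) sums \<nu> (\<Union>n. A n))"

definition M\<^sub>0 :: "('a::metric_space set \<Rightarrow> real) set"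
  where "M\<^sub>0 = {\<nu>. finite_signed_borel_measure \<nu> \<and>
    (\<exists>K. sigma_compact K \<and> (\<forall>B \<in> sets borel. B \<inter> K = {} \<longrightarrow> \<nu> B = 0))}"

definition M\<^sub>0\<^sub>b :: "('a::metric_space set \<Rightarrow> real) set"
  where "M\<^sub>0\<^sub>b = {\<mu>. \<forall>U \<in> bounded_borel. (\<lambda>B. \<mu> (U \<inter> B)) \<in> M\<^sub>0}"

definition M\<^sub>0\<^sub>b_nonneg :: "('a::metric_space set \<Rightarrow> real) set"
  where "M\<^sub>0\<^sub>b_nonneg = {\<mu> \<in> M\<^sub>0\<^sub>b. \<forall>B \<in> bounded_borel. 0 \<le> \<mu> B}"

text \<open>The canonical extension of a nonnegative \<open>\<mu> \<in> M\<^sub>0\<^sub>b\<close> to all Borel sets.\<close>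

definition borel_extension :: "('a::metric_space set \<Rightarrow> real) \<Rightarrow> 'a measure"
  where "borel_extension \<mu> =
    measure_of UNIV (sets borel) (\<lambda>B. SUP U \<in> bounded_borel. ennreal (\<mu> (U \<inter> B)))"

lemma sets_borel_extension [simp]: "sets (borel_extension \<mu>) = sets borel"
  unfolding borel_extension_def by (metis sets.sets_measure_of_eq space_borel)

lemma emeasure_borel_extension:
  fixes \<mu> :: "'a::metric_space set \<Rightarrow> real"
  assumes \<mu>: "\<mu> \<in> M\<^sub>0\<^sub>b_nonneg" and B: "B \<in> sets borel"
  shows "emeasure (borel_extension \<mu>) B = (SUP U \<in> bounded_borel. ennreal (\<mu> (U \<inter> B)))"
proof (rule emeasure_measure_of[OF borel_extension_def])
  have nonneg: "0 \<le> \<mu> (U \<inter> A)" if "U \<in> bounded_borel" "A \<in> sets borel" for U A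
    using \<mu> that by (auto simp: M\<^sub>0\<^sub>b_nonneg_def bounded_borel_def bounded_Int)
  have sm: "finite_signed_borel_measure (\<lambda>B. \<mu> (U \<inter> B))" if "U \<in> bounded_borel" for U
    using \<mu> that by (auto simp: M\<^sub>0\<^sub>b_nonneg_def M\<^sub>0\<^sub>b_def M\<^sub>0_def)
  have empty: "\<mu> {} = 0"
    using sm[of "{}"] by (auto simp: finite_signed_borel_measure_def bounded_borel_def)
  have mono: "\<mu> U \<le> \<mu> V" if U: "U \<in> bounded_borel" and V: "V \<in> bounded_borel" and UV: "U \<subseteq> V" for U V
  proof -
    define A where "A = (\<lambda>n::nat. if n = 0 then U else if n = 1 then V - U else {})"
    have "range A \<subseteq> sets borel" "disjoint_family A"
      using U V by (auto simp: A_def bounded_borel_def disjoint_family_on_def)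
    then have s: "(\<lambda>n. \<mu> (V \<inter> A n)) sums \<mu> (V \<inter> (\<Union>n. A n))"
      using sm[OF V] by (auto simp: finite_signed_borel_measure_def)
    have u: "(\<Union>n. A n) = V"
      using UV by (auto simp: A_def split: if_splits)
    have "(\<lambda>n. \<mu> (V \<inter> A n)) sums (\<Sum>n\<in>{0,1}. \<mu> (V \<inter> A n))"
      by (rule sums_finite) (auto simp: A_def empty)
    with s have "\<mu> (V \<inter> (\<Union>n. A n)) = (\<Sum>n\<in>{0,1}. \<mu> (V \<inter> A n))"
      by (rule sums_unique2)
    moreover have "V \<inter> U = U" "V \<inter> (V - U) = V - U" using UV by auto
    moreover have "0 \<le> \<mu> (V \<inter> (V - U))"
      using U V by (intro nonneg) (auto simp: bounded_borel_def)
    ultimately show ?thesis by (simp add: u A_def)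
  qed
  show "sets borel \<subseteq> Pow (UNIV :: 'a set)" by simp
  show "B \<in> sets (borel_extension \<mu>)" using B by simp
  show "positive (sets (borel_extension \<mu>)) (\<lambda>B. SUP U \<in> bounded_borel. ennreal (\<mu> (U \<inter> B)))"
    by (simp add: positive_def empty SUP_constant bot_ennreal)
  show "countably_additive (sets (borel_extension \<mu>)) (\<lambda>B. SUP U \<in> bounded_borel. ennreal (\<mu> (U \<inter> B)))"
  proof (rule countably_additiveI)
    fix A :: "nat \<Rightarrow> 'a set"
    assume A: "range A \<subseteq> sets (borel_extension \<mu>)" and d: "disjoint_family A"
    then have A': "A n \<in> sets borel" for n by auto
    have "(\<Sum>n. SUP U \<in> bounded_borel. ennreal (\<mu> (U \<inter> A n)))
        = (SUP U \<in> bounded_borel. \<Sum>n. ennreal (\<mu> (U \<inter> A n)))"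
    proof (rule ennreal_suminf_SUP_eq_directed)
      fix N :: "nat set" and U V :: "'a set"
      assume UV: "U \<in> bounded_borel" "V \<in> bounded_borel"
      have "\<mu> (W \<inter> A n) \<le> \<mu> ((U \<union> V) \<inter> A n)" if "W = U \<or> W = V" for W n
        using UV that A'[of n]
        by (intro mono) (auto simp: bounded_borel_def bounded_Int)
      moreover have "U \<union> V \<in> bounded_borel" using UV by (auto simp: bounded_borel_def)
      ultimately show "\<exists>W\<in>bounded_borel. \<forall>n\<in>N. ennreal (\<mu> (U \<inter> A n)) \<le> ennreal (\<mu> (W \<inter> A n))
          \<and> ennreal (\<mu> (V \<inter> A n)) \<le> ennreal (\<mu> (W \<inter> A n))"
        by (intro bexI[of _ "U \<union> V"]) (auto intro!: ennreal_leI)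
    qed
    also have "\<dots> = (SUP U \<in> bounded_borel. ennreal (\<mu> (U \<inter> (\<Union>n. A n))))"
    proof (rule SUP_cong[OF refl])
      fix U :: "'a set" assume U: "U \<in> bounded_borel"
      have "(\<lambda>n. \<mu> (U \<inter> A n)) sums \<mu> (U \<inter> (\<Union>n. A n))"
        using sm[OF U] A d by (simp add: finite_signed_borel_measure_def)
      then show "(\<Sum>n. ennreal (\<mu> (U \<inter> A n))) = ennreal (\<mu> (U \<inter> (\<Union>n. A n)))"
        using nonneg[OF U A'] by (intro suminf_ennreal_eq) auto
    qed
    finally show "(\<Sum>n. SUP U \<in> bounded_borel. ennreal (\<mu> (U \<inter> A n)))
        = (SUP U \<in> bounded_borel. ennreal (\<mu> (U \<inter> (\<Union>n. A n))))" .
  qed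
qed

subsection \<open>Currents of dimension 0 and 1\<close>

text \<open>Currents are total functions, of which only the values on \<open>Lip_bs\<close> (dimension 0) and
  \<open>Lip_bs \<times> Lip\<close> (dimension 1) are meaningful; equality of currents means equality there.\<close>

type_synonym 'a current0 = "('a \<Rightarrow> real) \<Rightarrow> real"
type_synonym 'a current1 = "('a \<Rightarrow> real) \<Rightarrow> ('a \<Rightarrow> real) \<Rightarrow> real"

definition mass_bounds0 :: "'a::metric_space current0 \<Rightarrow> ('a set \<Rightarrow> real) set"
  where "mass_bounds0 T = {\<mu> \<in> M\<^sub>0\<^sub>b_nonneg. \<forall>f \<in> Lip_bs.
    \<bar>T f\<bar> \<le> (\<integral>x. \<bar>f x\<bar> \<partial>borel_extension \<mu>)}"

definition mass_bounds1 :: "'a::metric_space current1 \<Rightarrow> ('a set \<Rightarrow> real) set"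
  where "mass_bounds1 T = {\<mu> \<in> M\<^sub>0\<^sub>b_nonneg. \<forall>f \<in> Lip_bs. \<forall>\<pi> \<in> Lip.
    \<bar>T f \<pi>\<bar> \<le> lip_const \<pi> * (\<integral>x. \<bar>f x\<bar> \<partial>borel_extension \<mu>)}"

definition linear_on_Lip_bs :: "'a::metric_space current0 \<Rightarrow> bool"
  where "linear_on_Lip_bs T \<longleftrightarrow> (\<forall>f \<in> Lip_bs. \<forall>g \<in> Lip_bs. \<forall>a b.
    T (\<lambda>x. a * f x + b * g x) = a * T f + b * T g)"

definition linear_on_Lip :: "'a::metric_space current0 \<Rightarrow> bool"
  where "linear_on_Lip T \<longleftrightarrow> (\<forall>f \<in> Lip. \<forall>g \<in> Lip. \<forall>a b.
    T (\<lambda>x. a * f x + b * g x) = a * T f + b * T g)"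

text \<open>The 0-dimensional currents with locally finite mass.\<close>

definition currents0 :: "'a::metric_space current0 set"
  where "currents0 = {T. linear_on_Lip_bs T \<and> mass_bounds0 T \<noteq> {}}"

definition M\<^sub>1\<^sub>b :: "'a::metric_space current1 set"
  where "M\<^sub>1\<^sub>b = {T.
    (\<forall>\<pi> \<in> Lip. linear_on_Lip_bs (\<lambda>f. T f \<pi>)) \<and>
    (\<forall>f \<in> Lip_bs. linear_on_Lip (T f)) \<and>
    (\<forall>f \<in> Lip_bs. \<forall>\<pi> \<in> Lip. \<forall>p :: nat \<Rightarrow> 'a \<Rightarrow> real.
       (\<forall>j. p j \<in> Lip) \<and> bdd_above (range (\<lambda>j. lip_const (p j))) \<and> (\<forall>x. (\<lambda>j. p j x) \<longlonglongrightarrow> \<pi> x)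
       \<longrightarrow> (\<lambda>j. T f (p j)) \<longlonglongrightarrow> T f \<pi>) \<and>
    (\<forall>f \<in> Lip_bs. \<forall>\<pi> \<in> Lip. (\<forall>x \<in> supp f. \<pi> x = 0) \<longrightarrow> T f \<pi> = 0) \<and>
    mass_bounds1 T \<noteq> {}}"

text \<open>The least element of a set of nonnegative elements of \<open>M\<^sub>0\<^sub>b\<close>, as a measure on all Borel
  sets. The extension makes it unique, since it depends only on the values on bounded Borel sets.\<close>

definition least_measure :: "('a::metric_space set \<Rightarrow> real) set \<Rightarrow> 'a measure"
  where "least_measure \<M> = (THE M. \<exists>\<mu> \<in> \<M>.
    (\<forall>\<nu> \<in> \<M>. \<forall>B \<in> bounded_borel. \<mu> B \<le> \<nu> B) \<and> M = borel_extension \<mu>)"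

definition mass0 :: "'a::metric_space current0 \<Rightarrow> 'a measure"
  where "mass0 T = least_measure (mass_bounds0 T)"

definition mass1 :: "'a::metric_space current1 \<Rightarrow> 'a measure"
  where "mass1 T = least_measure (mass_bounds1 T)"

text \<open>For \<open>T \<in> M\<^sub>1\<^sub>b\<close> the value does not depend on the choice of \<open>\<sigma>\<close>.\<close>

definition boundary :: "'a::metric_space current1 \<Rightarrow> 'a current0"
  where "boundary T f = T (SOME \<sigma>. \<sigma> \<in> Lip_bs \<and> (\<forall>x \<in> supp f. \<sigma> x = 1)) f"

definition N\<^sub>1\<^sub>b :: "'a::metric_space current1 set"
  where "N\<^sub>1\<^sub>b = {T \<in> M\<^sub>1\<^sub>b. boundary T \<in> currents0}"

definition subcurrent0 :: "'a::metric_space current0 \<Rightarrow> 'a current0 \<Rightarrow> bool"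
  where "subcurrent0 S T \<longleftrightarrow> (\<forall>B \<in> sets borel.
    emeasure (mass0 T) B = emeasure (mass0 S) B + emeasure (mass0 (\<lambda>f. T f - S f)) B)"

definition subcurrent1 :: "'a::metric_space current1 \<Rightarrow> 'a current1 \<Rightarrow> bool"
  where "subcurrent1 S T \<longleftrightarrow> (\<forall>B \<in> sets borel.
    emeasure (mass1 T) B = emeasure (mass1 S) B + emeasure (mass1 (\<lambda>f \<pi>. T f \<pi> - S f \<pi>)) B)"

end

theory Submission
  imports Defs
begin

text \<open>
  Write \<open>\<partial>T = \<mu>\<^sup>+ - \<mu>\<^sup>-\<close>. The key step finds, for a bounded set \<open>U\<close>, a subcurrent \<open>S\<close> of \<open>T\<close> with
  \<open>\<partial>S = \<mu>\<^sup>+\<lfloor>U - \<eta>\<close>, \<open>0 \<le> \<eta> \<le> \<mu>\<^sup>-\<close> and \<open>\<eta>(E) \<le> \<mu>\<^sup>+(U)\<close>: everything that starts in \<open>U\<close> is followed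
  until it ends or escapes to infinity. The candidates \<open>(S, \<eta>)\<close> form a convex set that is compact for
  pointwise convergence, so it is enough to find, for each test function \<open>\<phi>\<close>, a candidate satisfying
  \<open>\<partial>S(\<phi>) \<ge> (\<mu>\<^sup>+\<lfloor>U - \<eta>)(\<phi>)\<close>. Take \<open>S = T\<lfloor>{\<phi> > c}\<close>, where \<open>c \<ge> 0\<close> is the level at which the superlevel
  set of \<open>\<phi>\<close> carries the allowed amount of \<open>\<mu>\<^sup>-\<close>; then \<open>\<partial>S(\<phi>) = \<partial>T((\<phi> - c)\<^sup>+)\<close> by locality.

  Applying this to \<open>T\<close> and to the negative of what remains removes the whole boundary in \<open>U\<close> by a
  subcurrent with finite boundary mass. Exhausting the space by balls \<open>U\<close> leaves a limit without
  boundary, which is \<open>S\<^sub>0\<close>; the pieces removed are \<open>S\<^sub>1, S\<^sub>2, \<dots>\<close>. All masses are compared through their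
  densities with respect to the masses of \<open>T\<close> and \<open>\<partial>T\<close>.
\<close>

section \<open>Lipschitz functions with bounded support\<close>

text \<open>Additivity of masses does not survive pointwise limits, since mass is only lower
  semicontinuous. A candidate therefore carries a certificate: a positive linear functional
  \<open>H\<close> that bounds \<open>S\<close>, while the mass of \<open>T\<close> minus
  \<open>H\<close> bounds \<open>T - S\<close>. These conditions compare finitely many values at a
  time, so they are closed and convex. One candidate per test function suffices by separation: if no
  candidate gave equality for all \<phi>, some finite linear combination of the defects would be
  negative on every candidate, and that combination is itself the defect of a single test function.
  The bound on \<eta> makes the removed boundary finite and also determines the level
  \<open>c\<close>. It is only an inequality because flow may escape to infinity without meeting
  negative boundary. For the final pieces the order is immaterial: if the densities of the parts of
  a splitting of \<open>T\<close> sum to at most 1, they must be the exact densities of the masses,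
  so masses add. Hence the limit, which is found last, may be listed first.\<close>

lemma LipI: "L-lipschitz_on UNIV f \<Longrightarrow> f \<in> Lip"
  by (auto simp: Lip_def)

lemma LipI_real: "0 \<le> L \<Longrightarrow> (\<And>x y. \<bar>f x - f y\<bar> \<le> L * dist x y) \<Longrightarrow> f \<in> Lip"
  by (rule LipI[of L]) (auto intro!: lipschitz_onI simp: dist_real_def)

lemma lip_const_nonneg: "f \<in> Lip \<Longrightarrow> 0 \<le> lip_const f"
  unfolding lip_const_def by (rule cInf_greatest) (auto simp: Lip_def lipschitz_on_nonneg)

lemma lip_const_le: "L-lipschitz_on UNIV f \<Longrightarrow> lip_const f \<le> L"
  unfolding lip_const_def by (rule cInf_lower) (auto intro!: bdd_belowI[of _ 0] lipschitz_on_nonneg)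

lemma lip_const_leI: "0 \<le> L \<Longrightarrow> (\<And>x y. \<bar>f x - f y\<bar> \<le> L * dist x y) \<Longrightarrow> lip_const f \<le> L"
  by (rule lip_const_le) (auto intro!: lipschitz_onI simp: dist_real_def)

text \<open>The infimum defining \<open>lip_const\<close> is attained: every difference quotient is
  a lower bound of the set of admissible constants.\<close>

lemma lip_constD: 
  assumes "f \<in> Lip" shows "\<bar>f x - f y\<bar> \<le> lip_const f * dist x y"
proof (cases "x = y")
  case False
  then have d: "dist x y > 0" by simp
  have "\<bar>f x - f y\<bar> / dist x y \<le> lip_const f"
    unfolding lip_const_def
  proof (rule cInf_greatest)
    show "{L. L-lipschitz_on UNIV f} \<noteq> {}" using assms by (auto simp: Lip_def)
    fix L assume "L \<in> {L. L-lipschitz_on UNIV f}"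
    then show "\<bar>f x - f y\<bar> / dist x y \<le> L"
      using lipschitz_onD[of L UNIV f x y] d by (auto simp: dist_real_def field_simps)
  qed
  then show ?thesis using d by (simp add: field_simps)
qed simp

lemma Lip_const: "(\<lambda>x. c) \<in> Lip"
  by (rule LipI[OF lipschitz_on_constant])

lemma Lip_lincomb:
  assumes "f \<in> Lip" "g \<in> Lip" shows "(\<lambda>x. a * f x + b * g x) \<in> Lip"
proof -
  obtain L K where "L-lipschitz_on UNIV f" "K-lipschitz_on UNIV g"
    using assms by (auto simp: Lip_def)
  then have "(\<bar>a\<bar> * L + \<bar>b\<bar> * K)-lipschitz_on UNIV (\<lambda>x. a * f x + b * g x)"
    by (intro lipschitz_intros) 
  then show ?thesis by (rule LipI)
qed

lemma Lip_add: "f \<in> Lip \<Longrightarrow> g \<in> Lip \<Longrightarrow> (\<lambda>x. f x + g x) \<in> Lip"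
  using Lip_lincomb[of f g 1 1] by simp

lemma Lip_diff: "f \<in> Lip \<Longrightarrow> g \<in> Lip \<Longrightarrow> (\<lambda>x. f x - g x) \<in> Lip"
  using Lip_lincomb[of f g 1 "-1"] by simp

lemma Lip_cmult: "f \<in> Lip \<Longrightarrow> (\<lambda>x. a * f x) \<in> Lip"
  using Lip_lincomb[of f f a 0] by simp

lemma Lip_comp:
  fixes u :: "real \<Rightarrow> real"
  assumes "f \<in> Lip" and u: "\<And>s t. \<bar>u s - u t\<bar> \<le> \<bar>s - t\<bar>" 
  shows "(\<lambda>x. u (f x)) \<in> Lip" "lip_const (\<lambda>x. u (f x)) \<le> lip_const f"
proof -
  have "\<bar>u (f x) - u (f y)\<bar> \<le> lip_const f * dist x y" for x y
    using u[of "f x" "f y"] lip_constD[OF assms(1), of x y] by linarith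
  then show "(\<lambda>x. u (f x)) \<in> Lip" "lip_const (\<lambda>x. u (f x)) \<le> lip_const f"
    using lip_const_nonneg[OF assms(1)] by (auto intro: LipI_real lip_const_leI)
qed

lemma Lip_continuous: "f \<in> Lip \<Longrightarrow> continuous_on UNIV f"
  by (auto simp: Lip_def intro: lipschitz_on_continuous_on)

lemma Lip_measurable [measurable_dest]: "f \<in> Lip \<Longrightarrow> f \<in> borel_measurable borel"
  by (intro borel_measurable_continuous_onI Lip_continuous)

lemma lip_const_cmult:
  assumes "f \<in> Lip" shows "lip_const (\<lambda>x. c * f x) \<le> \<bar>c\<bar> * lip_const f"
proof (rule lip_const_leI)
  fix x y
  have "\<bar>c * f x - c * f y\<bar> = \<bar>c\<bar> * \<bar>f x - f y\<bar>"
    by (simp add: abs_mult flip: right_diff_distrib)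
  also have "\<dots> \<le> \<bar>c\<bar> * (lip_const f * dist x y)"
    by (intro mult_left_mono lip_constD assms) simp
  finally show "\<bar>c * f x - c * f y\<bar> \<le> \<bar>c\<bar> * lip_const f * dist x y" by (simp add: mult.assoc)
qed (simp add: lip_const_nonneg[OF assms])

lemma supp_zero: "x \<notin> supp f \<Longrightarrow> f x = 0"
  unfolding supp_def using closure_subset[of "{x. f x \<noteq> 0}"] by auto

lemma supp_mono: "(\<And>x. f x = 0 \<Longrightarrow> g x = 0) \<Longrightarrow> supp g \<subseteq> supp f"
  unfolding supp_def by (rule closure_mono) auto

lemma supp_subset: "(\<And>x. f x \<noteq> 0 \<Longrightarrow> x \<in> A) \<Longrightarrow> closed A \<Longrightarrow> supp f \<subseteq> A"
  unfolding supp_def by (rule closure_minimal) auto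

lemma Lip_bs_Lip: "f \<in> Lip_bs \<Longrightarrow> f \<in> Lip"
  by (simp add: Lip_bs_def)

lemma Lip_bs_measurable [measurable_dest]: "f \<in> Lip_bs \<Longrightarrow> f \<in> borel_measurable borel"
  by (simp add: Lip_bs_Lip Lip_measurable)

lemma Lip_bsI: "f \<in> Lip \<Longrightarrow> bounded A \<Longrightarrow> (\<And>x. f x \<noteq> 0 \<Longrightarrow> x \<in> A) \<Longrightarrow> f \<in> Lip_bs"
  unfolding Lip_bs_def supp_def by (auto intro!: bounded_closure intro: bounded_subset)

lemma Lip_bs_supp_bounded: "f \<in> Lip_bs \<Longrightarrow> bounded (supp f)"
  by (simp add: Lip_bs_def)

lemma Lip_bounded_on:
  assumes "f \<in> Lip" "bounded A" obtains K where "K > 0" "\<And>x. x \<in> A \<Longrightarrow> \<bar>f x\<bar> \<le> K"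
proof -
  obtain a e where ae: "\<And>x. x \<in> A \<Longrightarrow> dist a x \<le> e"
    using assms(2) by (auto simp: bounded_def)
  have "\<bar>f x\<bar> \<le> \<bar>f a\<bar> + lip_const f * \<bar>e\<bar> + 1" if "x \<in> A" for x
  proof -
    have "\<bar>f x - f a\<bar> \<le> lip_const f * dist a x"
      using lip_constD[OF assms(1), of x a] by (simp add: dist_commute)
    also have "\<dots> \<le> lip_const f * \<bar>e\<bar>"
      using ae[OF that] by (intro mult_left_mono lip_const_nonneg assms) auto
    finally show ?thesis by linarith
  qed
  moreover have "\<bar>f a\<bar> + lip_const f * \<bar>e\<bar> + 1 > 0"
    using lip_const_nonneg[OF assms(1)] by (simp add: add_nonneg_pos)
  ultimately show ?thesis by (rule that[rotated])
qed

lemma Lip_bs_bounded: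
  assumes "f \<in> Lip_bs" obtains K where "K > 0" "\<And>x. \<bar>f x\<bar> \<le> K"
proof -
  obtain K where "K > 0" and K: "\<And>x. x \<in> supp f \<Longrightarrow> \<bar>f x\<bar> \<le> K"
    using Lip_bounded_on[OF Lip_bs_Lip Lip_bs_supp_bounded] assms by blast
  then have "\<bar>f x\<bar> \<le> K" for x
    using supp_zero[of x f] by (cases "x \<in> supp f") auto
  then show ?thesis using \<open>K > 0\<close> that by blast
qed

lemma Lip_bs_lincomb:
  assumes "f \<in> Lip_bs" "g \<in> Lip_bs" shows "(\<lambda>x. a * f x + b * g x) \<in> Lip_bs"
proof (rule Lip_bsI[where A="supp f \<union> supp g"])
  fix x assume "a * f x + b * g x \<noteq> 0"
  then have "f x \<noteq> 0 \<or> g x \<noteq> 0" by auto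
  then show "x \<in> supp f \<union> supp g" using supp_zero by blast
qed (use assms in \<open>auto simp: Lip_bs_def intro!: Lip_lincomb\<close>)

lemma Lip_bs_0: "(\<lambda>x. 0) \<in> Lip_bs"
  by (rule Lip_bsI[where A="{}"]) (auto simp: Lip_const)

lemma Lip_bs_add: "f \<in> Lip_bs \<Longrightarrow> g \<in> Lip_bs \<Longrightarrow> (\<lambda>x. f x + g x) \<in> Lip_bs"
  using Lip_bs_lincomb[of f g 1 1] by simp

lemma Lip_bs_diff: "f \<in> Lip_bs \<Longrightarrow> g \<in> Lip_bs \<Longrightarrow> (\<lambda>x. f x - g x) \<in> Lip_bs"
  using Lip_bs_lincomb[of f g 1 "-1"] by simp

lemma Lip_bs_cmult: "f \<in> Lip_bs \<Longrightarrow> (\<lambda>x. a * f x) \<in> Lip_bs"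
  using Lip_bs_lincomb[of f f a 0] by simp

lemma Lip_bs_sum: "finite I \<Longrightarrow> (\<And>i. i \<in> I \<Longrightarrow> f i \<in> Lip_bs) \<Longrightarrow> (\<lambda>x. \<Sum>i\<in>I. c i * f i x) \<in> Lip_bs"
  by (induction I rule: finite_induct) (auto simp: Lip_bs_0 intro!: Lip_bs_add Lip_bs_cmult)

lemma Lip_bs_comp:
  fixes u :: "real \<Rightarrow> real"
  assumes "f \<in> Lip_bs" and "\<And>s t. \<bar>u s - u t\<bar> \<le> \<bar>s - t\<bar>" and "u 0 = 0"
  shows "(\<lambda>x. u (f x)) \<in> Lip_bs"
proof (rule Lip_bsI[where A="supp f"])
  fix x assume "u (f x) \<noteq> 0"
  then have "f x \<noteq> 0" using assms(3) by auto
  then show "x \<in> supp f" using supp_zero by blast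
qed (use assms in \<open>simp_all add: Lip_bs_def Lip_comp(1)\<close>)

lemma Lip_bs_abs: "f \<in> Lip_bs \<Longrightarrow> (\<lambda>x. \<bar>f x\<bar>) \<in> Lip_bs"
  by (rule Lip_bs_comp) auto

text \<open>\<open>g\<close> may be unbounded, but the product rule for differences evaluates it
  without a difference at one point only, and that point can be chosen in the bounded set
  \<open>supp f\<close>.\<close>

lemma Lip_bs_mult:
  assumes "f \<in> Lip_bs" "g \<in> Lip" shows "(\<lambda>x. f x * g x) \<in> Lip_bs"
proof -
  obtain K where K: "K > 0" "\<And>x. \<bar>f x\<bar> \<le> K"
    using Lip_bs_bounded assms by blast
  obtain K' where K': "K' > 0" "\<And>x. x \<in> supp f \<Longrightarrow> \<bar>g x\<bar> \<le> K'"
    using Lip_bounded_on[OF assms(2) Lip_bs_supp_bounded[OF assms(1)]] by blast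
  let ?L = "lip_const f" and ?L' = "lip_const g"
  have f: "f \<in> Lip" using assms by (simp add: Lip_bs_Lip)
  have *: "\<bar>f x * g x - f y * g y\<bar> \<le> (K' * ?L + K * ?L') * dist x y" if "x \<in> supp f" for x y
  proof -
    have "\<bar>f x * g x - f y * g y\<bar> = \<bar>g x * (f x - f y) + f y * (g x - g y)\<bar>"
      by (simp add: algebra_simps)
    also have "\<dots> \<le> \<bar>g x\<bar> * \<bar>f x - f y\<bar> + \<bar>f y\<bar> * \<bar>g x - g y\<bar>"
      by (metis abs_mult abs_triangle_ineq)
    also have "\<dots> \<le> K' * (?L * dist x y) + K * (?L' * dist x y)"
      using K K' that lip_constD[OF f] lip_constD[OF assms(2)] by (intro add_mono mult_mono) auto
    finally show ?thesis by (simp add: algebra_simps)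
  qed
  have "\<bar>f x * g x - f y * g y\<bar> \<le> (K' * ?L + K * ?L') * dist x y" for x y
  proof (cases "x \<in> supp f \<or> y \<in> supp f")
    case True then show ?thesis using *[of x y] *[of y x] by (auto simp: dist_commute abs_minus_commute)
  next
    case False then show ?thesis
      using K K' lip_const_nonneg[OF f] lip_const_nonneg[OF assms(2)] by (simp add: supp_zero)
  qed
  then have "(\<lambda>x. f x * g x) \<in> Lip"
    using K K' lip_const_nonneg[OF f] lip_const_nonneg[OF assms(2)] by (intro LipI_real[of "K' * ?L + K * ?L'"]) auto
  then show ?thesis
    using Lip_bs_supp_bounded[OF assms(1)] by (rule Lip_bsI) (use supp_zero in force)
qed

text \<open>All exhaustions in the proof use balls around the arbitrary point
  \<open>undefined\<close>; the type is inhabited, so there is always such a centre.\<close>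

definition cutoff :: "nat \<Rightarrow> 'a::metric_space \<Rightarrow> real"
  where "cutoff n x = max 0 (min 1 (real n + 1 - dist x undefined))"

lemma cutoff_range: "0 \<le> cutoff n x" "cutoff n x \<le> 1"
  by (auto simp: cutoff_def)

lemma cutoff_one: "x \<in> cball undefined (real n) \<Longrightarrow> cutoff n x = 1"
  by (auto simp: cutoff_def dist_commute)

lemma cutoff_zero: "x \<notin> ball undefined (real (Suc n)) \<Longrightarrow> cutoff n x = 0"
  by (auto simp: cutoff_def dist_commute)

lemma cutoff_Lip_bs: "(cutoff n :: 'a::metric_space \<Rightarrow> real) \<in> Lip_bs"
proof (rule Lip_bsI)
  show "(cutoff n :: 'a \<Rightarrow> real) \<in> Lip"
  proof (rule LipI_real[of 1])
    fix x y :: 'a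
    have "\<bar>max 0 (min 1 a) - max 0 (min 1 b)\<bar> \<le> \<bar>a - b\<bar>" for a b :: real
      by linarith
    from this[of "real n + 1 - dist x undefined" "real n + 1 - dist y undefined"]
    have "\<bar>cutoff n x - cutoff n y\<bar> \<le> \<bar>dist y undefined - dist x undefined\<bar>"
      by (simp add: cutoff_def)
    also have "\<dots> \<le> dist x y"
      using dist_triangle[of x undefined y] dist_triangle[of y undefined x]
      by (simp add: dist_commute)
    finally show "\<bar>cutoff n x - cutoff n y\<bar> \<le> 1 * dist x y" by simp
  qed simp
  show "bounded (ball (undefined::'a) (real (Suc n)))" by simp
  fix x :: 'a assume "cutoff n x \<noteq> 0"
  then show "x \<in> ball undefined (real (Suc n))" using cutoff_zero[of x n] by auto
qed

lemma bounded_subset_ball: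
  fixes A :: "'a::metric_space set"
  assumes "bounded A" obtains n where "A \<subseteq> ball undefined (real n)"
proof -
  obtain e where "\<forall>x\<in>A. dist undefined x \<le> e" using assms bounded_any_center by blast
  moreover obtain n where "e < real n" using reals_Archimedean2 by blast
  ultimately have "A \<subseteq> ball undefined (real n)" by force
  then show ?thesis by (rule that)
qed

lemma cutoff_eventually_one:
  fixes A :: "'a::metric_space set"
  assumes "bounded A" obtains n where "\<And>x m. x \<in> A \<Longrightarrow> n \<le> m \<Longrightarrow> cutoff m x = 1"
proof -
  obtain n where n: "A \<subseteq> ball undefined (real n)" using bounded_subset_ball assms by blast
  have "cutoff m x = 1" if "x \<in> A" "n \<le> m" for x m
  proof (rule cutoff_one)
    have "dist undefined x < real n" using n that(1) by auto
    then show "x \<in> cball undefined (real m)" using that(2) by simp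
  qed
  then show ?thesis using that by blast
qed

lemma Lip_bs_has_cutoff:
  assumes "f \<in> Lip_bs" shows "\<exists>\<sigma>. \<sigma> \<in> Lip_bs \<and> (\<forall>x \<in> supp f. \<sigma> x = 1)"
proof -
  obtain n where "\<And>x m. x \<in> supp f \<Longrightarrow> n \<le> m \<Longrightarrow> cutoff m x = 1"
    using cutoff_eventually_one[OF Lip_bs_supp_bounded[OF assms]] by blast
  then show ?thesis using cutoff_Lip_bs[of n] by blast
qed

section \<open>Locally finite measures\<close>

text \<open>The measures \<open>borel_extension \<mu>\<close> with \<open>\<mu> \<in> M\<^sub>0\<^sub>b_nonneg\<close>, described intrinsically.\<close>

definition loc_finite :: "'a::metric_space measure \<Rightarrow> bool"
  where "loc_finite M \<longleftrightarrow> sets M = sets borel \<and> (\<forall>U \<in> bounded_borel. emeasure M U < \<infinity> \<and>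
    (\<exists>K. sigma_compact K \<and> (\<forall>B \<in> sets borel. B \<inter> K = {} \<longrightarrow> emeasure M (U \<inter> B) = 0)))"

lemma loc_finite_sets: "loc_finite M \<Longrightarrow> sets M = sets borel"
  by (simp add: loc_finite_def)

lemma loc_finite_space: "loc_finite M \<Longrightarrow> space M = UNIV"
  by (metis loc_finite_sets sets_eq_imp_space_eq space_borel)

lemma loc_finite_measurable: "loc_finite M \<Longrightarrow> borel_measurable M = borel_measurable borel"
  by (rule measurable_cong_sets) (auto simp: loc_finite_sets)

lemma ball_bounded_borel: "ball x r \<in> bounded_borel"
  by (simp add: bounded_borel_def)

lemma bounded_borel_Int: "U \<in> bounded_borel \<Longrightarrow> B \<in> sets borel \<Longrightarrow> U \<inter> B \<in> bounded_borel"
  by (auto simp: bounded_borel_def bounded_Int)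

lemma bounded_borel_Int2: "U \<in> bounded_borel \<Longrightarrow> B \<in> sets borel \<Longrightarrow> B \<inter> U \<in> bounded_borel"
  by (auto simp: bounded_borel_def bounded_Int)

lemma UN_balls: "(\<Union>n. ball a (real n)) = (UNIV :: 'a::metric_space set)"
  by (auto intro: reals_Archimedean2)

lemma incseq_balls: "incseq (\<lambda>n. A \<inter> ball a (real n))"
  by (auto simp: incseq_def)

lemma emeasure_SUP_balls:
  fixes M :: "'a::metric_space measure"
  assumes "sets M = sets borel" "A \<in> sets borel"
  shows "emeasure M A = (SUP n. emeasure M (A \<inter> ball a (real n)))"
proof -
  have "(SUP n. emeasure M (A \<inter> ball a (real n))) = emeasure M (\<Union>n. A \<inter> ball a (real n))"
    by (rule SUP_emeasure_incseq) (use assms incseq_balls in auto)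
  also have "(\<Union>n. A \<inter> ball a (real n)) = A"
    using UN_balls[of a] by blast
  finally show ?thesis by simp
qed

lemma emeasure_le_if_bounded_le:
  fixes M N :: "'a::metric_space measure"
  assumes "sets M = sets borel" "sets N = sets borel"
    and "\<And>B. B \<in> bounded_borel \<Longrightarrow> emeasure M B \<le> emeasure N B" and "A \<in> sets borel"
  shows "emeasure M A \<le> emeasure N A"
  unfolding emeasure_SUP_balls[OF assms(1,4), of undefined] emeasure_SUP_balls[OF assms(2,4), of undefined]
  using assms(3,4) by (intro SUP_mono) (auto intro!: assms bounded_borel_Int2 ball_bounded_borel)

lemma loc_finite_emeasure:
  "loc_finite M \<Longrightarrow> B \<in> bounded_borel \<Longrightarrow> emeasure M B = ennreal (measure M B)"
  by (auto simp: loc_finite_def less_top intro!: emeasure_eq_ennreal_measure)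

lemma M0b_nonneg_mono:
  assumes \<mu>: "\<mu> \<in> M\<^sub>0\<^sub>b_nonneg" and U: "U \<in> bounded_borel" and V: "V \<in> bounded_borel" and UV: "U \<subseteq> V"
  shows "\<mu> U \<le> \<mu> V"
proof -
  have fs: "finite_signed_borel_measure (\<lambda>B. \<mu> (V \<inter> B))"
    using \<mu> V by (auto simp: M\<^sub>0\<^sub>b_nonneg_def M\<^sub>0\<^sub>b_def M\<^sub>0_def)
  define A where "A = (\<lambda>n::nat. if n = 0 then U else if n = 1 then V - U else {})"
  have "range A \<subseteq> sets borel" "disjoint_family A"
    using U V by (auto simp: A_def bounded_borel_def disjoint_family_on_def)
  then have s: "(\<lambda>n. \<mu> (V \<inter> A n)) sums \<mu> (V \<inter> (\<Union>n. A n))"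
    using fs by (auto simp: finite_signed_borel_measure_def)
  have "\<mu> {} = 0" using fs by (simp add: finite_signed_borel_measure_def)
  then have "(\<lambda>n. \<mu> (V \<inter> A n)) sums (\<Sum>n\<in>{0,1}. \<mu> (V \<inter> A n))"
    by (intro sums_finite) (auto simp: A_def)
  with s have "\<mu> (V \<inter> (\<Union>n. A n)) = (\<Sum>n\<in>{0,1}. \<mu> (V \<inter> A n))"
    by (rule sums_unique2)
  moreover have "(\<Union>n. A n) = V" "V \<inter> U = U" "V \<inter> (V - U) = V - U"
    using UV by (auto simp: A_def split: if_splits)
  moreover have "V - U \<in> bounded_borel"
    using U V by (auto simp: bounded_borel_def intro: bounded_subset)
  then have "0 \<le> \<mu> (V - U)" using \<mu> by (auto simp: M\<^sub>0\<^sub>b_nonneg_def)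
  ultimately show ?thesis by (simp add: A_def)
qed

lemma emeasure_borel_extension_bounded:
  assumes "\<mu> \<in> M\<^sub>0\<^sub>b_nonneg" "B \<in> bounded_borel"
  shows "emeasure (borel_extension \<mu>) B = ennreal (\<mu> B)"
proof -
  have B: "B \<in> sets borel" using assms by (simp add: bounded_borel_def)
  have "(SUP U \<in> bounded_borel. ennreal (\<mu> (U \<inter> B))) = ennreal (\<mu> B)"
  proof (rule antisym)
    show "(SUP U \<in> bounded_borel. ennreal (\<mu> (U \<inter> B))) \<le> ennreal (\<mu> B)"
      using assms B by (intro SUP_least ennreal_leI M0b_nonneg_mono bounded_borel_Int) auto
    show "ennreal (\<mu> B) \<le> (SUP U \<in> bounded_borel. ennreal (\<mu> (U \<inter> B)))"
      by (rule SUP_upper2[OF assms(2)]) simp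
  qed
  then show ?thesis using emeasure_borel_extension[OF assms(1) B] by simp
qed

lemma measure_borel_extension_bounded:
  assumes "\<mu> \<in> M\<^sub>0\<^sub>b_nonneg" "B \<in> bounded_borel"
  shows "measure (borel_extension \<mu>) B = \<mu> B"
  using emeasure_borel_extension_bounded[OF assms] assms
  by (simp add: measure_def M\<^sub>0\<^sub>b_nonneg_def)

lemma loc_finite_borel_extension:
  assumes "\<mu> \<in> M\<^sub>0\<^sub>b_nonneg" shows "loc_finite (borel_extension \<mu>)"
  unfolding loc_finite_def
proof (intro conjI ballI)
  fix U :: "'a set" assume U: "U \<in> bounded_borel"
  show "emeasure (borel_extension \<mu>) U < \<infinity>"
    using emeasure_borel_extension_bounded[OF assms U] by simp
  obtain K where "sigma_compact K" "\<forall>B \<in> sets borel. B \<inter> K = {} \<longrightarrow> \<mu> (U \<inter> B) = 0"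
    using assms U by (auto simp: M\<^sub>0\<^sub>b_nonneg_def M\<^sub>0\<^sub>b_def M\<^sub>0_def)
  then show "\<exists>K. sigma_compact K \<and> (\<forall>B \<in> sets borel. B \<inter> K = {} \<longrightarrow> emeasure (borel_extension \<mu>) (U \<inter> B) = 0)"
    using emeasure_borel_extension_bounded[OF assms bounded_borel_Int[OF U]] by auto
qed simp

lemma M0b_nonneg_measure:
  assumes "loc_finite M" shows "measure M \<in> M\<^sub>0\<^sub>b_nonneg"
  unfolding M\<^sub>0\<^sub>b_nonneg_def M\<^sub>0\<^sub>b_def M\<^sub>0_def finite_signed_borel_measure_def
proof (safe, goal_cases)
  case (2 U A)
  have "(\<lambda>n. measure M (U \<inter> A n)) sums measure M (\<Union>n. U \<inter> A n)"
  proof (rule measure_UNION)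
    show "range (\<lambda>n. U \<inter> A n) \<subseteq> sets M" "disjoint_family (\<lambda>n. U \<inter> A n)"
      using 2 loc_finite_sets[OF assms] by (auto simp: bounded_borel_def disjoint_family_on_def)
    have "(\<Union>n. U \<inter> A n) \<in> bounded_borel"
      using bounded_borel_Int[OF 2(1), of "\<Union>n. A n"] 2(2) by auto
    then show "emeasure M (\<Union>n. U \<inter> A n) \<noteq> \<infinity>"
      using assms by (auto simp: loc_finite_def)
  qed
  then show ?case by simp
next
  case (3 U)
  then obtain K where "sigma_compact K" "\<forall>B \<in> sets borel. B \<inter> K = {} \<longrightarrow> emeasure M (U \<inter> B) = 0"
    using assms by (auto simp: loc_finite_def)
  then show ?case by (auto simp: measure_def intro!: exI[of _ K])
qed auto

text \<open>Together with \<open>loc_finite_borel_extension\<close> this identifies nonnegative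
  elements of \<open>M\<^sub>0\<^sub>b\<close> with locally finite measures, so that the rest can be
  done with genuine measures. Both sides are determined by their values on bounded Borel
  sets.\<close>

lemma borel_extension_measure:
  assumes "loc_finite M" shows "borel_extension (measure M) = M"
proof (rule measure_eqI)
  note M = loc_finite_sets[OF assms] and m = M0b_nonneg_measure[OF assms]
  show "sets (borel_extension (measure M)) = sets M" using M by simp
  fix A assume "A \<in> sets (borel_extension (measure M))"
  then have A: "A \<in> sets borel" by simp
  have eq: "emeasure (borel_extension (measure M)) B = emeasure M B" if "B \<in> bounded_borel" for B
    using emeasure_borel_extension_bounded[OF m that] loc_finite_emeasure[OF assms that] by simp
  show "emeasure (borel_extension (measure M)) A = emeasure M A"
  proof (rule antisym)
    show "emeasure (borel_extension (measure M)) A \<le> emeasure M A"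
      by (rule emeasure_le_if_bounded_le[OF _ M _ A]) (simp_all add: eq)
    show "emeasure M A \<le> emeasure (borel_extension (measure M)) A"
      by (rule emeasure_le_if_bounded_le[OF M _ _ A]) (simp_all add: eq)
  qed
qed

lemma loc_finite_integrable:
  fixes f :: "'a::metric_space \<Rightarrow> real"
  assumes M: "loc_finite M" and f: "f \<in> borel_measurable borel" and "bounded A"
    and K: "\<And>x. \<bar>f x\<bar> \<le> K" and A: "\<And>x. x \<notin> A \<Longrightarrow> f x = 0"
  shows "integrable M f"
proof -
  obtain n where n: "A \<subseteq> ball undefined (real n)" using bounded_subset_ball \<open>bounded A\<close> by blast
  show ?thesis
  proof (rule integrableI_bounded_set[where A="ball undefined (real n)" and B=K])
    show "emeasure M (ball undefined (real n)) < \<infinity>"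
      using M ball_bounded_borel by (auto simp: loc_finite_def)
  qed (use n A K f loc_finite_sets[OF M] loc_finite_measurable[OF M] in \<open>auto simp: subset_eq\<close>)
qed

lemma Lip_bs_integrable:
  assumes M: "loc_finite M" and "f \<in> Lip_bs" and h: "h \<in> borel_measurable borel" "\<And>x. \<bar>h x\<bar> \<le> C"
  shows "integrable M (\<lambda>x. f x * h x)" "integrable M f"
proof -
  obtain K where K: "K > 0" "\<And>x. \<bar>f x\<bar> \<le> K" using Lip_bs_bounded assms by blast
  have [measurable]: "f \<in> borel_measurable borel" using assms by measurable
  note [measurable] = h(1)
  show "integrable M (\<lambda>x. f x * h x)"
    by (rule loc_finite_integrable[OF M _ Lip_bs_supp_bounded[OF assms(2)], where K="K * C"])
      (use K h(2) in \<open>auto simp: abs_mult supp_zero intro!: mult_mono\<close>)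
  show "integrable M f"
    by (rule loc_finite_integrable[OF M _ Lip_bs_supp_bounded[OF assms(2)], where K=K])
      (use K in \<open>auto simp: supp_zero\<close>)
qed

lemma integrable_Lip_bs: "loc_finite M \<Longrightarrow> f \<in> Lip_bs \<Longrightarrow> integrable M f"
  using Lip_bs_integrable(2)[of M f "\<lambda>_. 0" 0] by simp

lemma loc_finite_sigma_finite:
  assumes M: "loc_finite M" shows "sigma_finite_measure M"
proof
  show "\<exists>A. countable A \<and> A \<subseteq> sets M \<and> \<Union>A = space M \<and> (\<forall>a\<in>A. emeasure M a \<noteq> \<infinity>)"
  proof (intro exI conjI)
    show "\<Union>(range (\<lambda>n. ball undefined (real n))) = space M"
      by (simp add: UN_balls loc_finite_space[OF M])
    have "emeasure M (ball undefined (real n)) \<noteq> \<infinity>" for n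
      by (simp add: loc_finite_emeasure[OF M ball_bounded_borel])
    then show "\<forall>a\<in>range (\<lambda>n. ball undefined (real n)). emeasure M a \<noteq> \<infinity>"
      by blast
  qed (auto simp: loc_finite_sets[OF M])
qed

lemma AE_on_balls:
  assumes "\<And>n. AE x in M. x \<in> ball a (real n) \<longrightarrow> P x" shows "AE x in M. P x"
proof -
  have "AE x in M. \<forall>n. x \<in> ball a (real n) \<longrightarrow> P x"
    using assms by (subst AE_all_countable) blast
  then show ?thesis by eventually_elim (use UN_balls[of a] in blast)
qed

lemma loc_finite_density:
  fixes h :: "'a::metric_space \<Rightarrow> real"
  assumes M: "loc_finite M" and h[measurable]: "h \<in> borel_measurable borel" and K: "\<And>x. h x \<le> K"
  shows "loc_finite (density M (\<lambda>x. ennreal (h x)))"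
  unfolding loc_finite_def
proof (intro conjI ballI)
  have [measurable_cong]: "sets M = sets borel" by (rule loc_finite_sets[OF M])
  then show "sets (density M (\<lambda>x. ennreal (h x))) = sets borel" by simp
  fix U :: "'a set" assume U: "U \<in> bounded_borel"
  then have [measurable]: "U \<in> sets borel" by (simp add: bounded_borel_def)
  have fin: "emeasure M U < \<infinity>" using M U by (auto simp: loc_finite_def)
  have "emeasure (density M (\<lambda>x. ennreal (h x))) U \<le> (\<integral>\<^sup>+ x. ennreal K * indicator U x \<partial>M)"
    by (subst emeasure_density) (auto intro!: nn_integral_mono mult_right_mono ennreal_leI K)
  also have "\<dots> = ennreal K * emeasure M U" by (subst nn_integral_cmult_indicator) auto
  also have "\<dots> < \<infinity>" using fin by (simp add: ennreal_mult_less_top)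
  finally show "emeasure (density M (\<lambda>x. ennreal (h x))) U < \<infinity>" .
  obtain C where C: "sigma_compact C" "\<forall>B \<in> sets borel. B \<inter> C = {} \<longrightarrow> emeasure M (U \<inter> B) = 0"
    using M U by (auto simp: loc_finite_def)
  have "emeasure (density M (\<lambda>x. ennreal (h x))) (U \<inter> B) = 0" if "B \<in> sets borel" "B \<inter> C = {}" for B
  proof -
    have "emeasure M (U \<inter> B) = 0" using C that by blast
    then have "U \<inter> B \<in> null_sets M" using that by (auto simp: null_sets_def)
    moreover have "absolutely_continuous M (density M (\<lambda>x. ennreal (h x)))"
      by (rule absolutely_continuousI_density) measurable
    ultimately have "U \<inter> B \<in> null_sets (density M (\<lambda>x. ennreal (h x)))"
      by (auto simp: absolutely_continuous_def)
    then show ?thesis by (simp add: null_sets_def)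
  qed
  then show "\<exists>K. sigma_compact K \<and> (\<forall>B \<in> sets borel. B \<inter> K = {} \<longrightarrow>
      emeasure (density M (\<lambda>x. ennreal (h x))) (U \<inter> B) = 0)" using C(1) by blast
qed

lemma sigma_compact_Un: "sigma_compact K \<Longrightarrow> sigma_compact L \<Longrightarrow> sigma_compact (K \<union> L)"
proof -
  assume "sigma_compact K" "sigma_compact L"
  then obtain C D where CD: "\<And>n::nat. compact (C n)" "K = (\<Union>n. C n)" "\<And>n::nat. compact (D n)" "L = (\<Union>n. D n)"
    unfolding sigma_compact_def by metis
  have "compact (C n \<union> D n)" for n using CD by (intro compact_Un)
  moreover have "K \<union> L = (\<Union>n. C n \<union> D n)" using CD by auto
  ultimately show ?thesis unfolding sigma_compact_def
    by (intro exI[of _ "\<lambda>n. C n \<union> D n"]) simp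
qed

text \<open>Provides a common measure with respect to which two given measures both have densities.
  The sum is formed on the level of set functions, where a \<sigma>-compact carrier is the union of
  the two carriers.\<close>

lemma loc_finite_add:
  assumes M: "loc_finite M" and N: "loc_finite N"
  obtains Q where "loc_finite Q" "\<And>B. B \<in> bounded_borel \<Longrightarrow> emeasure Q B = emeasure M B + emeasure N B"
proof -
  define \<mu> where "\<mu> B = measure M B + measure N B" for B
  have mn: "measure M \<in> M\<^sub>0\<^sub>b_nonneg" "measure N \<in> M\<^sub>0\<^sub>b_nonneg"
    using M N by (auto intro: M0b_nonneg_measure)
  have "(\<lambda>B. \<mu> (U \<inter> B)) \<in> M\<^sub>0" if U: "U \<in> bounded_borel" for U
  proof -
    have 1: "(\<lambda>B. measure M (U \<inter> B)) \<in> M\<^sub>0" "(\<lambda>B. measure N (U \<inter> B)) \<in> M\<^sub>0"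
      using mn U by (auto simp: M\<^sub>0\<^sub>b_nonneg_def M\<^sub>0\<^sub>b_def)
    then obtain K L where "sigma_compact K" "\<forall>B \<in> sets borel. B \<inter> K = {} \<longrightarrow> measure M (U \<inter> B) = 0"
      "sigma_compact L" "\<forall>B \<in> sets borel. B \<inter> L = {} \<longrightarrow> measure N (U \<inter> B) = 0"
      by (auto simp: M\<^sub>0_def)
    then have "\<exists>K. sigma_compact K \<and> (\<forall>B \<in> sets borel. B \<inter> K = {} \<longrightarrow> \<mu> (U \<inter> B) = 0)"
      by (intro exI[of _ "K \<union> L"]) (auto simp: \<mu>_def sigma_compact_Un Int_Un_distrib)
    then show ?thesis using 1
      by (auto simp: M\<^sub>0_def finite_signed_borel_measure_def \<mu>_def intro!: sums_add)
  qed
  then have \<mu>: "\<mu> \<in> M\<^sub>0\<^sub>b_nonneg"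
    by (auto simp: M\<^sub>0\<^sub>b_nonneg_def M\<^sub>0\<^sub>b_def \<mu>_def)
  show ?thesis
  proof (rule that[OF loc_finite_borel_extension[OF \<mu>]])
    fix B :: "'a set" assume B: "B \<in> bounded_borel"
    show "emeasure (borel_extension \<mu>) B = emeasure M B + emeasure N B"
      using emeasure_borel_extension_bounded[OF \<mu> B] loc_finite_emeasure[OF M B] loc_finite_emeasure[OF N B]
      by (simp add: \<mu>_def)
  qed
qed

text \<open>The comparison on bounded sets gives absolute continuity ball by ball. It also bounds
  the derivative by \<open>c\<close> almost everywhere, so truncation yields a real density that
  obeys the bound at every point.\<close>

lemma loc_finite_Radon_Nikodym:
  fixes M N :: "'a::metric_space measure"
  assumes M: "loc_finite M" and N: "loc_finite N" and c: "0 \<le> c"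
    and le: "\<And>B. B \<in> bounded_borel \<Longrightarrow> emeasure N B \<le> ennreal c * emeasure M B"
  obtains h :: "'a \<Rightarrow> real" where "h \<in> borel_measurable borel" "\<And>x. 0 \<le> h x" "\<And>x. h x \<le> c"
    "N = density M (\<lambda>x. ennreal (h x))"
proof -
  have sM[measurable_cong]: "sets M = sets borel" by (rule loc_finite_sets[OF M])
  have sN: "sets N = sets borel" by (rule loc_finite_sets[OF N])
  interpret sigma_finite_measure M by (rule loc_finite_sigma_finite[OF M])
  have "absolutely_continuous M N"
    unfolding absolutely_continuous_def
  proof
    fix X assume X: "X \<in> null_sets M"
    then have X': "X \<in> sets borel" "emeasure M X = 0" using sM by auto
    have "emeasure N (X \<inter> ball undefined (real n)) = 0" for n
    proof -
      have "emeasure M (X \<inter> ball undefined (real n)) \<le> emeasure M X"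
        using X' sM by (intro emeasure_mono) auto
      then have "emeasure M (X \<inter> ball undefined (real n)) = 0" using X' by simp
      then show ?thesis using le[OF bounded_borel_Int2[OF ball_bounded_borel X'(1), of undefined n]] by simp
    qed
    then have "emeasure N X = 0" using emeasure_SUP_balls[OF sN X'(1), of undefined] by simp
    then show "X \<in> null_sets N" using X'(1) sN by (simp add: null_sets_def)
  qed
  from Radon_Nikodym[OF this] sM sN obtain f where f: "f \<in> borel_measurable M" "density M f = N" by auto
  note [measurable] = f(1)
  have ae: "AE x in M. f x \<le> ennreal c"
  proof (rule AE_on_balls)
    fix n
    \<comment> \<open>The part of a ball where the derivative is too large. Staying inside a ball
      keeps the integrals finite, which the subtraction in \<open>ennreal\<close> requires.\<close>
    define Z where "Z = {x \<in> ball undefined (real n). f x > ennreal c}"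
    have Zs: "Z = ball undefined (real n) \<inter> {x\<in>space M. f x > ennreal c}" by (auto simp: Z_def loc_finite_space[OF M])
    have "{x\<in>space M. f x > ennreal c} \<in> sets M" by measurable
    then have Z: "Z \<in> bounded_borel" unfolding Zs sM by (intro bounded_borel_Int ball_bounded_borel)
    then have [measurable]: "Z \<in> sets M" by (simp add: bounded_borel_def sM)
    have Zfin: "emeasure M Z < \<infinity>" using M Z by (auto simp: loc_finite_def)
    have i1: "(\<integral>\<^sup>+x. f x * indicator Z x \<partial>M) \<le> ennreal c * emeasure M Z"
      using le[OF Z] emeasure_density[of f M Z] f(2) by simp
    have i2: "(\<integral>\<^sup>+x. ennreal c * indicator Z x \<partial>M) = ennreal c * emeasure M Z"
      by (rule nn_integral_cmult_indicator) simp
    have "(\<integral>\<^sup>+x. f x * indicator Z x - ennreal c * indicator Z x \<partial>M)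
        = (\<integral>\<^sup>+x. f x * indicator Z x \<partial>M) - (\<integral>\<^sup>+x. ennreal c * indicator Z x \<partial>M)"
    proof (rule nn_integral_diff)
      show "AE x in M. ennreal c * indicator Z x \<le> f x * indicator Z x"
        by (rule AE_I2) (auto simp: Z_def indicator_def)
      show "(\<integral>\<^sup>+x. ennreal c * indicator Z x \<partial>M) \<noteq> \<infinity>"
        using Zfin i2 by (simp add: ennreal_mult_eq_top_iff)
    qed measurable
    also have "\<dots> = 0"
    proof -
      have "(\<integral>\<^sup>+x. f x * indicator Z x \<partial>M) < \<infinity>"
        using i1 Zfin by (auto intro: le_less_trans simp: ennreal_mult_less_top)
      then show ?thesis using i1 i2 by (simp add: diff_eq_0_iff_ennreal)
    qed
    finally have "AE x in M. f x * indicator Z x - ennreal c * indicator Z x = 0"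
      by (subst (asm) nn_integral_0_iff_AE) auto
    then show "AE x in M. x \<in> ball undefined (real n) \<longrightarrow> f x \<le> ennreal c"
    proof eventually_elim
      case (elim x)
      show ?case
      proof (intro impI, rule ccontr)
        assume "x \<in> ball undefined (real n)" "\<not> f x \<le> ennreal c"
        then show False using elim by (auto simp: Z_def diff_eq_0_iff_ennreal)
      qed
    qed
  qed
  define h where "h x = min c (enn2real (f x))" for x
  have [measurable]: "h \<in> borel_measurable borel"
    using f(1) unfolding h_def loc_finite_measurable[OF M] measurable_cong_sets[OF sM refl] by measurable
  have "AE x in M. f x = ennreal (h x)"
    using ae
  proof eventually_elim
    case (elim x)
    then have "f x < \<infinity>" by (simp add: le_less_trans)
    moreover have "enn2real (f x) \<le> c" using enn2real_mono[OF elim] c by simp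
    ultimately show ?case by (simp add: h_def)
  qed
  then have "density M f = density M (\<lambda>x. ennreal (h x))"
    by (intro density_cong) auto
  then show ?thesis using f(2) c by (intro that[of h]) (auto simp: h_def[of x for x])
qed

section \<open>Functionals on Lipschitz functions dominated by a measure\<close>

lemma L1_triangle:
  fixes u v w :: "'a \<Rightarrow> real"
  assumes "integrable M u" "integrable M v" "integrable M w"
  shows "(\<integral>x. \<bar>u x - w x\<bar> \<partial>M) \<le> (\<integral>x. \<bar>u x - v x\<bar> \<partial>M) + (\<integral>x. \<bar>v x - w x\<bar> \<partial>M)"
proof -
  have "(\<integral>x. \<bar>u x - w x\<bar> \<partial>M) \<le> (\<integral>x. \<bar>u x - v x\<bar> + \<bar>v x - w x\<bar> \<partial>M)"
    using assms by (intro integral_mono) auto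
  also have "\<dots> = (\<integral>x. \<bar>u x - v x\<bar> \<partial>M) + (\<integral>x. \<bar>v x - w x\<bar> \<partial>M)"
    using assms by (intro Bochner_Integration.integral_add) auto
  finally show ?thesis .
qed

lemma L1_dominated_convergence:
  fixes u w :: "'a \<Rightarrow> real"
  assumes "integrable M u" "integrable M w" "\<And>i. s i \<in> borel_measurable M"
    and "\<And>x. x \<in> space M \<Longrightarrow> (\<lambda>i. s i x) \<longlonglongrightarrow> u x" "\<And>i x. x \<in> space M \<Longrightarrow> \<bar>s i x\<bar> \<le> w x"
  shows "(\<lambda>i. \<integral>x. \<bar>s i x - u x\<bar> \<partial>M) \<longlonglongrightarrow> 0"
proof -
  note [measurable] = assms(3) borel_measurable_integrable[OF assms(1)]
  have "(\<lambda>i. \<integral>x. \<bar>s i x - u x\<bar> \<partial>M) \<longlonglongrightarrow> (\<integral>x. 0 \<partial>M)"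
  proof (rule integral_dominated_convergence[where w="\<lambda>x. w x + \<bar>u x\<bar>"])
    show "AE x in M. (\<lambda>i. \<bar>s i x - u x\<bar>) \<longlonglongrightarrow> 0"
      using assms(4) by (intro AE_I2) (auto intro!: tendsto_rabs_zero LIM_zero)
    show "AE x in M. norm \<bar>s i x - u x\<bar> \<le> w x + \<bar>u x\<bar>" for i
    proof (rule AE_I2)
      fix x assume "x \<in> space M"
      from assms(5)[OF this, of i] show "norm \<bar>s i x - u x\<bar> \<le> w x + \<bar>u x\<bar>" by simp
    qed
  qed (use assms in auto)
  then show ?thesis by simp
qed

text \<open>Open sets generate the Borel sets and are stable under intersection, so it suffices that
  approximability holds for open sets and passes to complements and disjoint unions. The ball makes
  the measure finite, as complements require.\<close>

lemma Lip_approx_indicator: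
  fixes M :: "'a::metric_space measure"
  assumes M: "loc_finite M" and A: "A \<in> sets borel" and e: "e > 0"
  shows "\<exists>f\<in>Lip. (\<forall>x. 0 \<le> f x \<and> f x \<le> 1) \<and>
    (\<integral>x. \<bar>f x * indicator (ball a r) x - indicator A x * indicator (ball a r) x\<bar> \<partial>M) < e"
proof -
  define U where "U = ball a r"
  have U: "U \<in> bounded_borel" "U \<in> sets borel" "bounded U" by (auto simp: U_def ball_bounded_borel)
  have sM[measurable_cong]: "sets M = sets borel" by (rule loc_finite_sets[OF M])
  have int: "integrable M (\<lambda>x. f x * indicator U x)"
    if "f \<in> borel_measurable borel" "\<And>x. 0 \<le> f x" "\<And>x. f x \<le> (1::real)" for f
    by (rule loc_finite_integrable[OF M _ U(3), where K=1]) (use that U(2) in \<open>auto simp: indicator_def\<close>)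
  have intA: "integrable M (\<lambda>x. indicator B x * indicator U x :: real)" if "B \<in> sets borel" for B
    using that by (intro int) (auto simp: indicator_def)
  let ?d = "\<lambda>(f :: 'a \<Rightarrow> real) B. \<integral>x. \<bar>f x * indicator U x - indicator B x * indicator U x\<bar> \<partial>M"
  have conv: "(\<lambda>k. ?d (g k) B) \<longlonglongrightarrow> 0" if B: "B \<in> sets borel" and g: "\<And>k. g k \<in> borel_measurable borel"
      "\<And>k x. 0 \<le> g k x" "\<And>k x. g k x \<le> (1::real)" "\<And>x. (\<lambda>k. g k x) \<longlonglongrightarrow> indicator B x"
      for g :: "nat \<Rightarrow> 'a \<Rightarrow> real" and B
  proof (rule L1_dominated_convergence[OF intA[OF B], where w="indicator U"])
    show "integrable M (indicator U :: 'a \<Rightarrow> real)"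
      using U(2) M U(1) sM by (auto simp: integrable_indicator_iff loc_finite_def)
    show "(\<lambda>x. g i x * indicator U x) \<in> borel_measurable M" for i
      using int[of "g i"] g by auto
    show "(\<lambda>i. g i x * indicator U x) \<longlonglongrightarrow> indicator B x * indicator U x" for x
      using g by (intro tendsto_intros)
    show "\<bar>g i x * indicator U x\<bar> \<le> indicator U x" for i x
      using g(2,3)[of i x] by (auto simp: indicator_def)
  qed
  have "Int_stable {S::'a set. open S}" "{S::'a set. open S} \<subseteq> Pow UNIV" "A \<in> sigma_sets UNIV {S. open S}"
    using A by (auto simp: sets_borel Int_stable_def)
  then have "\<forall>e>0. \<exists>f\<in>Lip. (\<forall>x. 0 \<le> f x \<and> f x \<le> 1) \<and> ?d f A < e"
  proof (induction rule: sigma_sets_induct_disjoint)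
    case (basic A)
    then have op: "open A" by simp
    show ?case
    \<comment> \<open>Since \<open>infdist x {} = 0\<close>, the functions \<open>g k\<close> below
      would all vanish for \<open>A = UNIV\<close>.\<close>
    proof (cases "A = UNIV")
      case True then show ?thesis by (auto intro!: bexI[of _ "\<lambda>x. 1"] Lip_const)
    next
      case False
      define g where "g k x = min 1 (real k * infdist x (- A))" for k x
      have gL: "g k \<in> Lip" for k
      proof (rule LipI_real[of "real k"])
        fix x y
        have "\<bar>min 1 s - min 1 t\<bar> \<le> \<bar>s - t\<bar>" for s t :: real by linarith
        then have "\<bar>g k x - g k y\<bar> \<le> \<bar>real k * infdist x (- A) - real k * infdist y (- A)\<bar>"
          by (simp add: g_def)
        also have "\<dots> = real k * \<bar>infdist x (- A) - infdist y (- A)\<bar>"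
          by (simp add: abs_mult flip: right_diff_distrib)
        also have "\<dots> \<le> real k * dist x y"
          using infdist_triangle_abs[of x "- A" y] by (intro mult_left_mono) auto
        finally show "\<bar>g k x - g k y\<bar> \<le> real k * dist x y" .
      qed simp
      have pw: "(\<lambda>k. g k x) \<longlonglongrightarrow> indicator A x" for x
      proof (cases "x \<in> A")
        case True
        have "infdist x (- A) > 0"
          using True op False in_closed_iff_infdist_zero[of "- A" x] infdist_nonneg[of x "- A"]
          by (auto simp: less_le)
        then obtain n where n: "1 < real n * infdist x (- A)" using ex_less_of_nat_mult by blast
        have "eventually (\<lambda>k. g k x = 1) sequentially"
        proof (rule eventually_sequentiallyI[of n])
          fix k assume "n \<le> k"
          then have "real n * infdist x (- A) \<le> real k * infdist x (- A)"
            by (intro mult_right_mono infdist_nonneg) auto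
          then show "g k x = 1" using n by (simp add: g_def)
        qed
        then show ?thesis using True by (simp add: tendsto_eventually)
      next
        case False
        then show ?thesis by (simp add: g_def)
      qed
      have lim: "(\<lambda>k. ?d (g k) A) \<longlonglongrightarrow> 0"
      proof (rule conv[rotated])
        show "g k \<in> borel_measurable borel" for k using gL by (rule Lip_measurable)
        show "(\<lambda>k. g k x) \<longlonglongrightarrow> indicator A x" for x by (rule pw)
      qed (use op in \<open>auto simp: g_def infdist_nonneg\<close>)
      show ?thesis
      proof (intro allI impI)
        fix e :: real assume "e > 0"
        then obtain k where "?d (g k) A < e"
          using order_tendstoD(2)[OF lim] by (auto simp: eventually_sequentially)
        then show "\<exists>f\<in>Lip. (\<forall>x. 0 \<le> f x \<and> f x \<le> 1) \<and> ?d f A < e"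
          using gL by (intro bexI[of _ "g k"]) (auto simp: g_def infdist_nonneg)
      qed
    qed
  next
    case empty
    then show ?case by (auto intro!: bexI[of _ "\<lambda>x. 0"] Lip_const)
  next
    case (compl A)
    show ?case
    proof (intro allI impI)
      fix e :: real assume "e > 0"
      then obtain f where f: "f \<in> Lip" "\<And>x. 0 \<le> f x \<and> f x \<le> 1" "?d f A < e" using compl by blast
      have "?d (\<lambda>x. 1 - f x) (UNIV - A) = ?d f A"
        by (rule Bochner_Integration.integral_cong) (auto simp: indicator_def)
      then show "\<exists>f\<in>Lip. (\<forall>x. 0 \<le> f x \<and> f x \<le> 1) \<and> ?d f (UNIV - A) < e"
        using f by (intro bexI[of _ "\<lambda>x. 1 - f x"] Lip_diff Lip_const) auto
    qed
  next
    case (union A)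
    then have Ab: "A i \<in> sets borel" for i by (auto simp: sets_borel)
    \<comment> \<open>Finite unions come first: they need only finitely many approximants, whose
      truncated sum is again Lipschitz. The countable union is then an L1 limit of finite
      ones.\<close>
    have fin: "\<forall>e>0. \<exists>f\<in>Lip. (\<forall>x. 0 \<le> f x \<and> f x \<le> 1) \<and> ?d f (\<Union>i<n. A i) < e" for n
    proof (induction n)
      case 0
      then show ?case by (auto intro!: bexI[of _ "\<lambda>x. 0"] Lip_const)
    next
      case (Suc n)
      show ?case
      proof (intro allI impI)
        fix e :: real assume "e > 0"
        then have e2: "e / 2 > 0" by simp
        obtain f where f: "f \<in> Lip" "\<And>x. 0 \<le> f x" "\<And>x. f x \<le> 1" "?d f (\<Union>i<n. A i) < e / 2"
          using Suc e2 by blast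
        obtain g where g: "g \<in> Lip" "\<And>x. 0 \<le> g x" "\<And>x. g x \<le> 1" "?d g (A n) < e / 2"
          using union.IH e2 by blast
        define h where "h x = min 1 (f x + g x)" for x
        have h: "h \<in> Lip" unfolding h_def
          by (rule Lip_comp(1)[where u="min 1"]) (use f g in \<open>auto intro: Lip_add\<close>)
        have un: "(\<Union>i<Suc n. A i) = (\<Union>i<n. A i) \<union> A n" by (auto simp: less_Suc_eq)
        have dj: "(\<Union>i<n. A i) \<inter> A n = {}"
        proof -
          have "A i \<inter> A n = {}" if "i < n" for i
            using union(1) that by (intro disjoint_family_onD[of A UNIV]) auto
          then show ?thesis by blast
        qed
        have iu: "integrable M (\<lambda>x. \<bar>f x * indicator U x - indicator (\<Union>i<n. A i) x * indicator U x\<bar>)"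
          "integrable M (\<lambda>x. \<bar>g x * indicator U x - indicator (A n) x * indicator U x\<bar>)"
          using f g Ab by (intro integrable_abs Bochner_Integration.integrable_diff int intA; auto simp: Lip_measurable)+
        have "?d h (\<Union>i<Suc n. A i) \<le> (\<integral>x. \<bar>f x * indicator U x - indicator (\<Union>i<n. A i) x * indicator U x\<bar>
           + \<bar>g x * indicator U x - indicator (A n) x * indicator U x\<bar> \<partial>M)"
        proof (rule integral_mono)
          show "integrable M (\<lambda>x. \<bar>h x * indicator U x - indicator (\<Union>i<Suc n. A i) x * indicator U x\<bar>)"
            using f g h Ab by (intro integrable_abs Bochner_Integration.integrable_diff int intA) (auto simp: Lip_measurable h_def)
          fix x
          show "\<bar>h x * indicator U x - indicator (\<Union>i<Suc n. A i) x * indicator U x\<bar> \<le>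
            \<bar>f x * indicator U x - indicator (\<Union>i<n. A i) x * indicator U x\<bar>
            + \<bar>g x * indicator U x - indicator (A n) x * indicator U x\<bar>"
            using f(2,3)[of x] g(2,3)[of x] dj unfolding un h_def
            by (cases "x \<in> (\<Union>i<n. A i)"; cases "x \<in> A n"; cases "x \<in> U") (auto simp: indicator_def)
        qed (use iu in auto)
        also have "\<dots> < e"
          using f(4) g(4) iu by simp
        finally show "\<exists>f\<in>Lip. (\<forall>x. 0 \<le> f x \<and> f x \<le> 1) \<and> ?d f (\<Union>i<Suc n. A i) < e"
          using h f g by (intro bexI[of _ h]) (auto simp: h_def)
      qed
    qed
    have "(\<lambda>k. indicator (\<Union>i<k. A i) x :: real) \<longlonglongrightarrow> indicator (\<Union>i. A i) x" for x
      by (rule LIMSEQ_indicator_UN)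
    then have lim: "(\<lambda>k. ?d (indicator (\<Union>i<k. A i)) (\<Union>i. A i)) \<longlonglongrightarrow> 0"
      using Ab by (intro conv)
        (auto simp: indicator_def)
    show ?case
    proof (intro allI impI)
      fix e :: real assume "e > 0"
      then have e2: "e / 2 > 0" by simp
      obtain k where k: "?d (indicator (\<Union>i<k. A i)) (\<Union>i. A i) < e / 2"
        using order_tendstoD(2)[OF lim e2] by (auto simp: eventually_sequentially)
      obtain f where f: "f \<in> Lip" "\<And>x. 0 \<le> f x" "\<And>x. f x \<le> 1" "?d f (\<Union>i<k. A i) < e / 2"
        using fin e2 by blast
      have "?d f (\<Union>i. A i) \<le> ?d f (\<Union>i<k. A i) + ?d (indicator (\<Union>i<k. A i)) (\<Union>i. A i)"
        using f Ab by (intro L1_triangle int intA) (auto simp: Lip_measurable)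
      then show "\<exists>f\<in>Lip. (\<forall>x. 0 \<le> f x \<and> f x \<le> 1) \<and> ?d f (\<Union>i. A i) < e"
        using f k by (intro bexI[of _ f]) auto
    qed
  qed
  then show ?thesis using e by (auto simp: U_def)
qed

text \<open>Multiplying the approximant by a cutoff that is 1 on \<open>B\<close> gives bounded
  support. On \<open>B\<close> nothing changes, and off \<open>B\<close> the target is 0, so
  shrinking a nonnegative function only reduces the error.\<close>

lemma Lip_bs_approx_indicator:
  fixes M :: "'a::metric_space measure"
  assumes M: "loc_finite M" and B: "B \<in> bounded_borel" and e: "e > 0"
  shows "\<exists>f\<in>Lip_bs. (\<integral>x. \<bar>f x - indicator B x\<bar> \<partial>M) < e"
proof -
  have Bs: "B \<in> sets borel" "bounded B" using B by (auto simp: bounded_borel_def)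
  obtain n where n: "B \<subseteq> ball undefined (real n)" using bounded_subset_ball Bs(2) by blast
  let ?U = "ball undefined (real (Suc n)) :: 'a set"
  obtain f where f: "f \<in> Lip" "\<And>x. 0 \<le> f x \<and> f x \<le> 1"
    "(\<integral>x. \<bar>f x * indicator ?U x - indicator B x * indicator ?U x\<bar> \<partial>M) < e"
    using Lip_approx_indicator[OF M Bs(1) e] by blast
  define g where "g x = cutoff n x * f x" for x
  have g: "g \<in> Lip_bs" unfolding g_def by (rule Lip_bs_mult[OF cutoff_Lip_bs f(1)])
  have sM[measurable_cong]: "sets M = sets borel" by (rule loc_finite_sets[OF M])
  have "integrable M (indicator B :: 'a \<Rightarrow> real)"
    using B M sM by (auto simp: integrable_indicator_iff loc_finite_def bounded_borel_def)
  then have ig: "integrable M (\<lambda>x. \<bar>g x - indicator B x\<bar>)"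
    using integrable_Lip_bs[OF M g] by auto
  have "(\<integral>x. \<bar>g x - indicator B x\<bar> \<partial>M) \<le> (\<integral>x. \<bar>f x * indicator ?U x - indicator B x * indicator ?U x\<bar> \<partial>M)"
  proof (rule integral_mono[OF ig])
    have fm: "f \<in> borel_measurable borel" using f(1) by (rule Lip_measurable)
    have "integrable M (\<lambda>x. f x * indicator ?U x)" "integrable M (\<lambda>x. indicator B x * indicator ?U x :: real)"
      using f(2)
      by (auto intro!: loc_finite_integrable[OF M _ bounded_ball[of undefined "real (Suc n)"], where K=1]
        borel_measurable_times fm borel_measurable_indicator Bs(1) split: split_indicator)
    then show "integrable M (\<lambda>x. \<bar>f x * indicator ?U x - indicator B x * indicator ?U x\<bar>)" by auto
    fix x
    show "\<bar>g x - indicator B x\<bar> \<le> \<bar>f x * indicator ?U x - indicator B x * indicator ?U x\<bar>"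
    proof (cases "x \<in> B")
      case True
      then have "cutoff n x = 1" using n by (intro cutoff_one) auto
      moreover have "x \<in> ?U" using n True by force
      ultimately show ?thesis using True by (simp add: g_def)
    next
      case False
      have "cutoff n x * f x \<le> f x" using cutoff_range[of n x] f(2)[of x] by (simp add: mult_left_le_one_le)
      then show ?thesis
        using False cutoff_range[of n x] f(2)[of x] cutoff_zero[of x n]
        by (cases "x \<in> ?U") (auto simp: g_def)
    qed
  qed
  then show ?thesis using f(3) g by (intro bexI[of _ g]) auto
qed

lemma Lip_bs_dense:
  fixes M :: "'a::metric_space measure" and u :: "'a \<Rightarrow> real"
  assumes M: "loc_finite M" and u: "integrable M u"
  shows "\<forall>e>0. \<exists>f\<in>Lip_bs. (\<integral>x. \<bar>f x - u x\<bar> \<partial>M) < e"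
proof -
  have sM[measurable_cong]: "sets M = sets borel" by (rule loc_finite_sets[OF M])
  have Li: "integrable M f" if "f \<in> Lip_bs" for f
    using integrable_Lip_bs[OF M that] by auto
  \<comment> \<open>The approximable functions are closed under L1 limits. This serves both for sets
    of infinite measure, exhausted by balls, and for the limit case of the induction.\<close>
  have close: "\<exists>f\<in>Lip_bs. (\<integral>x. \<bar>f x - v x\<bar> \<partial>M) < e"
    if s: "\<And>i. integrable M (s i)" "\<And>i. \<forall>e>0. \<exists>f\<in>Lip_bs. (\<integral>x. \<bar>f x - s i x\<bar> \<partial>M) < e"
      and v: "integrable M v" and lim: "(\<lambda>i. \<integral>x. \<bar>s i x - v x\<bar> \<partial>M) \<longlonglongrightarrow> 0" and e: "e > 0"
    for s :: "nat \<Rightarrow> 'a \<Rightarrow> real" and v e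
  proof -
    have e2: "e / 2 > 0" using e by simp
    obtain k where k: "(\<integral>x. \<bar>s k x - v x\<bar> \<partial>M) < e / 2"
      using order_tendstoD(2)[OF lim e2] by (auto simp: eventually_sequentially)
    obtain f where f: "f \<in> Lip_bs" "(\<integral>x. \<bar>f x - s k x\<bar> \<partial>M) < e / 2" using s(2) e2 by blast
    have "(\<integral>x. \<bar>f x - v x\<bar> \<partial>M) < e" using L1_triangle[OF Li[OF f(1)] s(1)[of k] v] f k by linarith
    then show ?thesis using f(1) by blast
  qed
  from u show ?thesis
  proof (induction rule: integrable_induct)
    case (base A c)
    then have A: "A \<in> sets borel" using sM by simp
    let ?s = "\<lambda>n x. indicator (A \<inter> ball undefined (real n)) x *\<^sub>R c :: real"
    show ?case
    proof (intro allI impI, rule close[where s="?s"])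
      fix i
      have AB: "A \<inter> ball undefined (real i) \<in> bounded_borel"
        using A by (intro bounded_borel_Int2 ball_bounded_borel)
      then show ii: "integrable M (?s i)"
        using M sM by (auto simp: loc_finite_def bounded_borel_def)
      show "\<forall>e>0. \<exists>f\<in>Lip_bs. (\<integral>x. \<bar>f x - ?s i x\<bar> \<partial>M) < e"
      proof (intro allI impI)
        fix e :: real assume "e > 0"
        then obtain f where f: "f \<in> Lip_bs"
          "(\<integral>x. \<bar>f x - indicator (A \<inter> ball undefined (real i)) x\<bar> \<partial>M) < e / (\<bar>c\<bar> + 1)"
          using Lip_bs_approx_indicator[OF M AB, of "e / (\<bar>c\<bar> + 1)"] by auto
        have "(\<integral>x. \<bar>c * f x - ?s i x\<bar> \<partial>M) = \<bar>c\<bar> * (\<integral>x. \<bar>f x - indicator (A \<inter> ball undefined (real i)) x\<bar> \<partial>M)"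
          by (subst Bochner_Integration.integral_mult_right_zero[symmetric], rule Bochner_Integration.integral_cong)
            (auto simp: abs_mult[symmetric] algebra_simps)
        also have "\<dots> \<le> (\<bar>c\<bar> + 1) * (\<integral>x. \<bar>f x - indicator (A \<inter> ball undefined (real i)) x\<bar> \<partial>M)"
          by (intro mult_right_mono) auto
        also have "\<dots> < e" using f(2) by (simp add: field_simps)
        finally show "\<exists>f\<in>Lip_bs. (\<integral>x. \<bar>f x - ?s i x\<bar> \<partial>M) < e"
          by (rule bexI[where x="\<lambda>x. c * f x", OF _ Lip_bs_cmult[OF f(1)]])
      qed
    next
      show iA: "integrable M (\<lambda>x. indicator A x *\<^sub>R c)" using base by auto
      show "(\<lambda>i. \<integral>x. \<bar>?s i x - indicator A x *\<^sub>R c\<bar> \<partial>M) \<longlonglongrightarrow> 0"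
      proof (rule L1_dominated_convergence[OF iA, where w="\<lambda>x. \<bar>indicator A x *\<^sub>R c\<bar>"])
        show "?s i \<in> borel_measurable M" for i
          using A sM by (intro borel_measurable_scaleR borel_measurable_indicator) auto
        fix x :: 'a
        have "x \<in> (\<Union>n. ball undefined (real n))" using UN_balls by blast
        then obtain n where n: "x \<in> ball undefined (real n)" by blast
        have "eventually (\<lambda>i. ?s i x = indicator A x *\<^sub>R c) sequentially"
          by (rule eventually_sequentiallyI[of n]) (use n in \<open>auto simp: indicator_def\<close>)
        then show "(\<lambda>i. ?s i x) \<longlonglongrightarrow> indicator A x *\<^sub>R c" by (rule tendsto_eventually)
      qed (use A iA in \<open>auto split: split_indicator\<close>)
    qed
  next
    case (add f g)
    show ?case
    proof (intro allI impI)
      fix e :: real assume "e > 0"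
      then have e2: "e / 2 > 0" by simp
      obtain u where u: "u \<in> Lip_bs" "(\<integral>x. \<bar>u x - f x\<bar> \<partial>M) < e / 2" using add e2 by blast
      obtain v where v: "v \<in> Lip_bs" "(\<integral>x. \<bar>v x - g x\<bar> \<partial>M) < e / 2" using add e2 by blast
      have "(\<integral>x. \<bar>u x + v x - (f x + g x)\<bar> \<partial>M) \<le> (\<integral>x. \<bar>u x - f x\<bar> + \<bar>v x - g x\<bar> \<partial>M)"
        using Li u v add by (intro integral_mono) auto
      also have "\<dots> = (\<integral>x. \<bar>u x - f x\<bar> \<partial>M) + (\<integral>x. \<bar>v x - g x\<bar> \<partial>M)"
        using Li u v add by (intro Bochner_Integration.integral_add) auto
      also have "\<dots> < e" using u v by simp
      finally show "\<exists>h\<in>Lip_bs. (\<integral>x. \<bar>h x - (f x + g x)\<bar> \<partial>M) < e"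
        by (rule bexI[where x="\<lambda>x. u x + v x", OF _ Lip_bs_add[OF u(1) v(1)]])
    qed
  next
    case (lim f s)
    show ?case
    proof (intro allI impI, rule close[where s=s])
      show "(\<lambda>i. \<integral>x. \<bar>s i x - f x\<bar> \<partial>M) \<longlonglongrightarrow> 0"
        by (rule L1_dominated_convergence[where w="\<lambda>x. 2 * norm (f x)"]) (use lim in auto)
    qed (use lim in auto)
  qed
qed

section \<open>Bounded functionals as integrals against bounded densities\<close>

context
  fixes L :: "'a::metric_space current0" and M :: "'a measure"
  assumes M: "loc_finite M" and lin: "linear_on_Lip_bs L"
    and bd: "\<And>f. f \<in> Lip_bs \<Longrightarrow> \<bar>L f\<bar> \<le> (\<integral>x. \<bar>f x\<bar> \<partial>M)"
begin

private lemma Lin: "f \<in> Lip_bs \<Longrightarrow> g \<in> Lip_bs \<Longrightarrow> L (\<lambda>x. a * f x + b * g x) = a * L f + b * L g"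
  using lin by (auto simp: linear_on_Lip_bs_def)

private lemma Ldiff: "f \<in> Lip_bs \<Longrightarrow> g \<in> Lip_bs \<Longrightarrow> \<bar>L f - L g\<bar> \<le> (\<integral>x. \<bar>f x - g x\<bar> \<partial>M)"
  using bd[OF Lip_bs_diff, of f g] Lin[of f g 1 "-1"] by simp

private lemma Li: "f \<in> Lip_bs \<Longrightarrow> integrable M f"
  using integrable_Lip_bs[OF M, of f] by auto

text \<open>The unique \<open>L\<^sup>1\<close>-continuous extension of \<open>L\<close>.\<close>

private definition ext :: "('a \<Rightarrow> real) \<Rightarrow> real"
  where "ext u = (INF f\<in>Lip_bs. L f + (\<integral>x. \<bar>f x - u x\<bar> \<partial>M))"

text \<open>\<open>ext\<close> is the McShane extension of \<open>L\<close>, which is 1-Lipschitz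
  for the L1 distance. The inequality \<open>low\<close> bounds the infimum from below and gives one
  half of the estimate.\<close>

private lemma ext_close:
  assumes u: "integrable M u" and f: "f \<in> Lip_bs"
  shows "\<bar>L f - ext u\<bar> \<le> (\<integral>x. \<bar>f x - u x\<bar> \<partial>M)"
proof -
  have low: "L f - (\<integral>x. \<bar>f x - u x\<bar> \<partial>M) \<le> L g + (\<integral>x. \<bar>g x - u x\<bar> \<partial>M)" if g: "g \<in> Lip_bs" for g
  proof -
    have "(\<integral>x. \<bar>f x - g x\<bar> \<partial>M) \<le> (\<integral>x. \<bar>f x - u x\<bar> \<partial>M) + (\<integral>x. \<bar>u x - g x\<bar> \<partial>M)"
      using Li f g u by (intro L1_triangle) auto
    moreover have "(\<integral>x. \<bar>u x - g x\<bar> \<partial>M) = (\<integral>x. \<bar>g x - u x\<bar> \<partial>M)"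
      by (simp add: abs_minus_commute)
    ultimately show ?thesis using Ldiff[OF f g] by linarith
  qed
  then have "ext u \<le> L f + (\<integral>x. \<bar>f x - u x\<bar> \<partial>M)"
    unfolding ext_def using f by (intro cINF_lower bdd_belowI2) auto
  moreover have "L f - (\<integral>x. \<bar>f x - u x\<bar> \<partial>M) \<le> ext u"
    unfolding ext_def using f low by (intro cINF_greatest) auto
  ultimately show ?thesis by linarith
qed

private lemma ext_eq: "f \<in> Lip_bs \<Longrightarrow> ext f = L f"
  using ext_close[OF Li, of f f] by simp

text \<open>The infimum formula is not visibly linear. Linearity is inherited from \<open>L\<close>
  by density: near \<open>u\<close> and \<open>v\<close> there are functions of
  \<open>Lip_bs\<close> at which \<open>ext\<close> is controlled by
  \<open>ext_close\<close>.\<close>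

private lemma ext_lincomb:
  assumes u: "integrable M u" and v: "integrable M v"
  shows "ext (\<lambda>x. a * u x + b * v x) = a * ext u + b * ext v"
proof -
  have "\<bar>ext (\<lambda>x. a * u x + b * v x) - (a * ext u + b * ext v)\<bar> \<le> 0 + e" if e: "e > 0" for e
  proof -
    \<comment> \<open>The summand 1 keeps the denominator positive when \<open>a\<close> and
      \<open>b\<close> both vanish.\<close>
    define d where "d = e / (2 * (\<bar>a\<bar> + \<bar>b\<bar> + 1))"
    have d: "d > 0" using e by (auto simp: d_def)
    obtain f where f: "f \<in> Lip_bs" "(\<integral>x. \<bar>f x - u x\<bar> \<partial>M) < d" using Lip_bs_dense[OF M u] d by blast
    obtain g where g: "g \<in> Lip_bs" "(\<integral>x. \<bar>g x - v x\<bar> \<partial>M) < d" using Lip_bs_dense[OF M v] d by blast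
    have h: "(\<lambda>x. a * f x + b * g x) \<in> Lip_bs" using f g by (intro Lip_bs_lincomb)
    have int: "integrable M (\<lambda>x. a * u x + b * v x)" using u v by auto
    have "(\<integral>x. \<bar>a * f x + b * g x - (a * u x + b * v x)\<bar> \<partial>M)
        \<le> (\<integral>x. \<bar>a\<bar> * \<bar>f x - u x\<bar> + \<bar>b\<bar> * \<bar>g x - v x\<bar> \<partial>M)"
    proof (rule integral_mono)
      fix x
      have "a * f x + b * g x - (a * u x + b * v x) = a * (f x - u x) + b * (g x - v x)"
        by (simp add: algebra_simps)
      then show "\<bar>a * f x + b * g x - (a * u x + b * v x)\<bar> \<le> \<bar>a\<bar> * \<bar>f x - u x\<bar> + \<bar>b\<bar> * \<bar>g x - v x\<bar>"
        by (metis abs_mult abs_triangle_ineq)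
    qed (use Li f g u v in auto)
    also have "\<dots> = \<bar>a\<bar> * (\<integral>x. \<bar>f x - u x\<bar> \<partial>M) + \<bar>b\<bar> * (\<integral>x. \<bar>g x - v x\<bar> \<partial>M)"
      using Li f g u v by simp
    finally have 1: "\<bar>L (\<lambda>x. a * f x + b * g x) - ext (\<lambda>x. a * u x + b * v x)\<bar>
        \<le> \<bar>a\<bar> * (\<integral>x. \<bar>f x - u x\<bar> \<partial>M) + \<bar>b\<bar> * (\<integral>x. \<bar>g x - v x\<bar> \<partial>M)"
      using ext_close[OF int h] by linarith
    have 2: "\<bar>a * L f - a * ext u\<bar> \<le> \<bar>a\<bar> * (\<integral>x. \<bar>f x - u x\<bar> \<partial>M)"
      using ext_close[OF u f(1)] by (simp add: abs_mult mult_left_mono flip: right_diff_distrib)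
    have 3: "\<bar>b * L g - b * ext v\<bar> \<le> \<bar>b\<bar> * (\<integral>x. \<bar>g x - v x\<bar> \<partial>M)"
      using ext_close[OF v g(1)] by (simp add: abs_mult mult_left_mono flip: right_diff_distrib)
    have "\<bar>a\<bar> * (\<integral>x. \<bar>f x - u x\<bar> \<partial>M) + \<bar>b\<bar> * (\<integral>x. \<bar>g x - v x\<bar> \<partial>M) \<le> \<bar>a\<bar> * d + \<bar>b\<bar> * d"
      using f g by (intro add_mono mult_left_mono) auto
    moreover have "\<bar>a\<bar> * d + \<bar>b\<bar> * d \<le> e / 2"
    proof -
      have "\<bar>a\<bar> * d + \<bar>b\<bar> * d \<le> (\<bar>a\<bar> + \<bar>b\<bar> + 1) * d" using d by (simp add: algebra_simps)
      also have "\<dots> = e / 2" proof -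
        have "\<bar>a\<bar> + \<bar>b\<bar> + 1 \<noteq> 0" by linarith
        then show ?thesis unfolding d_def by (simp only: times_divide_eq_right) (simp add: divide_simps)
      qed
      finally show ?thesis .
    qed
    ultimately show ?thesis using 1 2 3 Lin[OF f(1) g(1), of a b] by linarith
  qed
  then have "\<bar>ext (\<lambda>x. a * u x + b * v x) - (a * ext u + b * ext v)\<bar> \<le> 0"
    by (rule field_le_epsilon)
  then show ?thesis by simp
qed

private lemma ext_bound:
  assumes u: "integrable M u" shows "\<bar>ext u\<bar> \<le> (\<integral>x. \<bar>u x\<bar> \<partial>M)"
proof (rule field_le_epsilon)
  fix e :: real assume "e > 0"
  then obtain f where f: "f \<in> Lip_bs" "(\<integral>x. \<bar>f x - u x\<bar> \<partial>M) < e / 2"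
    using Lip_bs_dense[OF M u] by (meson half_gt_zero)
  have "(\<integral>x. \<bar>f x - 0\<bar> \<partial>M) \<le> (\<integral>x. \<bar>f x - u x\<bar> \<partial>M) + (\<integral>x. \<bar>u x - 0\<bar> \<partial>M)"
    using Li f u by (intro L1_triangle) auto
  then show "\<bar>ext u\<bar> \<le> (\<integral>x. \<bar>u x\<bar> \<partial>M) + e"
    using ext_close[OF u f(1)] bd[OF f(1)] f(2) by simp
qed

private lemma ext_diff_bound:
  assumes u: "integrable M u" and v: "integrable M v"
  shows "\<bar>ext u - ext v\<bar> \<le> (\<integral>x. \<bar>u x - v x\<bar> \<partial>M)"
  using ext_lincomb[OF u v, of 1 "-1"] ext_bound[of "\<lambda>x. u x - v x"] u v by simp

private lemma ext_sum:
  "finite I \<Longrightarrow> (\<And>i. i \<in> I \<Longrightarrow> integrable M (u i)) \<Longrightarrow> ext (\<lambda>x. \<Sum>i\<in>I. u i x) = (\<Sum>i\<in>I. ext (u i))"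
proof (induction I rule: finite_induct)
  case empty
  then show ?case using ext_bound[of "\<lambda>x. 0"] by simp
next
  case (insert i I)
  then show ?case using ext_lincomb[of "u i" "\<lambda>x. \<Sum>i\<in>I. u i x" 1 1] by simp
qed

private lemma int_ind: "B \<in> bounded_borel \<Longrightarrow> integrable M (indicator B :: 'a \<Rightarrow> real)"
  using M by (auto simp: integrable_indicator_iff loc_finite_def bounded_borel_def)

text \<open>Adding \<open>M\<close> to the signed set function makes it nonnegative, because
  \<open>ext\<close> is dominated by \<open>M\<close>. Countable additivity holds since the error of
  a partial sum is at most the \<open>M\<close>-measure of the remaining tail.\<close>

private lemma ext_set_function: "(\<lambda>B. ext (indicator B) + measure M B) \<in> M\<^sub>0\<^sub>b_nonneg"
proof -
  have sM: "sets M = sets borel" by (rule loc_finite_sets[OF M])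
  define \<nu> where "\<nu> B = ext (indicator B) + measure M B" for B
  have e: "\<bar>ext (indicator B)\<bar> \<le> measure M B" if "B \<in> bounded_borel" for B
    using ext_bound[OF int_ind[OF that]] by (simp add: loc_finite_space[OF M])
  have empty: "\<nu> {} = 0" using e[of "{}"] by (simp add: \<nu>_def bounded_borel_def)
  have m0: "(\<lambda>B. measure M (U \<inter> B)) \<in> M\<^sub>0" if "U \<in> bounded_borel" for U
    using M0b_nonneg_measure[OF M] that by (auto simp: M\<^sub>0\<^sub>b_nonneg_def M\<^sub>0\<^sub>b_def)
  have "(\<lambda>B. \<nu> (U \<inter> B)) \<in> M\<^sub>0" if U: "U \<in> bounded_borel" for U
  proof -
    have "(\<lambda>n. \<nu> (U \<inter> A n)) sums \<nu> (U \<inter> (\<Union>n. A n))"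
      if A: "range A \<subseteq> sets borel" "disjoint_family A" for A :: "nat \<Rightarrow> 'a set"
    proof -
      have Ab: "U \<inter> A n \<in> bounded_borel" for n using A U by (intro bounded_borel_Int) auto
      have Ub: "U \<inter> (\<Union>n. A n) \<in> bounded_borel" using A U by (intro bounded_borel_Int) auto
      have ms: "(\<lambda>n. measure M (U \<inter> A n)) sums measure M (U \<inter> (\<Union>n. A n))"
        using m0[OF U] A by (auto simp: M\<^sub>0_def finite_signed_borel_measure_def)
      have "(\<lambda>n. ext (indicator (U \<inter> A n))) sums ext (indicator (U \<inter> (\<Union>n. A n)))"
        unfolding sums_def
      proof (rule LIM_zero_cancel, rule Lim_null_comparison)
        show "(\<lambda>n. measure M (U \<inter> (\<Union>n. A n)) - (\<Sum>i<n. measure M (U \<inter> A i))) \<longlonglongrightarrow> 0"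
          using ms unfolding sums_def by (auto intro!: tendsto_eq_intros)
        have "\<bar>(\<Sum>i<n. ext (indicator (U \<inter> A i))) - ext (indicator (U \<inter> (\<Union>n. A n)))\<bar>
            \<le> measure M (U \<inter> (\<Union>n. A n)) - (\<Sum>i<n. measure M (U \<inter> A i))" for n
        proof -
          have i1: "integrable M (\<lambda>x. \<Sum>i<n. indicator (U \<inter> A i) x :: real)"
            using int_ind[OF Ab] by auto
          have le: "(\<Sum>i<n. indicator (U \<inter> A i) x) \<le> (indicator (U \<inter> (\<Union>n. A n)) x :: real)" for x
          proof -
            have "(\<Sum>i<n. indicator (U \<inter> A i) x) = (indicator (\<Union>i<n. U \<inter> A i) x :: real)"
              using A(2) by (intro indicator_UN_disjoint[symmetric]) (auto simp: disjoint_family_on_def)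
            also have "\<dots> \<le> indicator (U \<inter> (\<Union>n. A n)) x" by (auto simp: indicator_def)
            finally show ?thesis .
          qed
          have "(\<Sum>i<n. ext (indicator (U \<inter> A i))) = ext (\<lambda>x. \<Sum>i<n. indicator (U \<inter> A i) x)"
            by (rule ext_sum[symmetric]) (use int_ind[OF Ab] in auto)
          then have "\<bar>(\<Sum>i<n. ext (indicator (U \<inter> A i))) - ext (indicator (U \<inter> (\<Union>n. A n)))\<bar>
              \<le> (\<integral>x. \<bar>(\<Sum>i<n. indicator (U \<inter> A i) x) - indicator (U \<inter> (\<Union>n. A n)) x\<bar> \<partial>M)"
            using ext_diff_bound[OF i1 int_ind[OF Ub]] by simp
          also have "\<dots> = (\<integral>x. indicator (U \<inter> (\<Union>n. A n)) x - (\<Sum>i<n. indicator (U \<inter> A i) x) \<partial>M)"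
            using le by (intro Bochner_Integration.integral_cong refl) (simp add: abs_of_nonpos)
          also have "\<dots> = measure M (U \<inter> (\<Union>n. A n)) - (\<Sum>i<n. measure M (U \<inter> A i))"
            using int_ind[OF Ab] int_ind[OF Ub] Bochner_Integration.integral_diff[OF int_ind[OF Ub] i1]
            by (simp add: Bochner_Integration.integral_sum loc_finite_space[OF M])
          finally show ?thesis .
        qed
        then show "\<forall>\<^sub>F n in sequentially. norm ((\<Sum>i<n. ext (indicator (U \<inter> A i))) - ext (indicator (U \<inter> (\<Union>n. A n))))
            \<le> measure M (U \<inter> (\<Union>n. A n)) - (\<Sum>i<n. measure M (U \<inter> A i))" by simp
      qed
      from sums_add[OF this ms] show ?thesis by (simp add: \<nu>_def)
    qed
    moreover obtain K where "sigma_compact K" "\<forall>B\<in>sets borel. B \<inter> K = {} \<longrightarrow> measure M (U \<inter> B) = 0"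
      using m0[OF U] by (auto simp: M\<^sub>0_def)
    then have "\<exists>K. sigma_compact K \<and> (\<forall>B\<in>sets borel. B \<inter> K = {} \<longrightarrow> \<nu> (U \<inter> B) = 0)"
    proof (intro exI[of _ K] conjI ballI impI)
      fix B :: "'a set" assume "B \<in> sets borel" "B \<inter> K = {}"
      then show "\<nu> (U \<inter> B) = 0"
        using e[OF bounded_borel_Int[OF U, of B]] \<open>\<forall>B\<in>sets borel. B \<inter> K = {} \<longrightarrow> measure M (U \<inter> B) = 0\<close>
        by (simp add: \<nu>_def)
    qed
    ultimately show ?thesis
      using empty by (auto simp: M\<^sub>0_def finite_signed_borel_measure_def)
  qed
  moreover have "0 \<le> \<nu> B" if "B \<in> bounded_borel" for B using e[OF that] by (simp add: \<nu>_def)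
  ultimately show ?thesis by (simp add: M\<^sub>0\<^sub>b_nonneg_def M\<^sub>0\<^sub>b_def \<nu>_def)
qed

text \<open>The duality between L1 and bounded functions. The shifted set function \<nu> lies
  between 0 and \<open>2 * M\<close>, so it has a density in [0, 2]; subtracting 1 removes the added
  copy of \<open>M\<close>. Equality then spreads from indicators of bounded sets to all integrable
  functions.\<close>

lemma functional_density:
  "\<exists>g \<in> borel_measurable borel. (\<forall>x. \<bar>g x\<bar> \<le> 1) \<and> (\<forall>f\<in>Lip_bs. L f = (\<integral>x. f x * g x \<partial>M))"
proof -
  have sM[measurable_cong]: "sets M = sets borel" by (rule loc_finite_sets[OF M])
  define \<nu> where "\<nu> B = ext (indicator B) + measure M B" for B
  have \<nu>: "\<nu> \<in> M\<^sub>0\<^sub>b_nonneg" using ext_set_function by (simp add: \<nu>_def[abs_def])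
  let ?N = "borel_extension \<nu>"
  have "emeasure ?N B \<le> ennreal 2 * emeasure M B" if B: "B \<in> bounded_borel" for B
  proof -
    have "\<nu> B \<le> 2 * measure M B" using ext_bound[OF int_ind[OF B]] by (simp add: \<nu>_def loc_finite_space[OF M])
    then show ?thesis
      using emeasure_borel_extension_bounded[OF \<nu> B] loc_finite_emeasure[OF M B]
      by (metis ennreal_leI ennreal_mult measure_nonneg zero_le_numeral)
  qed
  then obtain h where h[measurable]: "h \<in> borel_measurable borel" and h01: "\<And>x. 0 \<le> h x" "\<And>x. h x \<le> 2"
      and Nh: "?N = density M (\<lambda>x. ennreal (h x))"
    using loc_finite_Radon_Nikodym[OF M loc_finite_borel_extension[OF \<nu>], of 2] by (metis zero_le_numeral)
  define g where "g x = h x - 1" for x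
  have g[measurable]: "g \<in> borel_measurable borel" unfolding g_def by measurable
  have g1: "\<bar>g x\<bar> \<le> 1" for x using h01[of x] by (auto simp: g_def)
  have intg: "integrable M (\<lambda>x. u x * g x)" if u: "integrable M u" for u
  proof (rule Bochner_Integration.integrable_bound[OF integrable_abs[OF u]])
    show "AE x in M. norm (u x * g x) \<le> norm \<bar>u x\<bar>"
      using g1 by (intro AE_I2) (auto simp: abs_mult intro: mult_left_le)
  qed (use borel_measurable_integrable[OF u] in measurable)
  have gdiff: "\<bar>(\<integral>x. u x * g x \<partial>M) - (\<integral>x. v x * g x \<partial>M)\<bar> \<le> (\<integral>x. \<bar>u x - v x\<bar> \<partial>M)"
    if u: "integrable M u" and v: "integrable M v" for u v
  proof -
    have "(\<integral>x. u x * g x \<partial>M) - (\<integral>x. v x * g x \<partial>M) = (\<integral>x. u x * g x - v x * g x \<partial>M)"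
      using intg u v by simp
    also have "\<bar>\<dots>\<bar> \<le> (\<integral>x. \<bar>u x - v x\<bar> \<partial>M)"
    proof (rule order_trans[OF integral_abs_bound], rule integral_mono)
      fix x
      have "\<bar>u x * g x - v x * g x\<bar> = \<bar>u x - v x\<bar> * \<bar>g x\<bar>" by (simp add: abs_mult flip: left_diff_distrib)
      then show "\<bar>u x * g x - v x * g x\<bar> \<le> \<bar>u x - v x\<bar>" using g1[of x] by (simp add: mult_left_le)
    qed (use intg u v in auto)
    finally show ?thesis .
  qed
  \<comment> \<open>Both sides are continuous for the L1 distance, so the identity passes to L1
    limits.\<close>
  have lim_eq: "ext u = (\<integral>x. u x * g x \<partial>M)"
    if u: "integrable M u" and s: "\<And>i. integrable M (s i)" "\<And>i. ext (s i) = (\<integral>x. s i x * g x \<partial>M)"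
      and lim: "(\<lambda>i. \<integral>x. \<bar>s i x - u x\<bar> \<partial>M) \<longlonglongrightarrow> 0" for u and s :: "nat \<Rightarrow> 'a \<Rightarrow> real"
  proof -
    have "(\<lambda>i. ext (s i)) \<longlonglongrightarrow> ext u"
      by (rule LIM_zero_cancel, rule Lim_null_comparison[OF _ lim]) (use ext_diff_bound[OF s(1) u] in simp)
    moreover have "(\<lambda>i. ext (s i)) \<longlonglongrightarrow> (\<integral>x. u x * g x \<partial>M)"
      by (rule LIM_zero_cancel, rule Lim_null_comparison[OF _ lim]) (use gdiff[OF s(1) u] s(2) in simp)
    ultimately show ?thesis by (rule LIMSEQ_unique)
  qed
  have ind: "ext (indicator B) = (\<integral>x. indicator B x * g x \<partial>M)" if B: "B \<in> bounded_borel" for B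
  proof -
    have [measurable]: "B \<in> sets borel" using B by (simp add: bounded_borel_def)
    have "\<nu> B = measure ?N B" using measure_borel_extension_bounded[OF \<nu> B] by simp
    also have "\<dots> = (\<integral>x. indicator B x \<partial>?N)" using loc_finite_sets[OF loc_finite_borel_extension[OF \<nu>]] by simp
    also have "\<dots> = (\<integral>x. h x *\<^sub>R indicator B x \<partial>M)"
      unfolding Nh by (rule integral_density) (auto simp: h01)
    also have "\<dots> = (\<integral>x. indicator B x * g x + indicator B x \<partial>M)"
      by (rule Bochner_Integration.integral_cong) (auto simp: g_def algebra_simps)
    also have "\<dots> = (\<integral>x. indicator B x * g x \<partial>M) + measure M B"
      using intg[OF int_ind[OF B]] int_ind[OF B] by (simp add: sM)
    finally show ?thesis by (simp add: \<nu>_def)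
  qed
  have all: "ext u = (\<integral>x. u x * g x \<partial>M)" if "integrable M u" for u
    using that
  proof (induction rule: integrable_induct)
    case (base A c)
    then have A: "A \<in> sets borel" using sM by simp
    let ?s = "\<lambda>n x. indicator (A \<inter> ball undefined (real n)) x *\<^sub>R c :: real"
    show ?case
    proof (rule lim_eq[where s="?s"])
      fix i
      have AB: "A \<inter> ball undefined (real i) \<in> bounded_borel"
        using A by (intro bounded_borel_Int2 ball_bounded_borel)
      show "integrable M (?s i)" using int_ind[OF AB] by simp
      have "ext (?s i) = c * ext (indicator (A \<inter> ball undefined (real i)))"
        using ext_lincomb[OF int_ind[OF AB] int_ind[OF AB], of c 0] by (simp add: mult.commute)
      also have "\<dots> = (\<integral>x. ?s i x * g x \<partial>M)"
        using ind[OF AB] by (simp add: mult.assoc mult.left_commute flip: integral_mult_right_zero)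
      finally show "ext (?s i) = (\<integral>x. ?s i x * g x \<partial>M)" .
    next
      show iA: "integrable M (\<lambda>x. indicator A x *\<^sub>R c)" using base by auto
      show "(\<lambda>i. \<integral>x. \<bar>?s i x - indicator A x *\<^sub>R c\<bar> \<partial>M) \<longlonglongrightarrow> 0"
      proof (rule L1_dominated_convergence[OF iA, where w="\<lambda>x. \<bar>indicator A x *\<^sub>R c\<bar>"])
        show "?s i \<in> borel_measurable M" for i
          using A sM by (intro borel_measurable_scaleR borel_measurable_indicator) auto
        fix x :: 'a
        have "x \<in> (\<Union>n. ball undefined (real n))" using UN_balls by blast
        then obtain n where n: "x \<in> ball undefined (real n)" by blast
        have "eventually (\<lambda>i. ?s i x = indicator A x *\<^sub>R c) sequentially"
          by (rule eventually_sequentiallyI[of n]) (use n in \<open>auto simp: indicator_def\<close>)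
        then show "(\<lambda>i. ?s i x) \<longlonglongrightarrow> indicator A x *\<^sub>R c" by (rule tendsto_eventually)
      qed (use A iA in \<open>auto split: split_indicator\<close>)
    qed
  next
    case (add f f')
    then show ?case using ext_lincomb[of f f' 1 1] intg[of f] intg[of f'] by (simp add: distrib_right)
  next
    case (lim f s)
    show ?case
    proof (rule lim_eq[where s=s])
      show "(\<lambda>i. \<integral>x. \<bar>s i x - f x\<bar> \<partial>M) \<longlonglongrightarrow> 0"
        by (rule L1_dominated_convergence[where w="\<lambda>x. 2 * norm (f x)"]) (use lim in auto)
    qed (use lim in auto)
  qed
  show ?thesis
    using all[OF Li] ext_eq g1 by (intro bexI[OF _ g]) auto
qed

end

section \<open>Comparison of densities by testing\<close>

lemma AE_le_if_bounded_borel_le: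
  fixes u v :: "'a::metric_space \<Rightarrow> real"
  assumes M: "loc_finite M" and u[measurable]: "u \<in> borel_measurable borel" and v[measurable]: "v \<in> borel_measurable borel"
    and C: "\<And>x. \<bar>u x\<bar> \<le> C" "\<And>x. \<bar>v x\<bar> \<le> C"
    and le: "\<And>B. B \<in> bounded_borel \<Longrightarrow> (\<integral>x. indicator B x * u x \<partial>M) \<le> (\<integral>x. indicator B x * v x \<partial>M)"
  shows "AE x in M. u x \<le> v x"
proof (rule AE_on_balls)
  fix n
  have [measurable_cong]: "sets M = sets borel" by (rule loc_finite_sets[OF M])
  have int: "integrable M (\<lambda>x. indicator B x * w x)"
    if B: "B \<in> bounded_borel" and [measurable]: "w \<in> borel_measurable borel" and w: "\<And>x. \<bar>w x\<bar> \<le> C" for B w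
  proof -
    have [measurable]: "B \<in> sets borel" using B by (simp add: bounded_borel_def)
    show ?thesis
    proof (rule loc_finite_integrable[OF M, where A=B and K=C])
      have "0 \<le> C" using w[of undefined] by linarith
      then show "\<bar>indicator B x * w x\<bar> \<le> C" for x using w[of x] by (simp split: split_indicator)
    qed (use B in \<open>auto simp: bounded_borel_def\<close>)
  qed
  define Z where "Z = ball undefined (real n) \<inter> {x. v x < u x}"
  have "{x. v x < u x} \<in> sets borel" by measurable
  then have Z: "Z \<in> bounded_borel" unfolding Z_def by (intro bounded_borel_Int ball_bounded_borel)
  have i: "integrable M (\<lambda>x. indicator Z x * u x)" "integrable M (\<lambda>x. indicator Z x * v x)"
    using Z u v C by (auto intro!: int)
  have nn: "0 \<le> indicator Z x * u x - indicator Z x * v x" for x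
    by (auto simp: Z_def split: split_indicator)
  have "(\<integral>x. indicator Z x * u x - indicator Z x * v x \<partial>M) \<le> 0"
    using le[OF Z] i by simp
  moreover have "0 \<le> (\<integral>x. indicator Z x * u x - indicator Z x * v x \<partial>M)"
    using nn by (intro integral_nonneg_AE) auto
  ultimately have "AE x in M. indicator Z x * u x - indicator Z x * v x = 0"
    using i nn by (subst integral_nonneg_eq_0_iff_AE[symmetric]) auto
  then show "AE x in M. x \<in> ball undefined (real n) \<longrightarrow> u x \<le> v x"
    by eventually_elim (auto simp: Z_def split: split_indicator_asm)
qed

text \<open>Reduces to indicators of bounded sets. The hypothesis covers nonnegative test functions
  only, so an approximant \<open>f\<close> of the indicator is replaced by its absolute value, which
  is at least as close.\<close>

lemma AE_le_if_Lip_bs_le: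
  fixes g k :: "'a::metric_space \<Rightarrow> real"
  assumes M: "loc_finite M" and g[measurable]: "g \<in> borel_measurable borel" and k[measurable]: "k \<in> borel_measurable borel"
    and C: "\<And>x. \<bar>g x\<bar> \<le> C" "\<And>x. \<bar>k x\<bar> \<le> C"
    and le: "\<And>f. f \<in> Lip_bs \<Longrightarrow> (\<And>x. 0 \<le> f x) \<Longrightarrow> (\<integral>x. f x * g x \<partial>M) \<le> (\<integral>x. f x * k x \<partial>M)"
  shows "AE x in M. g x \<le> k x"
proof (rule AE_le_if_bounded_borel_le[OF M g k C])
  fix B :: "'a set" assume B: "B \<in> bounded_borel"
  have Bs[measurable]: "B \<in> sets borel" using B by (simp add: bounded_borel_def)
  have sM[measurable_cong]: "sets M = sets borel" by (rule loc_finite_sets[OF M])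
  have iB: "integrable M (indicator B :: 'a \<Rightarrow> real)"
    using B M by (auto simp: integrable_indicator_iff loc_finite_def bounded_borel_def)
  have C0: "0 \<le> C" using C(1)[of undefined] by linarith
  have int: "integrable M (\<lambda>x. v x * w x)"
    if v: "integrable M v" and [measurable]: "w \<in> borel_measurable borel" and w: "\<And>x. \<bar>w x\<bar> \<le> C" for v w
  proof (rule Bochner_Integration.integrable_bound[where f="\<lambda>x. C * v x"])
    note [measurable] = borel_measurable_integrable[OF v]
    show "(\<lambda>x. v x * w x) \<in> borel_measurable M" by measurable
    show "AE x in M. norm (v x * w x) \<le> norm (C * v x)"
    proof (rule AE_I2)
      fix x show "norm (v x * w x) \<le> norm (C * v x)"
        using mult_right_mono[OF w[of x], of "\<bar>v x\<bar>"] C0 by (simp add: abs_mult mult.commute)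
    qed
  qed (use v in auto)
  have close: "\<bar>(\<integral>x. f x * w x \<partial>M) - (\<integral>x. indicator B x * w x \<partial>M)\<bar> \<le> C * (\<integral>x. \<bar>f x - indicator B x\<bar> \<partial>M)"
    if f: "integrable M f" and w: "w \<in> borel_measurable borel" "\<And>x. \<bar>w x\<bar> \<le> C" for f w
  proof -
    have "(\<integral>x. f x * w x \<partial>M) - (\<integral>x. indicator B x * w x \<partial>M) = (\<integral>x. f x * w x - indicator B x * w x \<partial>M)"
      using int[OF f w] int[OF iB w] by simp
    also have "\<bar>\<dots>\<bar> \<le> (\<integral>x. C * \<bar>f x - indicator B x\<bar> \<partial>M)"
    proof (rule order_trans[OF integral_abs_bound], rule integral_mono)
      fix x
      have "\<bar>f x * w x - indicator B x * w x\<bar> = \<bar>w x\<bar> * \<bar>f x - indicator B x\<bar>"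
        by (simp add: abs_mult flip: left_diff_distrib)
      then show "\<bar>f x * w x - indicator B x * w x\<bar> \<le> C * \<bar>f x - indicator B x\<bar>"
        using w(2)[of x] by (simp add: mult_right_mono)
    qed (use int[OF f w] int[OF iB w] f iB in auto)
    finally show ?thesis by simp
  qed
  show "(\<integral>x. indicator B x * g x \<partial>M) \<le> (\<integral>x. indicator B x * k x \<partial>M)"
  proof (rule field_le_epsilon)
    fix e :: real assume "e > 0"
    then have d: "e / (2 * (C + 1)) > 0" using C0 by simp
    obtain f where f: "f \<in> Lip_bs" "(\<integral>x. \<bar>f x - indicator B x\<bar> \<partial>M) < e / (2 * (C + 1))"
      using Lip_bs_approx_indicator[OF M B d] by blast
    have fi: "integrable M f" using integrable_Lip_bs[OF M f(1)] by simp
    have "(\<integral>x. \<bar>\<bar>f x\<bar> - indicator B x\<bar> \<partial>M) \<le> (\<integral>x. \<bar>f x - indicator B x\<bar> \<partial>M)"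
      using fi iB by (intro integral_mono) (auto split: split_indicator)
    then have "(\<integral>x. \<bar>\<bar>f x\<bar> - indicator B x\<bar> \<partial>M) \<le> e / (2 * (C + 1))" using f(2) by simp
    then have "C * (\<integral>x. \<bar>\<bar>f x\<bar> - indicator B x\<bar> \<partial>M) \<le> C * (e / (2 * (C + 1)))"
      using C0 by (rule mult_left_mono)
    also have "\<dots> \<le> e / 2" using C0 \<open>e > 0\<close> by (simp add: field_simps)
    finally have "C * (\<integral>x. \<bar>\<bar>f x\<bar> - indicator B x\<bar> \<partial>M) \<le> e / 2" .
    moreover have "(\<integral>x. \<bar>f x\<bar> * g x \<partial>M) \<le> (\<integral>x. \<bar>f x\<bar> * k x \<partial>M)"
      using f(1) by (intro le Lip_bs_abs) auto
    ultimately show "(\<integral>x. indicator B x * g x \<partial>M) \<le> (\<integral>x. indicator B x * k x \<partial>M) + e"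
      using close[OF integrable_abs[OF fi] g C(1)] close[OF integrable_abs[OF fi] k C(2)] by linarith
  qed
qed

lemma AE_eq_if_Lip_bs_eq:
  fixes g k :: "'a::metric_space \<Rightarrow> real"
  assumes "loc_finite M" "g \<in> borel_measurable borel" "k \<in> borel_measurable borel"
    and "\<And>x. \<bar>g x\<bar> \<le> C" "\<And>x. \<bar>k x\<bar> \<le> C"
    and "\<And>f. f \<in> Lip_bs \<Longrightarrow> (\<integral>x. f x * g x \<partial>M) = (\<integral>x. f x * k x \<partial>M)"
  shows "AE x in M. g x = k x"
proof -
  have "AE x in M. g x \<le> k x" "AE x in M. k x \<le> g x"
    using assms by (auto intro!: AE_le_if_Lip_bs_le[where C=C])
  then show ?thesis by eventually_elim simp
qed

lemma AE_abs_le_if_Lip_bs_le: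
  fixes g k :: "'a::metric_space \<Rightarrow> real"
  assumes M: "loc_finite M" and g: "g \<in> borel_measurable borel" and k: "k \<in> borel_measurable borel"
    and C: "\<And>x. \<bar>g x\<bar> \<le> C" "\<And>x. \<bar>k x\<bar> \<le> C"
    and le: "\<And>f. f \<in> Lip_bs \<Longrightarrow> \<bar>\<integral>x. f x * g x \<partial>M\<bar> \<le> (\<integral>x. \<bar>f x\<bar> * k x \<partial>M)"
  shows "AE x in M. \<bar>g x\<bar> \<le> k x"
proof -
  have "AE x in M. g x \<le> k x"
  proof (rule AE_le_if_Lip_bs_le[OF M g k C])
    fix f :: "'a \<Rightarrow> real" assume "f \<in> Lip_bs" "\<And>x. 0 \<le> f x"
    then show "(\<integral>x. f x * g x \<partial>M) \<le> (\<integral>x. f x * k x \<partial>M)" using le[of f] by simp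
  qed
  moreover have "AE x in M. - g x \<le> k x"
  proof (rule AE_le_if_Lip_bs_le[OF M _ k _ C(2)])
    fix f :: "'a \<Rightarrow> real" assume "f \<in> Lip_bs" "\<And>x. 0 \<le> f x"
    then show "(\<integral>x. f x * - g x \<partial>M) \<le> (\<integral>x. f x * k x \<partial>M)" using le[of f] by simp
  qed (use g C in auto)
  ultimately show ?thesis by eventually_elim auto
qed

lemma abs_integral_density_le:
  fixes g k :: "'a::metric_space \<Rightarrow> real"
  assumes M: "loc_finite M" and f: "f \<in> Lip_bs" and g: "g \<in> borel_measurable borel" and k: "k \<in> borel_measurable borel"
    and C: "\<And>x. \<bar>g x\<bar> \<le> C" "\<And>x. \<bar>k x\<bar> \<le> C" and le: "AE x in M. \<bar>g x\<bar> \<le> k x"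
  shows "\<bar>\<integral>x. f x * g x \<partial>M\<bar> \<le> (\<integral>x. \<bar>f x\<bar> * k x \<partial>M)"
proof (rule order_trans[OF integral_abs_bound], rule integral_mono_AE)
  show "AE x in M. \<bar>f x * g x\<bar> \<le> \<bar>f x\<bar> * k x"
    using le by eventually_elim (auto simp: abs_mult intro: mult_left_mono)
qed (use Lip_bs_integrable(1)[OF M f g C(1)] Lip_bs_integrable(1)[OF M Lip_bs_abs[OF f] k C(2)] in auto)

section \<open>Masses of families of functionals\<close>

text \<open>Both masses are instances of the least measure dominating a family of functionals on
  \<open>Lip_bs\<close>: a single one in dimension 0, the functionals \<open>f \<mapsto> T (f d\<pi>)\<close> with
  \<open>Lip \<pi> \<le> 1\<close> in dimension 1.\<close>

definition fam_bound :: "'i set \<Rightarrow> ('i \<Rightarrow> 'a::metric_space current0) \<Rightarrow> 'a measure \<Rightarrow> bool"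
  where "fam_bound I L M \<longleftrightarrow> (\<forall>i\<in>I. \<forall>f\<in>Lip_bs. \<bar>L i f\<bar> \<le> (\<integral>x. \<bar>f x\<bar> \<partial>M))"

definition fam_mass :: "'i set \<Rightarrow> ('i \<Rightarrow> 'a::metric_space current0) \<Rightarrow> 'a measure"
  where "fam_mass I L = least_measure {\<mu> \<in> M\<^sub>0\<^sub>b_nonneg. fam_bound I L (borel_extension \<mu>)}"

lemma integral_density_Lip_bs:
  assumes M: "loc_finite M" and f: "f \<in> borel_measurable borel" and k: "k \<in> borel_measurable borel" "\<And>x. 0 \<le> k x"
  shows "(\<integral>x. \<bar>f x\<bar> \<partial>density M (\<lambda>x. ennreal (k x))) = (\<integral>x. \<bar>f x\<bar> * k x \<partial>M)"
  using f k by (subst integral_density) (auto simp: loc_finite_measurable[OF M] mult.commute)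

lemma fam_bound_density:
  assumes "loc_finite M" "k \<in> borel_measurable borel" "\<And>x. 0 \<le> k x"
  shows "fam_bound I L (density M (\<lambda>x. ennreal (k x))) \<longleftrightarrow> (\<forall>i\<in>I. \<forall>f\<in>Lip_bs. \<bar>L i f\<bar> \<le> (\<integral>x. \<bar>f x\<bar> * k x \<partial>M))"
  using assms by (auto simp: fam_bound_def integral_density_Lip_bs Lip_bs_measurable)

lemma emeasure_density_mono:
  fixes k k' :: "'a::metric_space \<Rightarrow> real"
  assumes M: "loc_finite M" and [measurable]: "k \<in> borel_measurable borel" "k' \<in> borel_measurable borel"
    and le: "AE x in M. k x \<le> k' x" and B: "B \<in> sets borel"
  shows "emeasure (density M (\<lambda>x. ennreal (k x))) B \<le> emeasure (density M (\<lambda>x. ennreal (k' x))) B"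
proof -
  have [measurable_cong]: "sets M = sets borel" by (rule loc_finite_sets[OF M])
  have "AE x in M. ennreal (k x) * indicator B x \<le> ennreal (k' x) * indicator B x"
    using le by eventually_elim (auto intro: ennreal_leI mult_right_mono)
  then show ?thesis using B
    by (subst (1 2) emeasure_density) (auto intro!: nn_integral_mono_AE)
qed

lemma fam_density:
  assumes M: "loc_finite M" and lin: "\<And>i. i \<in> I \<Longrightarrow> linear_on_Lip_bs (L i)" and bd: "fam_bound I L M"
  obtains g where "\<And>i. i \<in> I \<Longrightarrow> g i \<in> borel_measurable borel" "\<And>i x. i \<in> I \<Longrightarrow> \<bar>g i x\<bar> \<le> 1"
    "\<And>i f. i \<in> I \<Longrightarrow> f \<in> Lip_bs \<Longrightarrow> L i f = (\<integral>x. f x * g i x \<partial>M)"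
proof -
  have "\<forall>i\<in>I. \<exists>g. g \<in> borel_measurable borel \<and> (\<forall>x. \<bar>g x\<bar> \<le> 1) \<and> (\<forall>f\<in>Lip_bs. L i f = (\<integral>x. f x * g x \<partial>M))"
    using functional_density[OF M lin] bd unfolding fam_bound_def by blast
  from bchoice[OF this] obtain g where "\<forall>i\<in>I. g i \<in> borel_measurable borel \<and> (\<forall>x. \<bar>g i x\<bar> \<le> 1) \<and>
      (\<forall>f\<in>Lip_bs. L i f = (\<integral>x. f x * g i x \<partial>M))" ..
  then show ?thesis by (intro that[of g]) auto
qed

text \<open>A positive integrable weight turns the search for a least density into the minimisation
  of a finite number, even when \<open>M\<close> has infinite total mass.\<close>

lemma loc_finite_weight:
  assumes M: "loc_finite M"
  obtains w :: "'a::metric_space \<Rightarrow> real" where "w \<in> borel_measurable borel" "\<And>x. 0 < w x" "integrable M w"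
proof -
  interpret sigma_finite_measure M by (rule loc_finite_sigma_finite[OF M])
  obtain h where h: "h \<in> borel_measurable M" "integral\<^sup>N M h \<noteq> \<infinity>" "\<And>x. 0 < h x" "\<And>x. h x < \<infinity>"
    using Ex_finite_integrable_function by (auto simp: loc_finite_space[OF M])
  define w where "w x = enn2real (h x)" for x
  have w[measurable]: "w \<in> borel_measurable M" using h(1) unfolding w_def by measurable
  have eq: "ennreal (w x) = h x" for x using h(4)[of x] by (simp add: w_def)
  show ?thesis
  proof (rule that)
    show "w \<in> borel_measurable borel" using w by (simp add: loc_finite_measurable[OF M])
    show "0 < w x" for x using h(3,4)[of x] by (simp add: w_def enn2real_positive_iff)
    show "integrable M w"
      by (rule integrableI_nonneg) (use h(2) w in \<open>auto simp: eq less_top, auto simp: w_def\<close>)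
  qed
qed

text \<open>For functionals with densities \<open>g i\<close> this is the essential supremum of the
  absolute values of the \<open>g i\<close>. It is phrased by minimality because the index set is
  uncountable in dimension 1, where a pointwise supremum need not be measurable.\<close>

definition least_density :: "'i set \<Rightarrow> ('i \<Rightarrow> 'a::metric_space current0) \<Rightarrow> 'a measure \<Rightarrow> ('a \<Rightarrow> real) \<Rightarrow> bool"
  where "least_density I L M k \<longleftrightarrow> k \<in> borel_measurable borel \<and> (\<forall>x. 0 \<le> k x) \<and> (\<forall>x. k x \<le> 1) \<and>
    fam_bound I L (density M (\<lambda>x. ennreal (k x))) \<and>
    (\<forall>k' C. k' \<in> borel_measurable borel \<longrightarrow> (\<forall>x. 0 \<le> k' x) \<longrightarrow> (\<forall>x. k' x \<le> C) \<longrightarrow>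
      fam_bound I L (density M (\<lambda>x. ennreal (k' x))) \<longrightarrow> (AE x in M. k x \<le> k' x))"

lemma least_densityD:
  assumes "least_density I L M k"
  shows "k \<in> borel_measurable borel" "\<And>x. 0 \<le> k x" "\<And>x. k x \<le> 1"
    "fam_bound I L (density M (\<lambda>x. ennreal (k x)))"
    "\<And>k' C. k' \<in> borel_measurable borel \<Longrightarrow> (\<And>x. 0 \<le> k' x) \<Longrightarrow> (\<And>x. k' x \<le> C) \<Longrightarrow>
      fam_bound I L (density M (\<lambda>x. ennreal (k' x))) \<Longrightarrow> AE x in M. k x \<le> k' x"
  using assms unfolding least_density_def by blast+

text \<open>Among the admissible densities one minimises a weighted integral. Admissibility means
  one almost-everywhere inequality per index and is therefore stable under countable infima, so the
  infimum of a minimising sequence is a minimiser.\<close>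

lemma least_density_exists:
  fixes M :: "'a::metric_space measure"
  assumes M: "loc_finite M" and lin: "\<And>i. i \<in> I \<Longrightarrow> linear_on_Lip_bs (L i)" and bd: "fam_bound I L M"
  shows "\<exists>k. least_density I L M k"
proof -
  have sM[measurable_cong]: "sets M = sets borel" by (rule loc_finite_sets[OF M])
  obtain g where g: "\<And>i. i \<in> I \<Longrightarrow> g i \<in> borel_measurable borel" "\<And>i x. i \<in> I \<Longrightarrow> \<bar>g i x\<bar> \<le> 1"
    "\<And>i f. i \<in> I \<Longrightarrow> f \<in> Lip_bs \<Longrightarrow> L i f = (\<integral>x. f x * g i x \<partial>M)"
    using fam_density[OF M lin bd] by blast
  obtain w :: "'a \<Rightarrow> real" where w[measurable]: "w \<in> borel_measurable borel" and w0: "\<And>x. 0 < w x" and wi: "integrable M w"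
    using loc_finite_weight[OF M] by blast
  define K where "K = {k \<in> borel_measurable borel. (\<forall>x. 0 \<le> k x \<and> k x \<le> 1) \<and> (\<forall>i\<in>I. AE x in M. \<bar>g i x\<bar> \<le> k x)}"
  have bound_iff: "fam_bound I L (density M (\<lambda>x. ennreal (k x))) \<longleftrightarrow> (\<forall>i\<in>I. AE x in M. \<bar>g i x\<bar> \<le> k x)"
    if k: "k \<in> borel_measurable borel" "\<And>x. 0 \<le> k x" "\<And>x. k x \<le> C" for k C
  proof
    have C: "\<bar>k x\<bar> \<le> max 1 C" "i \<in> I \<Longrightarrow> \<bar>g i x\<bar> \<le> max 1 C" for x i
      using k(2,3)[of x] g(2)[of i x] by (auto simp: max_def)
    show "\<forall>i\<in>I. AE x in M. \<bar>g i x\<bar> \<le> k x" if "fam_bound I L (density M (\<lambda>x. ennreal (k x)))"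
      using that g(3) C unfolding fam_bound_density[OF M k(1,2)]
      by (intro ballI AE_abs_le_if_Lip_bs_le[OF M g(1) k(1), where C="max 1 C"]) auto
    show "fam_bound I L (density M (\<lambda>x. ennreal (k x)))" if "\<forall>i\<in>I. AE x in M. \<bar>g i x\<bar> \<le> k x"
      using that g(3) C unfolding fam_bound_density[OF M k(1,2)]
      by (auto intro!: abs_integral_density_le[OF M _ g(1) k(1), where C="max 1 C"])
  qed
  define J where "J k = (\<integral>x. w x * k x \<partial>M)" for k
  have Ji: "integrable M (\<lambda>x. w x * k x)" if "k \<in> borel_measurable borel" "\<And>x. 0 \<le> k x" "\<And>x. k x \<le> 1" for k
    by (rule Bochner_Integration.integrable_bound[OF wi]) (use that w0 in \<open>auto simp: abs_mult intro!: AE_I2 mult_left_le\<close>)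
  have J0: "0 \<le> J k" if "k \<in> K" for k
    unfolding J_def by (rule integral_nonneg_AE) (use that w0 in \<open>auto simp: K_def less_imp_le intro!: AE_I2 mult_nonneg_nonneg\<close>)
  have bddJ: "bdd_below (J ` K)" using J0 by (auto intro!: bdd_belowI[of _ 0])
  have "(\<lambda>x. 1) \<in> K" using g by (auto simp: K_def)
  then have ne: "J ` K \<noteq> {}" by auto
  define c where "c = Inf (J ` K)"
  have "\<exists>k\<in>K. J k < c + 1 / real (Suc n)" for n
    using cInf_lessD[OF ne, of "c + 1 / real (Suc n)"] by (auto simp: c_def)
  then obtain s where s: "\<And>n. s n \<in> K" "\<And>n. J (s n) < c + 1 / real (Suc n)" by metis
  define k where "k x = (INF n. s n x)" for x
  have sb: "bdd_below (range (\<lambda>n. s n x))" for x using s(1) by (auto simp: K_def intro!: bdd_belowI[of _ 0])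
  have kle: "k x \<le> s n x" for x n unfolding k_def by (rule cINF_lower[OF sb]) auto
  have k[measurable]: "k \<in> borel_measurable borel" unfolding k_def[abs_def]
    by (rule borel_measurable_cINF) (use s(1) sb in \<open>auto simp: K_def\<close>)
  have k0: "0 \<le> k x" for x unfolding k_def by (rule cINF_greatest) (use s(1) in \<open>auto simp: K_def\<close>)
  have k1: "k x \<le> 1" for x using kle[of x 0] s(1)[of 0] by (auto simp: K_def intro: order_trans)
  have kK: "k \<in> K"
    unfolding K_def
  proof (intro CollectI conjI k ballI allI k0 k1)
    fix i assume i: "i \<in> I"
    have "AE x in M. \<forall>n. \<bar>g i x\<bar> \<le> s n x" unfolding AE_all_countable using s(1) i by (auto simp: K_def)
    then show "AE x in M. \<bar>g i x\<bar> \<le> k x"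
      by eventually_elim (auto simp: k_def intro!: cINF_greatest)
  qed
  have Jc: "J k \<le> c"
  proof (rule field_le_epsilon)
    fix e :: real assume "e > 0"
    then obtain n where n: "1 / real (Suc n) < e" using nat_approx_posE by blast
    have "J k \<le> J (s n)" unfolding J_def
      using s(1)[of n] kle[of _ n] w0 k k0 k1
      by (intro integral_mono Ji mult_left_mono) (auto simp: K_def less_imp_le)
    then show "J k \<le> c + e" using s(2)[of n] n by linarith
  qed
  have "AE x in M. k x \<le> k' x"
    if k'[measurable]: "k' \<in> borel_measurable borel" and k'0: "\<And>x. 0 \<le> k' x" and k'C: "\<And>x. k' x \<le> C"
      and b: "fam_bound I L (density M (\<lambda>x. ennreal (k' x)))" for k' :: "'a \<Rightarrow> real" and C
  proof -
    \<comment> \<open>The minimum with a competitor is again admissible. It cannot have a smaller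
      integral, and the weight is positive, so it agrees with \<open>k\<close> almost
      everywhere.\<close>
    define m where "m x = min (k x) (k' x)" for x
    have m[measurable]: "m \<in> borel_measurable borel" unfolding m_def by measurable
    have m01: "0 \<le> m x" "m x \<le> 1" "m x \<le> k x" for x using k0 k1[of x] k'0 by (auto simp: m_def min_def)
    have "m \<in> K"
      unfolding K_def
    proof (intro CollectI conjI m ballI allI m01)
      fix i assume i: "i \<in> I"
      have "AE x in M. \<bar>g i x\<bar> \<le> k x" "AE x in M. \<bar>g i x\<bar> \<le> k' x"
        using kK i bound_iff[OF k' k'0 k'C] b by (auto simp: K_def)
      then show "AE x in M. \<bar>g i x\<bar> \<le> m x" by eventually_elim (simp add: m_def)
    qed
    then have "c \<le> J m" unfolding c_def by (intro cInf_lower bddJ) auto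
    then have "J k - J m \<le> 0" using Jc by simp
    then have le0: "(\<integral>x. w x * k x - w x * m x \<partial>M) \<le> 0"
      using Ji[OF k k0 k1] Ji[OF m m01(1,2)] by (simp add: J_def)
    have nn: "0 \<le> w x * k x - w x * m x" for x using w0[of x] m01(3)[of x] by simp
    have "(\<integral>x. w x * k x - w x * m x \<partial>M) = 0"
      using le0 by (intro antisym integral_nonneg_AE) (use nn in auto)
    then have "AE x in M. w x * k x - w x * m x = 0"
      using Ji[OF k k0 k1] Ji[OF m m01(1,2)] nn by (subst integral_nonneg_eq_0_iff_AE[symmetric]) auto
    then show "AE x in M. k x \<le> k' x"
    proof eventually_elim
      case (elim x)
      then have "k x = m x" using w0[of x] by simp
      then show ?case by (simp add: m_def)
    qed
  qed
  moreover have "fam_bound I L (density M (\<lambda>x. ennreal (k x)))"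
    using bound_iff[OF k k0 k1] kK by (simp add: K_def)
  ultimately have "least_density I L M k"
    using k k0 k1 unfolding least_density_def by blast
  then show ?thesis by (rule exI[where x=k])
qed

lemma least_measure_eqI:
  assumes M: "loc_finite M" and sub: "\<M> \<subseteq> M\<^sub>0\<^sub>b_nonneg" and "measure M \<in> \<M>"
    and least: "\<And>\<nu> B. \<nu> \<in> \<M> \<Longrightarrow> B \<in> bounded_borel \<Longrightarrow> measure M B \<le> \<nu> B"
  shows "least_measure \<M> = M"
  unfolding least_measure_def
proof (rule the_equality)
  show "\<exists>\<mu>\<in>\<M>. (\<forall>\<nu>\<in>\<M>. \<forall>B\<in>bounded_borel. \<mu> B \<le> \<nu> B) \<and> M = borel_extension \<mu>"
    using assms borel_extension_measure[OF M] by (intro bexI[of _ "measure M"]) auto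
  fix N assume "\<exists>\<mu>\<in>\<M>. (\<forall>\<nu>\<in>\<M>. \<forall>B\<in>bounded_borel. \<mu> B \<le> \<nu> B) \<and> N = borel_extension \<mu>"
  then obtain \<mu> where \<mu>: "\<mu> \<in> \<M>" "\<forall>\<nu>\<in>\<M>. \<forall>B\<in>bounded_borel. \<mu> B \<le> \<nu> B" and N: "N = borel_extension \<mu>"
    by blast
  have m: "\<mu> \<in> M\<^sub>0\<^sub>b_nonneg" using \<mu> sub by auto
  have eq: "emeasure N B = emeasure M B" if B: "B \<in> bounded_borel" for B
  proof -
    have "\<mu> B = measure M B" using \<mu> assms(3) least[OF \<mu>(1) B] B by (intro antisym) auto
    then show ?thesis
      using emeasure_borel_extension_bounded[OF m B] loc_finite_emeasure[OF M B] N by simp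
  qed
  have sN: "sets N = sets borel" using N by simp
  show "N = M"
  proof (rule measure_eqI)
    show "sets N = sets M" using sN loc_finite_sets[OF M] by simp
    fix A assume "A \<in> sets N"
    then have A: "A \<in> sets borel" using sN by simp
    show "emeasure N A = emeasure M A"
      unfolding emeasure_SUP_balls[OF sN A, of undefined] emeasure_SUP_balls[OF loc_finite_sets[OF M] A, of undefined]
      using A by (intro SUP_cong refl eq bounded_borel_Int2 ball_bounded_borel)
  qed
qed

text \<open>Minimality among densities of \<open>M\<close> has to be extended to competitors
  \<open>N\<close> that are not absolutely continuous with respect to \<open>M\<close>. In the sum
  \<open>Q\<close> both become densities, and the least density of \<open>Q\<close> lies below both.
  Being below \<open>M\<close> it is also a density of \<open>M\<close>, so it is at least
  \<open>k\<close>.\<close>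

lemma fam_mass_density:
  fixes M :: "'a::metric_space measure"
  assumes M: "loc_finite M" and lin: "\<And>i. i \<in> I \<Longrightarrow> linear_on_Lip_bs (L i)" and bd: "fam_bound I L M"
  obtains k where "least_density I L M k" "fam_mass I L = density M (\<lambda>x. ennreal (k x))"
proof -
  obtain k where kk: "least_density I L M k" using least_density_exists[OF M lin bd] by blast
  note k = least_densityD(1-3)[OF kk] and kb = least_densityD(4)[OF kk] and kl = least_densityD(5)[OF kk]
  let ?D = "density M (\<lambda>x. ennreal (k x))"
  have D: "loc_finite ?D" using loc_finite_density[OF M k(1,3)] .
  have least: "emeasure ?D B \<le> emeasure N B"
    if N: "loc_finite N" and Nb: "fam_bound I L N" and B: "B \<in> bounded_borel" for N B
  proof -
    obtain Q where Q: "loc_finite Q" and Qe: "\<And>B. B \<in> bounded_borel \<Longrightarrow> emeasure Q B = emeasure M B + emeasure N B"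
      using loc_finite_add[OF M N] by blast
    obtain m :: "'a \<Rightarrow> real" where m: "m \<in> borel_measurable borel" "\<And>x. 0 \<le> m x" "\<And>x. m x \<le> 1" "M = density Q (\<lambda>x. ennreal (m x))"
      by (rule loc_finite_Radon_Nikodym[OF Q M, of 1]) (auto simp: Qe)
    obtain n :: "'a \<Rightarrow> real" where n: "n \<in> borel_measurable borel" "\<And>x. 0 \<le> n x" "\<And>x. n x \<le> 1" "N = density Q (\<lambda>x. ennreal (n x))"
      by (rule loc_finite_Radon_Nikodym[OF Q N, of 1]) (auto simp: Qe)
    have le: "(\<integral>x. \<bar>f x\<bar> * m x \<partial>Q) \<le> (\<integral>x. \<bar>f x\<bar> \<partial>Q)" if f: "f \<in> Lip_bs" for f
      using m(2,3) Lip_bs_integrable[OF Q Lip_bs_abs[OF f] m(1), of 1]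
      by (intro integral_mono) (auto intro: mult_left_le)
    have "fam_bound I L Q"
      unfolding fam_bound_def
    proof (intro ballI)
      fix i f assume i: "i \<in> I" and f: "f \<in> (Lip_bs :: ('a \<Rightarrow> real) set)"
      have "\<bar>L i f\<bar> \<le> (\<integral>x. \<bar>f x\<bar> * m x \<partial>Q)"
        using bd i f unfolding m(4) fam_bound_density[OF Q m(1,2)] by blast
      then show "\<bar>L i f\<bar> \<le> (\<integral>x. \<bar>f x\<bar> \<partial>Q)" using le[OF f] by linarith
    qed
    note Qb = this
    obtain q where qq: "least_density I L Q q" using least_density_exists[OF Q lin Qb] by blast
    note q = least_densityD(1-3)[OF qq] and qb = least_densityD(4)[OF qq] and ql = least_densityD(5)[OF qq]
    have qm: "AE x in Q. q x \<le> m x" using m bd by (intro ql[OF m(1-3)]) auto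
    have qn: "AE x in Q. q x \<le> n x" using n Nb by (intro ql[OF n(1-3)]) auto
    have qM: "emeasure (density Q (\<lambda>x. ennreal (q x))) B \<le> ennreal 1 * emeasure M B" if "B \<in> bounded_borel" for B
      using emeasure_density_mono[OF Q q(1) m(1) qm, of B] that m(4) by (simp add: bounded_borel_def)
    obtain k' :: "'a \<Rightarrow> real" where k': "k' \<in> borel_measurable borel" "\<And>x. 0 \<le> k' x" "\<And>x. k' x \<le> 1"
      "density Q (\<lambda>x. ennreal (q x)) = density M (\<lambda>x. ennreal (k' x))"
      by (rule loc_finite_Radon_Nikodym[OF M loc_finite_density[OF Q q(1,3)] _ qM]) auto
    have Bs: "B \<in> sets borel" using B by (simp add: bounded_borel_def)
    have "AE x in M. k x \<le> k' x" using qb k' by (intro kl[OF k'(1-3)]) auto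
    then have "emeasure ?D B \<le> emeasure (density M (\<lambda>x. ennreal (k' x))) B"
      by (rule emeasure_density_mono[OF M k(1) k'(1) _ Bs])
    also have "\<dots> = emeasure (density Q (\<lambda>x. ennreal (q x))) B" by (simp add: k'(4))
    also have "\<dots> \<le> emeasure N B" unfolding n(4) by (rule emeasure_density_mono[OF Q q(1) n(1) qn Bs])
    finally show ?thesis .
  qed
  have "fam_mass I L = ?D"
    unfolding fam_mass_def
  proof (rule least_measure_eqI[OF D])
    show "measure ?D \<in> {\<mu> \<in> M\<^sub>0\<^sub>b_nonneg. fam_bound I L (borel_extension \<mu>)}"
      using M0b_nonneg_measure[OF D] borel_extension_measure[OF D] kb by simp
    fix \<nu> and B :: "'a set" assume \<nu>: "\<nu> \<in> {\<mu> \<in> M\<^sub>0\<^sub>b_nonneg. fam_bound I L (borel_extension \<mu>)}" and B: "B \<in> bounded_borel"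
    then have "emeasure ?D B \<le> emeasure (borel_extension \<nu>) B"
      by (intro least loc_finite_borel_extension) auto
    then show "measure ?D B \<le> \<nu> B"
      using \<nu> B emeasure_borel_extension_bounded[of \<nu> B] loc_finite_emeasure[OF D B]
      by (auto simp: M\<^sub>0\<^sub>b_nonneg_def)
  qed auto
  with kk show ?thesis by (rule that)
qed

text \<open>Densities that fit under 1 cannot have slack. The true densities satisfy
  \<open>kA \<le> a\<close>, \<open>kB \<le> b\<close>, \<open>kR \<le> kA + kB\<close> and
  \<open>kT \<le> kR + c\<close>. As \<open>T\<close> has mass exactly \<open>M\<close>,
  \<open>kT\<close> is at least 1, so \<open>kA + kB \<le> a + b \<le> 1 - c \<le> kR\<close>, and
  the triangle inequality for \<open>kR\<close> is an equality.\<close>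

lemma fam_mass_add:
  fixes M :: "'a::metric_space measure"
  assumes M: "loc_finite M" and lin: "\<And>i. i \<in> I \<Longrightarrow> linear_on_Lip_bs (A i)" "\<And>i. i \<in> I \<Longrightarrow> linear_on_Lip_bs (R i)"
      "\<And>i. i \<in> I \<Longrightarrow> linear_on_Lip_bs (T i)"
    and mass: "fam_mass I T = M" "fam_bound I T M"
    and meas: "a \<in> borel_measurable borel" "b \<in> borel_measurable borel" "c \<in> borel_measurable borel"
    and nn: "\<And>x. 0 \<le> a x" "\<And>x. 0 \<le> b x" "\<And>x. 0 \<le> c x" and sum: "\<And>x. a x + b x + c x \<le> 1"
    and bA: "\<And>i f. i \<in> I \<Longrightarrow> f \<in> Lip_bs \<Longrightarrow> \<bar>A i f\<bar> \<le> (\<integral>x. \<bar>f x\<bar> * a x \<partial>M)"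
    and bB: "\<And>i f. i \<in> I \<Longrightarrow> f \<in> Lip_bs \<Longrightarrow> \<bar>R i f - A i f\<bar> \<le> (\<integral>x. \<bar>f x\<bar> * b x \<partial>M)"
    and bC: "\<And>i f. i \<in> I \<Longrightarrow> f \<in> Lip_bs \<Longrightarrow> \<bar>T i f - R i f\<bar> \<le> (\<integral>x. \<bar>f x\<bar> * c x \<partial>M)"
    and X: "X \<in> sets borel"
  shows "emeasure (fam_mass I R) X = emeasure (fam_mass I A) X + emeasure (fam_mass I (\<lambda>i f. R i f - A i f)) X"
proof -
  have sM[measurable_cong]: "sets M = sets borel" by (rule loc_finite_sets[OF M])
  have abc: "a x \<le> 1" "b x \<le> 1" "c x \<le> 1" "a x + b x \<le> 1" for x using nn[of x] sum[of x] by linarith+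
  have int: "integrable M (\<lambda>x. \<bar>f x\<bar> * h x)"
    if "f \<in> Lip_bs" "h \<in> borel_measurable borel" "\<And>x. 0 \<le> h x" "\<And>x. h x \<le> 1" for f h
    using that by (intro Lip_bs_integrable(1)[OF M Lip_bs_abs, where C=1]) auto
  have le1: "(\<integral>x. \<bar>f x\<bar> * h x \<partial>M) \<le> (\<integral>x. \<bar>f x\<bar> \<partial>M)"
    if "f \<in> Lip_bs" "h \<in> borel_measurable borel" "\<And>x. 0 \<le> h x" "\<And>x. h x \<le> 1" for f h
    using that Lip_bs_integrable[OF M Lip_bs_abs[OF that(1)] that(2), of 1]
    by (intro integral_mono) (auto intro: mult_left_le)
  have linB: "linear_on_Lip_bs (\<lambda>f. R i f - A i f)" if "i \<in> I" for i
    using lin(1,2)[OF that] by (auto simp: linear_on_Lip_bs_def algebra_simps)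
  have fA: "fam_bound I A M" unfolding fam_bound_def
  proof (intro ballI)
    fix i f assume "i \<in> I" "f \<in> (Lip_bs :: ('a \<Rightarrow> real) set)"
    then show "\<bar>A i f\<bar> \<le> (\<integral>x. \<bar>f x\<bar> \<partial>M)"
      using bA le1[of f a] meas nn abc by (meson order_trans)
  qed
  have fB: "fam_bound I (\<lambda>i f. R i f - A i f) M" unfolding fam_bound_def
  proof (intro ballI)
    fix i f assume "i \<in> I" "f \<in> (Lip_bs :: ('a \<Rightarrow> real) set)"
    then show "\<bar>R i f - A i f\<bar> \<le> (\<integral>x. \<bar>f x\<bar> \<partial>M)"
      using bB le1[of f b] meas nn abc by (meson order_trans)
  qed
  have fR: "fam_bound I R M" unfolding fam_bound_def
  proof (intro ballI)
    fix i f assume i: "i \<in> I" and f: "f \<in> (Lip_bs :: ('a \<Rightarrow> real) set)"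
    have "\<bar>R i f\<bar> \<le> (\<integral>x. \<bar>f x\<bar> * a x \<partial>M) + (\<integral>x. \<bar>f x\<bar> * b x \<partial>M)"
      using bA[OF i f] bB[OF i f] by linarith
    also have "\<dots> = (\<integral>x. \<bar>f x\<bar> * (a x + b x) \<partial>M)"
      using int[OF f] meas nn abc by (simp add: distrib_left)
    also have "\<dots> \<le> (\<integral>x. \<bar>f x\<bar> \<partial>M)"
      using meas nn abc by (intro le1 f) auto
    finally show "\<bar>R i f\<bar> \<le> (\<integral>x. \<bar>f x\<bar> \<partial>M)" .
  qed
  obtain kA where ldA: "least_density I A M kA" and mA: "fam_mass I A = density M (\<lambda>x. ennreal (kA x))"
    by (rule fam_mass_density[OF M lin(1) fA])
  note kA = least_densityD(1-3)[OF ldA] mA least_densityD(4)[OF ldA] and lA = least_densityD(5)[OF ldA]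
  obtain kB where ldB: "least_density I (\<lambda>i f. R i f - A i f) M kB" and mB: "fam_mass I (\<lambda>i f. R i f - A i f) = density M (\<lambda>x. ennreal (kB x))"
    by (rule fam_mass_density[OF M linB fB])
  note kB = least_densityD(1-3)[OF ldB] mB least_densityD(4)[OF ldB] and lB = least_densityD(5)[OF ldB]
  obtain kR where ldR: "least_density I R M kR" and mR: "fam_mass I R = density M (\<lambda>x. ennreal (kR x))"
    by (rule fam_mass_density[OF M lin(2) fR])
  note kR = least_densityD(1-3)[OF ldR] mR least_densityD(4)[OF ldR] and lR = least_densityD(5)[OF ldR]
  obtain kT where ldT: "least_density I T M kT" and mT: "fam_mass I T = density M (\<lambda>x. ennreal (kT x))"
    by (rule fam_mass_density[OF M lin(3) mass(2)])
  note kT = least_densityD(1-3)[OF ldT] mT least_densityD(4)[OF ldT] and lT = least_densityD(5)[OF ldT]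
  have AEa: "AE x in M. kA x \<le> a x"
    using bA by (intro lA[OF meas(1) nn(1) abc(1)]) (simp add: fam_bound_density[OF M meas(1) nn(1)])
  have AEb: "AE x in M. kB x \<le> b x"
    using bB by (intro lB[OF meas(2) nn(2) abc(2)]) (simp add: fam_bound_density[OF M meas(2) nn(2)])
  have AER: "AE x in M. kR x \<le> kA x + kB x"
  proof (rule lR[where C=2])
    show mm: "(\<lambda>x. kA x + kB x) \<in> borel_measurable borel" using kA(1) kB(1) by measurable
    show n2: "0 \<le> kA x + kB x" "kA x + kB x \<le> 2" for x using kA(2,3)[of x] kB(2,3)[of x] by auto
    show "fam_bound I R (density M (\<lambda>x. ennreal (kA x + kB x)))"
      unfolding fam_bound_density[OF M mm n2(1)]
    proof (intro ballI)
      fix i f assume i: "i \<in> I" and f: "f \<in> (Lip_bs :: ('a \<Rightarrow> real) set)"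
      have "\<bar>A i f\<bar> \<le> (\<integral>x. \<bar>f x\<bar> * kA x \<partial>M)" "\<bar>R i f - A i f\<bar> \<le> (\<integral>x. \<bar>f x\<bar> * kB x \<partial>M)"
        using kA(5) kB(5) i f unfolding fam_bound_density[OF M kA(1,2)] fam_bound_density[OF M kB(1,2)] by auto
      then have "\<bar>R i f\<bar> \<le> (\<integral>x. \<bar>f x\<bar> * kA x \<partial>M) + (\<integral>x. \<bar>f x\<bar> * kB x \<partial>M)" by linarith
      also have "\<dots> = (\<integral>x. \<bar>f x\<bar> * (kA x + kB x) \<partial>M)"
        using int[OF f kA(1-3)] int[OF f kB(1-3)] by (simp add: distrib_left)
      finally show "\<bar>R i f\<bar> \<le> (\<integral>x. \<bar>f x\<bar> * (kA x + kB x) \<partial>M)" .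
    qed
  qed
  have AET: "AE x in M. kT x \<le> kR x + c x"
  proof (rule lT[where C=2])
    show mm: "(\<lambda>x. kR x + c x) \<in> borel_measurable borel" using kR(1) meas(3) by measurable
    show n2: "0 \<le> kR x + c x" "kR x + c x \<le> 2" for x using kR(2,3)[of x] nn(3)[of x] abc(3)[of x] by auto
    show "fam_bound I T (density M (\<lambda>x. ennreal (kR x + c x)))"
      unfolding fam_bound_density[OF M mm n2(1)]
    proof (intro ballI)
      fix i f assume i: "i \<in> I" and f: "f \<in> (Lip_bs :: ('a \<Rightarrow> real) set)"
      have "\<bar>R i f\<bar> \<le> (\<integral>x. \<bar>f x\<bar> * kR x \<partial>M)"
        using kR(5) i f unfolding fam_bound_density[OF M kR(1,2)] by auto
      then have "\<bar>T i f\<bar> \<le> (\<integral>x. \<bar>f x\<bar> * kR x \<partial>M) + (\<integral>x. \<bar>f x\<bar> * c x \<partial>M)" using bC[OF i f] by linarith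
      also have "\<dots> = (\<integral>x. \<bar>f x\<bar> * (kR x + c x) \<partial>M)"
        using int[OF f kR(1-3)] int[OF f meas(3) nn(3) abc(3)] by (simp add: distrib_left)
      finally show "\<bar>T i f\<bar> \<le> (\<integral>x. \<bar>f x\<bar> * (kR x + c x) \<partial>M)" .
    qed
  qed
  have AE1: "AE x in M. 1 \<le> kT x"
  proof (rule AE_le_if_bounded_borel_le[OF M _ kT(1), where C=1])
    fix B :: "'a set" assume B: "B \<in> bounded_borel"
    then have [measurable]: "B \<in> sets borel" by (simp add: bounded_borel_def)
    have "(\<integral>x. indicator B x * 1 \<partial>M) = (\<integral>x. (indicator B x :: real) \<partial>density M (\<lambda>x. ennreal (kT x)))"
      using mass(1) kT(4) by simp
    also have "\<dots> = (\<integral>x. indicator B x * kT x \<partial>M)"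
      using kT(1,2) by (subst integral_density) (auto simp: mult.commute)
    finally show "(\<integral>x. indicator B x * 1 \<partial>M) \<le> (\<integral>x. indicator B x * kT x \<partial>M)" by simp
  qed (use kT in auto)
  have "AE x in M. ennreal (kR x) * indicator X x = ennreal (kA x) * indicator X x + ennreal (kB x) * indicator X x"
    using AEa AEb AER AET AE1
  proof eventually_elim
    case (elim x)
    then have "kR x = kA x + kB x" using sum[of x] by linarith
    then show ?case using kA(2)[of x] kB(2)[of x] by (simp add: distrib_right)
  qed
  then have "(\<integral>\<^sup>+x. ennreal (kR x) * indicator X x \<partial>M)
      = (\<integral>\<^sup>+x. ennreal (kA x) * indicator X x + ennreal (kB x) * indicator X x \<partial>M)"
    by (rule nn_integral_cong_AE)
  also have "\<dots> = (\<integral>\<^sup>+x. ennreal (kA x) * indicator X x \<partial>M) + (\<integral>\<^sup>+x. ennreal (kB x) * indicator X x \<partial>M)"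
    using kA(1) kB(1) X by (intro nn_integral_add) auto
  finally show ?thesis
    unfolding kA(4) kB(4) kR(4) using kA(1) kB(1) kR(1) X by (simp add: emeasure_density)
qed

text \<open>Positivity gives \<open>\<bar>H f\<bar> \<le> H \<bar>f\<bar>\<close> and so a bounded
  density. Testing with nonnegative functions puts it between 0 and \<open>r\<close> almost
  everywhere, and truncation makes this hold everywhere.\<close>

lemma positive_functional_density:
  fixes M :: "'a::metric_space measure"
  assumes M: "loc_finite M" and lin: "linear_on_Lip_bs H"
    and r: "r \<in> borel_measurable borel" "\<And>x. 0 \<le> r x" "\<And>x. r x \<le> 1"
    and H: "\<And>f. f \<in> Lip_bs \<Longrightarrow> (\<And>x. 0 \<le> f x) \<Longrightarrow> 0 \<le> H f"
      "\<And>f. f \<in> Lip_bs \<Longrightarrow> (\<And>x. 0 \<le> f x) \<Longrightarrow> H f \<le> (\<integral>x. f x * r x \<partial>M)"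
  shows "\<exists>h \<in> borel_measurable borel. (\<forall>x. 0 \<le> h x \<and> h x \<le> r x) \<and> (\<forall>f\<in>Lip_bs. H f = (\<integral>x. f x * h x \<partial>M))"
proof -
  have bd: "\<bar>H f\<bar> \<le> (\<integral>x. \<bar>f x\<bar> \<partial>M)" if f: "f \<in> Lip_bs" for f
  proof -
    define p n where "p x = max 0 (f x)" and "n x = max 0 (- f x)" for x
    have pn: "p \<in> Lip_bs" "n \<in> Lip_bs" unfolding p_def n_def
      using Lip_bs_comp[OF f, of "max 0"] Lip_bs_comp[OF f, of "\<lambda>t. max 0 (- t)"] by auto
    have fpn: "f = (\<lambda>x. 1 * p x + (-1) * n x)" "(\<lambda>x. \<bar>f x\<bar>) = (\<lambda>x. 1 * p x + 1 * n x)"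
      by (auto simp: p_def n_def fun_eq_iff)
    have L: "H (\<lambda>x. a * p x + b * n x) = a * H p + b * H n" for a b
      using lin pn by (auto simp: linear_on_Lip_bs_def)
    have "H f = 1 * H p + (-1) * H n" by (subst fpn(1)) (rule L)
    moreover have "H (\<lambda>x. \<bar>f x\<bar>) = 1 * H p + 1 * H n" by (subst fpn(2)) (rule L)
    moreover have "0 \<le> H p" "0 \<le> H n" using pn by (auto intro!: H(1) simp: p_def n_def)
    ultimately have "\<bar>H f\<bar> \<le> H (\<lambda>x. \<bar>f x\<bar>)" by linarith
    also have "\<dots> \<le> (\<integral>x. \<bar>f x\<bar> * r x \<partial>M)" using Lip_bs_abs[OF f] by (intro H(2)) auto
    also have "\<dots> \<le> (\<integral>x. \<bar>f x\<bar> \<partial>M)"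
      using r Lip_bs_integrable[OF M Lip_bs_abs[OF f] r(1), of 1]
      by (intro integral_mono) (auto intro: mult_left_le)
    finally show ?thesis .
  qed
  obtain g where g: "g \<in> borel_measurable borel" "\<And>x. \<bar>g x\<bar> \<le> 1" "\<And>f. f \<in> Lip_bs \<Longrightarrow> H f = (\<integral>x. f x * g x \<partial>M)"
    using functional_density[OF M lin bd] by blast
  have r1: "\<bar>r x\<bar> \<le> 1" for x using r by auto
  have g0: "AE x in M. 0 \<le> g x"
    by (rule AE_le_if_Lip_bs_le[OF M _ g(1) _ g(2)]) (use H(1) g(3) in auto)
  have gr: "AE x in M. g x \<le> r x"
    by (rule AE_le_if_Lip_bs_le[OF M g(1) r(1) g(2) r1]) (use H(2) g(3) in auto)
  define h where "h x = max 0 (min (g x) (r x))" for x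
  have h: "h \<in> borel_measurable borel" unfolding h_def using g(1) r(1) by measurable
  have "(\<integral>x. f x * g x \<partial>M) = (\<integral>x. f x * h x \<partial>M)" if f: "f \<in> Lip_bs" for f
  proof (rule integral_cong_AE)
    show "AE x in M. f x * g x = f x * h x" using g0 gr by eventually_elim (simp add: h_def)
  qed (use f g(1) h in \<open>auto simp: loc_finite_measurable[OF M] intro!: borel_measurable_times Lip_bs_measurable\<close>)
  then show ?thesis using g(3) r(2) h by (intro bexI[of _ h]) (auto simp: h_def)
qed

section \<open>Densities of one-dimensional currents\<close>

lemma M1bD:
  assumes "T \<in> M\<^sub>1\<^sub>b"
  shows "\<pi> \<in> Lip \<Longrightarrow> linear_on_Lip_bs (\<lambda>f. T f \<pi>)" "f \<in> Lip_bs \<Longrightarrow> linear_on_Lip (T f)"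
    "f \<in> Lip_bs \<Longrightarrow> \<pi> \<in> Lip \<Longrightarrow> (\<And>j. p j \<in> Lip) \<Longrightarrow> (\<And>j. lip_const (p j) \<le> K) \<Longrightarrow> (\<And>x. (\<lambda>j. p j x) \<longlonglongrightarrow> \<pi> x) \<Longrightarrow>
      (\<lambda>j. T f (p j)) \<longlonglongrightarrow> T f \<pi>"
    "f \<in> Lip_bs \<Longrightarrow> \<pi> \<in> Lip \<Longrightarrow> (\<And>x. x \<in> supp f \<Longrightarrow> \<pi> x = 0) \<Longrightarrow> T f \<pi> = 0"
    "mass_bounds1 T \<noteq> {}"
proof -
  show "\<pi> \<in> Lip \<Longrightarrow> linear_on_Lip_bs (\<lambda>f. T f \<pi>)" "f \<in> Lip_bs \<Longrightarrow> linear_on_Lip (T f)"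
    "f \<in> Lip_bs \<Longrightarrow> \<pi> \<in> Lip \<Longrightarrow> (\<And>x. x \<in> supp f \<Longrightarrow> \<pi> x = 0) \<Longrightarrow> T f \<pi> = 0"
    "mass_bounds1 T \<noteq> {}"
    using assms unfolding M\<^sub>1\<^sub>b_def by simp_all
  assume a: "f \<in> Lip_bs" "\<pi> \<in> Lip" "\<And>j. p j \<in> Lip" "\<And>j. lip_const (p j) \<le> K" "\<And>x. (\<lambda>j. p j x) \<longlonglongrightarrow> \<pi> x"
  have "bdd_above (range (\<lambda>j. lip_const (p j)))" using a(4) by (auto intro!: bdd_aboveI[of _ K])
  then show "(\<lambda>j. T f (p j)) \<longlonglongrightarrow> T f \<pi>" using assms a unfolding M\<^sub>1\<^sub>b_def by simp
qed

definition unit_density :: "('a::metric_space \<Rightarrow> real) \<Rightarrow> bool"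
  where "unit_density r \<longleftrightarrow> r \<in> borel_measurable borel \<and> (\<forall>x. 0 \<le> r x \<and> r x \<le> 1)"

lemma unit_densityD:
  assumes "unit_density r" shows "r \<in> borel_measurable borel" "\<And>x. 0 \<le> r x" "\<And>x. r x \<le> 1" "\<And>x. \<bar>r x\<bar> \<le> 1"
  using assms by (auto simp: unit_density_def)

text \<open>Says that the mass of \<open>T\<close> is at most \<open>r\<close> times
  \<open>M\<close> without mentioning the mass, so that it can be added and passed to limits before
  the mass is known.\<close>

definition mass1_le :: "'a::metric_space current1 \<Rightarrow> 'a measure \<Rightarrow> ('a \<Rightarrow> real) \<Rightarrow> bool"
  where "mass1_le T M r \<longleftrightarrow>
    (\<forall>f\<in>Lip_bs. \<forall>\<pi>\<in>Lip. \<bar>T f \<pi>\<bar> \<le> lip_const \<pi> * (\<integral>x. \<bar>f x\<bar> * r x \<partial>M))"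

context
  fixes T :: "'a::metric_space current1" and M :: "'a measure" and r :: "'a \<Rightarrow> real"
  assumes T: "T \<in> M\<^sub>1\<^sub>b" and M: "loc_finite M" and r_unit: "unit_density r" and T_le: "mass1_le T M r"
begin

private lemma r: "r \<in> borel_measurable borel" "\<And>x. 0 \<le> r x" "\<And>x. r x \<le> 1"
  using unit_densityD[OF r_unit] by auto

private lemma bd: "f \<in> Lip_bs \<Longrightarrow> \<pi> \<in> Lip \<Longrightarrow> \<bar>T f \<pi>\<bar> \<le> lip_const \<pi> * (\<integral>x. \<bar>f x\<bar> * r x \<partial>M)"
  using T_le by (simp add: mass1_le_def)

lemma current_density_exists:
  assumes \<pi>: "\<pi> \<in> Lip"
  shows "\<exists>g. g \<in> borel_measurable borel \<and> (\<forall>x. \<bar>g x\<bar> \<le> lip_const \<pi> * r x) \<and>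
    (\<forall>f\<in>Lip_bs. T f \<pi> = (\<integral>x. f x * g x \<partial>M))"
proof -
  \<comment> \<open>The summand 1 makes division possible when the Lipschitz constant is 0.\<close>
  define c where "c = lip_const \<pi> + 1"
  have l0: "0 \<le> lip_const \<pi>" using \<pi> by (rule lip_const_nonneg)
  have c: "c > 0" "lip_const \<pi> \<le> c" using l0 by (auto simp: c_def)
  have lin: "linear_on_Lip_bs (\<lambda>f. T f \<pi> / c)"
    using M1bD(1)[OF T \<pi>] by (auto simp: linear_on_Lip_bs_def add_divide_distrib)
  have int: "integrable M (\<lambda>x. \<bar>f x\<bar> * r x)" "(\<integral>x. \<bar>f x\<bar> * r x \<partial>M) \<le> (\<integral>x. \<bar>f x\<bar> \<partial>M)" "0 \<le> (\<integral>x. \<bar>f x\<bar> * r x \<partial>M)" if f: "f \<in> Lip_bs" for f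
    using r Lip_bs_integrable[OF M Lip_bs_abs[OF f] r(1), of 1]
    by (auto intro!: integral_mono mult_left_le integral_nonneg_AE)
  have "\<bar>T f \<pi> / c\<bar> \<le> (\<integral>x. \<bar>f x\<bar> \<partial>M)" if f: "f \<in> Lip_bs" for f
  proof -
    have "\<bar>T f \<pi>\<bar> \<le> c * (\<integral>x. \<bar>f x\<bar> * r x \<partial>M)"
      using bd[OF f \<pi>] mult_right_mono[OF c(2) int(3)[OF f]] by linarith
    also have "\<dots> \<le> c * (\<integral>x. \<bar>f x\<bar> \<partial>M)" using int(2)[OF f] c by simp
    finally show ?thesis using c by (simp add: field_simps)
  qed
  from functional_density[OF M lin this]
  obtain g where g: "g \<in> borel_measurable borel" "\<And>x. \<bar>g x\<bar> \<le> 1" "\<And>f. f \<in> Lip_bs \<Longrightarrow> T f \<pi> / c = (\<integral>x. f x * g x \<partial>M)"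
    by blast
  define k where "k x = c * g x" for x
  have k: "k \<in> borel_measurable borel" unfolding k_def using g(1) by measurable
  have Tk: "T f \<pi> = (\<integral>x. f x * k x \<partial>M)" if "f \<in> Lip_bs" for f
  proof -
    have "T f \<pi> = c * (\<integral>x. f x * g x \<partial>M)" using g(3)[OF that] c by (simp add: field_simps)
    then show ?thesis by (simp add: k_def mult.left_commute)
  qed
  have kC: "\<bar>k x\<bar> \<le> c" for x using g(2)[of x] c by (simp add: k_def abs_mult)
  have lr: "\<bar>lip_const \<pi> * r x\<bar> \<le> c" for x
    using r(2,3)[of x] l0 by (simp add: abs_mult c_def mult_left_le add_increasing2)
  have AEk: "AE x in M. \<bar>k x\<bar> \<le> lip_const \<pi> * r x"
  proof (rule AE_abs_le_if_Lip_bs_le[OF M k _ kC lr])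
    show "(\<lambda>x. lip_const \<pi> * r x) \<in> borel_measurable borel" using r(1) by measurable
    fix f :: "'a \<Rightarrow> real" assume f: "f \<in> Lip_bs"
    show "\<bar>\<integral>x. f x * k x \<partial>M\<bar> \<le> (\<integral>x. \<bar>f x\<bar> * (lip_const \<pi> * r x) \<partial>M)"
      using bd[OF f \<pi>] Tk[OF f] by (simp add: mult.left_commute)
  qed
  \<comment> \<open>Truncation changes the density on a null set only and makes the bound valid at
    every point.\<close>
  define h where "h x = max (- (lip_const \<pi> * r x)) (min (lip_const \<pi> * r x) (k x))" for x
  have h: "h \<in> borel_measurable borel" unfolding h_def using k r(1) by measurable
  have "\<bar>h x\<bar> \<le> lip_const \<pi> * r x" for x
    using mult_nonneg_nonneg[OF l0 r(2)[of x]] by (auto simp: h_def)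
  moreover have "(\<integral>x. f x * k x \<partial>M) = (\<integral>x. f x * h x \<partial>M)" if f: "f \<in> Lip_bs" for f
  proof (rule integral_cong_AE)
    show "AE x in M. f x * k x = f x * h x" using AEk by eventually_elim (auto simp: h_def)
  qed (use f k h in \<open>auto simp: loc_finite_measurable[OF M] intro!: borel_measurable_times Lip_bs_measurable\<close>)
  ultimately show ?thesis using h Tk by (intro exI[of _ h]) auto
qed

text \<open>Plays the role of the derivative of \<pi> along the vector field carried by
  \<open>T\<close>. It is chosen separately for each \<pi>, so the rules of calculus below hold only
  almost everywhere.\<close>

definition current_density :: "('a \<Rightarrow> real) \<Rightarrow> 'a \<Rightarrow> real"
  where "current_density \<pi> = (SOME g. g \<in> borel_measurable borel \<and> (\<forall>x. \<bar>g x\<bar> \<le> lip_const \<pi> * r x) \<and>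
    (\<forall>f\<in>Lip_bs. T f \<pi> = (\<integral>x. f x * g x \<partial>M)))"

lemma current_densityD:
  assumes "\<pi> \<in> Lip"
  shows "current_density \<pi> \<in> borel_measurable borel" "\<bar>current_density \<pi> x\<bar> \<le> lip_const \<pi> * r x"
    "\<bar>current_density \<pi> x\<bar> \<le> lip_const \<pi>"
    "f \<in> Lip_bs \<Longrightarrow> T f \<pi> = (\<integral>x. f x * current_density \<pi> x \<partial>M)"
proof -
  have *: "current_density \<pi> \<in> borel_measurable borel \<and> (\<forall>x. \<bar>current_density \<pi> x\<bar> \<le> lip_const \<pi> * r x) \<and>
      (\<forall>f\<in>Lip_bs. T f \<pi> = (\<integral>x. f x * current_density \<pi> x \<partial>M))"
    unfolding current_density_def by (rule someI_ex[OF current_density_exists[OF assms]])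
  then show "current_density \<pi> \<in> borel_measurable borel" "\<bar>current_density \<pi> x\<bar> \<le> lip_const \<pi> * r x"
    "f \<in> Lip_bs \<Longrightarrow> T f \<pi> = (\<integral>x. f x * current_density \<pi> x \<partial>M)" by auto
  have "lip_const \<pi> * r x \<le> lip_const \<pi>" using r lip_const_nonneg[OF assms] by (simp add: mult_left_le)
  then show "\<bar>current_density \<pi> x\<bar> \<le> lip_const \<pi>" using * by (meson order_trans)
qed

lemma current_density_unique:
  assumes "\<pi> \<in> Lip" "g \<in> borel_measurable borel" "\<And>x. \<bar>g x\<bar> \<le> C"
    "\<And>f. f \<in> Lip_bs \<Longrightarrow> T f \<pi> = (\<integral>x. f x * g x \<partial>M)"
  shows "AE x in M. current_density \<pi> x = g x"
proof (rule AE_eq_if_Lip_bs_eq[OF M, where C="max C (lip_const \<pi>)"])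
  show "\<bar>current_density \<pi> x\<bar> \<le> max C (lip_const \<pi>)" "\<bar>g x\<bar> \<le> max C (lip_const \<pi>)" for x
    using current_densityD(3)[OF assms(1), of x] assms(3)[of x] by auto
qed (use assms current_densityD[OF assms(1)] in auto)

lemma current_density_lincomb:
  assumes \<pi>: "\<pi> \<in> Lip" and \<rho>: "\<rho> \<in> Lip"
  shows "AE x in M. current_density (\<lambda>x. a * \<pi> x + b * \<rho> x) x = a * current_density \<pi> x + b * current_density \<rho> x"
proof (rule current_density_unique[where C="\<bar>a\<bar> * lip_const \<pi> + \<bar>b\<bar> * lip_const \<rho>"])
  show "(\<lambda>x. a * \<pi> x + b * \<rho> x) \<in> Lip" using \<pi> \<rho> by (rule Lip_lincomb)
  show "(\<lambda>x. a * current_density \<pi> x + b * current_density \<rho> x) \<in> borel_measurable borel"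
    using current_densityD(1)[OF \<pi>] current_densityD(1)[OF \<rho>] by measurable
  show "\<bar>a * current_density \<pi> x + b * current_density \<rho> x\<bar> \<le> \<bar>a\<bar> * lip_const \<pi> + \<bar>b\<bar> * lip_const \<rho>" for x
  proof -
    have "\<bar>a * current_density \<pi> x + b * current_density \<rho> x\<bar> \<le> \<bar>a\<bar> * \<bar>current_density \<pi> x\<bar> + \<bar>b\<bar> * \<bar>current_density \<rho> x\<bar>"
      by (metis abs_mult abs_triangle_ineq)
    also have "\<dots> \<le> \<bar>a\<bar> * lip_const \<pi> + \<bar>b\<bar> * lip_const \<rho>"
      using current_densityD(3)[OF \<pi>, of x] current_densityD(3)[OF \<rho>, of x] by (intro add_mono mult_left_mono) auto
    finally show ?thesis .
  qed
  fix f :: "'a \<Rightarrow> real" assume f: "f \<in> Lip_bs"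
  have i: "integrable M (\<lambda>x. f x * current_density \<pi> x)" "integrable M (\<lambda>x. f x * current_density \<rho> x)"
    using Lip_bs_integrable(1)[OF M f current_densityD(1,3)[OF \<pi>]] Lip_bs_integrable(1)[OF M f current_densityD(1,3)[OF \<rho>]] by auto
  have "T f (\<lambda>x. a * \<pi> x + b * \<rho> x) = a * T f \<pi> + b * T f \<rho>"
    using M1bD(2)[OF T f] \<pi> \<rho> by (auto simp: linear_on_Lip_def)
  also have "\<dots> = (\<integral>x. a * (f x * current_density \<pi> x) + b * (f x * current_density \<rho> x) \<partial>M)"
    using i current_densityD(4)[OF \<pi> f] current_densityD(4)[OF \<rho> f] by simp
  also have "\<dots> = (\<integral>x. f x * (a * current_density \<pi> x + b * current_density \<rho> x) \<partial>M)"
    by (rule Bochner_Integration.integral_cong) (auto simp: algebra_simps)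
  finally show "T f (\<lambda>x. a * \<pi> x + b * \<rho> x) = (\<integral>x. f x * (a * current_density \<pi> x + b * current_density \<rho> x) \<partial>M)" .
qed

text \<open>Strong locality: the derivative vanishes almost everywhere on the zero set of \<pi>,
  although the axiom only speaks of \<pi> vanishing on a support. Soft thresholding gives functions
  \<open>p j\<close> that vanish near the zero set and tend to \<pi> with bounded Lipschitz
  constants, so the continuity axiom transfers the property.\<close>

lemma current_density_zero:
  assumes \<pi>: "\<pi> \<in> Lip"
  shows "AE x in M. \<pi> x = 0 \<longrightarrow> current_density \<pi> x = 0"
proof -
  have [measurable_cong]: "sets M = sets borel" by (rule loc_finite_sets[OF M])
  note [measurable] = Lip_measurable[OF \<pi>]
  define Z where "Z = {x. \<pi> x = 0}"
  have Z[measurable]: "Z \<in> sets borel" unfolding Z_def by measurable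
  define l where "l = lip_const \<pi>"
  have l0: "0 \<le> l" unfolding l_def by (rule lip_const_nonneg[OF \<pi>])
  define p where "p j x = \<pi> x - max (- inverse (real (Suc j))) (min (inverse (real (Suc j))) (\<pi> x))" for j x
  have u: "\<bar>(s - max (- e) (min e s)) - (t - max (- e) (min e t))\<bar> \<le> \<bar>s - t\<bar>" if "e > 0" for e s t :: real
    using that by linarith
  have p: "p j \<in> Lip" "lip_const (p j) \<le> l" for j
    unfolding p_def[abs_def] l_def
    using Lip_comp[OF \<pi>, of "\<lambda>t. t - max (- inverse (real (Suc j))) (min (inverse (real (Suc j))) t)", OF u] by auto
  have plim: "(\<lambda>j. p j x) \<longlonglongrightarrow> \<pi> x" for x
  proof (rule LIM_zero_cancel, rule Lim_null_comparison)
    show "(\<lambda>j. inverse (real (Suc j))) \<longlonglongrightarrow> 0" by (rule LIMSEQ_inverse_real_of_nat)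
    have "\<bar>p j x - \<pi> x\<bar> \<le> inverse (real (Suc j))" for j
    proof -
      have "inverse (real (Suc j)) > 0" by simp
      then show ?thesis unfolding p_def by linarith
    qed
    then show "\<forall>\<^sub>F j in sequentially. norm (p j x - \<pi> x) \<le> inverse (real (Suc j))" by simp
  qed
  have gp: "AE x in M. x \<in> Z \<longrightarrow> current_density (p j) x = 0" for j
  proof -
    note [measurable] = current_densityD(1)[OF p(1)[of j]]
    have cb: "\<bar>current_density (p j) x\<bar> \<le> l" for x using current_densityD(3)[OF p(1)] p(2) by (meson order_trans)
    have "AE x in M. indicator Z x * current_density (p j) x = 0"
    proof (rule AE_eq_if_Lip_bs_eq[OF M, where C=l])
      fix f :: "'a \<Rightarrow> real" assume f: "f \<in> Lip_bs"
      note [measurable] = Lip_bs_measurable[OF f]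
      \<comment> \<open>Lipschitz functions decreasing to the indicator of \<open>Z\<close> for
        \<open>i\<close> at least 1; products with them remain admissible first arguments of
        \<open>T\<close>.\<close>
      define \<psi> where "\<psi> i x = max 0 (1 - real i * \<bar>\<pi> x\<bar>)" for i x
      have \<psi>L: "\<psi> i \<in> Lip" for i
      proof -
        have "(\<lambda>x. real i * \<pi> x) \<in> Lip" by (rule Lip_cmult[OF \<pi>])
        then have "(\<lambda>x. max 0 (1 - \<bar>real i * \<pi> x\<bar>)) \<in> Lip"
          by (rule Lip_comp(1)[where u="\<lambda>t. max 0 (1 - \<bar>t\<bar>)"]) linarith
        then show ?thesis by (simp add: \<psi>_def[abs_def] abs_mult)
      qed
      \<comment> \<open>Once \<open>i\<close> exceeds \<open>j\<close>, the support of the product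
        lies in the closed strip on which \<open>p j\<close> vanishes identically.\<close>
      have T0: "(\<integral>x. f x * \<psi> i x * current_density (p j) x \<partial>M) = 0" if i: "Suc j \<le> i" for i
      proof -
        have fx: "(\<lambda>x. f x * \<psi> i x) \<in> Lip_bs" by (rule Lip_bs_mult[OF f \<psi>L])
        have "supp (\<lambda>x. f x * \<psi> i x) \<subseteq> {x. \<bar>\<pi> x\<bar> \<le> inverse (real (Suc j))}"
        proof (rule supp_subset)
          show "closed {x. \<bar>\<pi> x\<bar> \<le> inverse (real (Suc j))}"
            using Lip_continuous[OF \<pi>] by (intro closed_Collect_le continuous_intros) auto
          fix x assume "f x * \<psi> i x \<noteq> 0"
          then have "real i * \<bar>\<pi> x\<bar> < 1" by (auto simp: \<psi>_def max_def split: if_splits)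
          moreover have "real (Suc j) * \<bar>\<pi> x\<bar> \<le> real i * \<bar>\<pi> x\<bar>" using i by (intro mult_right_mono) auto
          ultimately have "real (Suc j) * \<bar>\<pi> x\<bar> \<le> 1" by linarith
          then show "x \<in> {x. \<bar>\<pi> x\<bar> \<le> inverse (real (Suc j))}" by (simp add: field_simps)
        qed
        then have "T (\<lambda>x. f x * \<psi> i x) (p j) = 0"
          by (intro M1bD(4)[OF T fx p(1)]) (auto simp: p_def subset_eq)
        then show ?thesis using current_densityD(4)[OF p(1) fx] by simp
      qed
      have "(\<lambda>i. \<integral>x. f x * \<psi> i x * current_density (p j) x \<partial>M) \<longlonglongrightarrow> (\<integral>x. f x * (indicator Z x * current_density (p j) x) \<partial>M)"
      proof (rule integral_dominated_convergence[where w="\<lambda>x. \<bar>f x\<bar> * l"])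
        show "integrable M (\<lambda>x. \<bar>f x\<bar> * l)" using integrable_Lip_bs[OF M Lip_bs_abs[OF f]] by simp
        show "AE x in M. (\<lambda>i. f x * \<psi> i x * current_density (p j) x) \<longlonglongrightarrow> f x * (indicator Z x * current_density (p j) x)"
        proof (rule AE_I2)
          fix x
          have "(\<lambda>i. \<psi> i x) \<longlonglongrightarrow> indicator Z x"
          proof (cases "x \<in> Z")
            case True then show ?thesis by (simp add: \<psi>_def Z_def)
          next
            case False
            then have "\<bar>\<pi> x\<bar> > 0" by (simp add: Z_def)
            then obtain n where n: "1 < real n * \<bar>\<pi> x\<bar>" using ex_less_of_nat_mult by blast
            have "eventually (\<lambda>k. \<psi> k x = 0) sequentially"
            proof (rule eventually_sequentiallyI[of n])
              fix k assume "n \<le> k"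
              then have "real n * \<bar>\<pi> x\<bar> \<le> real k * \<bar>\<pi> x\<bar>" by (intro mult_right_mono) auto
              then show "\<psi> k x = 0" using n by (simp add: \<psi>_def)
            qed
            then show ?thesis using False by (simp add: tendsto_eventually)
          qed
          then show "(\<lambda>i. f x * \<psi> i x * current_density (p j) x) \<longlonglongrightarrow> f x * (indicator Z x * current_density (p j) x)"
            unfolding mult.assoc by (intro tendsto_intros)
        qed
        show "AE x in M. norm (f x * \<psi> i x * current_density (p j) x) \<le> \<bar>f x\<bar> * l" for i
        proof (rule AE_I2)
          fix x
          have "\<bar>\<psi> i x\<bar> \<le> 1" by (auto simp: \<psi>_def)
          then have "\<bar>\<psi> i x\<bar> * \<bar>current_density (p j) x\<bar> \<le> 1 * l" using cb[of x] by (intro mult_mono) auto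
          then show "norm (f x * \<psi> i x * current_density (p j) x) \<le> \<bar>f x\<bar> * l"
            by (simp add: abs_mult mult.assoc mult_left_mono)
        qed
        show "(\<lambda>x. f x * \<psi> i x * current_density (p j) x) \<in> borel_measurable M" for i
          using Lip_measurable[OF \<psi>L[of i]] by measurable
      qed measurable
      moreover have "(\<lambda>i. \<integral>x. f x * \<psi> i x * current_density (p j) x \<partial>M) \<longlonglongrightarrow> 0"
        by (rule tendsto_eventually, rule eventually_sequentiallyI[of "Suc j"]) (rule T0)
      ultimately have "(\<integral>x. f x * (indicator Z x * current_density (p j) x) \<partial>M) = 0" by (rule LIMSEQ_unique)
      then show "(\<integral>x. f x * (indicator Z x * current_density (p j) x) \<partial>M) = (\<integral>x. f x * 0 \<partial>M)" by simp
    qed (use cb l0 in \<open>auto split: split_indicator\<close>)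
    then show ?thesis by eventually_elim (auto split: split_indicator_asm)
  qed
  note [measurable] = current_densityD(1)[OF \<pi>]
  have cb: "\<bar>current_density \<pi> x\<bar> \<le> l" for x using current_densityD(3)[OF \<pi>] by (simp add: l_def)
  have close: "\<bar>(\<integral>x. u x * g x \<partial>M) - (\<integral>x. v x * g x \<partial>M)\<bar> \<le> l * (\<integral>x. \<bar>u x - v x\<bar> \<partial>M)"
    if u: "integrable M u" and v: "integrable M v" and [measurable]: "g \<in> borel_measurable borel" and g: "\<And>x. \<bar>g x\<bar> \<le> l" for u v g
  proof -
    have ig: "integrable M (\<lambda>x. w x * g x)" if w: "integrable M w" for w
    proof (rule Bochner_Integration.integrable_bound[where f="\<lambda>x. l * w x"])
      show "(\<lambda>x. w x * g x) \<in> borel_measurable M" using borel_measurable_integrable[OF w] by measurable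
      show "AE x in M. norm (w x * g x) \<le> norm (l * w x)"
      proof (rule AE_I2)
        fix x show "norm (w x * g x) \<le> norm (l * w x)"
          using mult_right_mono[OF g[of x], of "\<bar>w x\<bar>"] l0 by (simp add: abs_mult mult.commute)
      qed
    qed (use w in auto)
    have "(\<integral>x. u x * g x \<partial>M) - (\<integral>x. v x * g x \<partial>M) = (\<integral>x. u x * g x - v x * g x \<partial>M)"
      using ig u v by simp
    also have "\<bar>\<dots>\<bar> \<le> (\<integral>x. l * \<bar>u x - v x\<bar> \<partial>M)"
    proof (rule order_trans[OF integral_abs_bound], rule integral_mono)
      fix x
      have "\<bar>u x * g x - v x * g x\<bar> = \<bar>g x\<bar> * \<bar>u x - v x\<bar>" by (simp add: abs_mult flip: left_diff_distrib)
      then show "\<bar>u x * g x - v x * g x\<bar> \<le> l * \<bar>u x - v x\<bar>" using g[of x] by (simp add: mult_right_mono)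
    qed (use ig u v in auto)
    finally show ?thesis by simp
  qed
  have "AE x in M. indicator Z x * current_density \<pi> x = 0"
  proof (rule AE_eq_if_Lip_bs_eq[OF M, where C=l])
    fix f :: "'a \<Rightarrow> real" assume f: "f \<in> Lip_bs"
    note [measurable] = Lip_bs_measurable[OF f]
    have fi: "integrable M (\<lambda>x. f x * indicator Z x)"
      by (rule Lip_bs_integrable(1)[OF M f, where C=1]) (auto split: split_indicator)
    have "\<bar>\<integral>x. (f x * indicator Z x) * current_density \<pi> x \<partial>M\<bar> \<le> 0 + e" if e: "e > 0" for e
    proof -
      define d where "d = e / (2 * (l + 1))"
      have d: "d > 0" using e l0 by (simp add: d_def)
      \<comment> \<open>The continuity axiom concerns a first argument in \<open>Lip_bs\<close>, so
        \<open>f\<close> cut to \<open>Z\<close> is replaced by an L1 approximant. The error is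
        uniform in \<open>j\<close> because all densities involved are bounded by
        \<open>l\<close>.\<close>
      obtain \<phi> where \<phi>: "\<phi> \<in> Lip_bs" "(\<integral>x. \<bar>\<phi> x - f x * indicator Z x\<bar> \<partial>M) < d"
        using Lip_bs_dense[OF M fi] d by blast
      have \<phi>i: "integrable M \<phi>" using integrable_Lip_bs[OF M \<phi>(1)] by simp
      have ld: "l * (\<integral>x. \<bar>\<phi> x - f x * indicator Z x\<bar> \<partial>M) \<le> l * d" using \<phi>(2) l0 by (intro mult_left_mono) auto
      have "\<bar>T \<phi> (p j)\<bar> \<le> l * d" for j
      proof -
        note [measurable] = current_densityD(1)[OF p(1)[of j]] 
        have "(\<integral>x. (f x * indicator Z x) * current_density (p j) x \<partial>M) = (\<integral>x. 0 \<partial>M)"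
        proof (rule integral_cong_AE)
          show "AE x in M. (f x * indicator Z x) * current_density (p j) x = 0"
            using gp[of j] by eventually_elim (auto split: split_indicator)
        qed measurable
        moreover have "\<bar>current_density (p j) x\<bar> \<le> l" for x using current_densityD(3)[OF p(1)] p(2) by (meson order_trans)
        ultimately show ?thesis
          using close[OF \<phi>i fi, of "current_density (p j)"] ld current_densityD(4)[OF p(1) \<phi>(1), of j] by simp
      qed
      moreover have "(\<lambda>j. T \<phi> (p j)) \<longlonglongrightarrow> T \<phi> \<pi>"
        by (rule M1bD(3)[OF T \<phi>(1) \<pi> p plim])
      ultimately have "\<bar>T \<phi> \<pi>\<bar> \<le> l * d"
        by (intro LIMSEQ_le_const2[OF tendsto_rabs]) auto
      moreover have "2 * (l * d) \<le> e" using l0 e by (simp add: d_def field_simps)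
      ultimately show ?thesis
        using close[OF \<phi>i fi current_densityD(1)[OF \<pi>] cb] ld current_densityD(4)[OF \<pi> \<phi>(1)] by linarith
    qed
    then have "\<bar>\<integral>x. (f x * indicator Z x) * current_density \<pi> x \<partial>M\<bar> \<le> 0" by (rule field_le_epsilon)
    then show "(\<integral>x. f x * (indicator Z x * current_density \<pi> x) \<partial>M) = (\<integral>x. f x * 0 \<partial>M)" by (simp add: mult.assoc)
  qed (use cb l0 in \<open>auto split: split_indicator\<close>)
  then show ?thesis by eventually_elim (auto simp: Z_def split: split_indicator_asm)
qed

lemma current_density_local:
  assumes \<pi>: "\<pi> \<in> Lip" and \<rho>: "\<rho> \<in> Lip"
  shows "AE x in M. \<pi> x = \<rho> x \<longrightarrow> current_density \<pi> x = current_density \<rho> x"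
proof -
  have "AE x in M. 1 * \<pi> x + (-1) * \<rho> x = 0 \<longrightarrow> current_density (\<lambda>x. 1 * \<pi> x + (-1) * \<rho> x) x = 0"
    by (rule current_density_zero[OF Lip_lincomb[OF \<pi> \<rho>]])
  then show ?thesis using current_density_lincomb[OF \<pi> \<rho>, of 1 "-1"] by eventually_elim auto
qed

lemma current_density_const: "current_density (\<lambda>x. c) x = 0"
proof -
  have "lip_const (\<lambda>x::'a. c) \<le> 0" by (rule lip_const_leI) auto
  then show ?thesis using current_densityD(3)[OF Lip_const, of c x] by simp
qed

text \<open>Where \<open>f\<close> is within \<open>e\<close> of \<open>s\<close> and \<pi> within
  \<open>e\<close> of \<open>t\<close>, the product differs from
  \<open>s * \<pi> + t * f - s * t\<close> by \<open>(f - s) * (\<pi> - t)\<close>, whose derivative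
  is of order \<open>e\<close> there. Locality gives the rule up to such an error on each cell;
  countably many cells cover the space, and \<open>e\<close> tends to 0.\<close>

lemma current_density_Leibniz:
  assumes f: "f \<in> Lip_bs" and \<pi>: "\<pi> \<in> Lip"
  shows "AE x in M. current_density (\<lambda>x. f x * \<pi> x) x = f x * current_density \<pi> x + \<pi> x * current_density f x"
proof -
  define Lf L\<pi> where "Lf = lip_const f" and "L\<pi> = lip_const \<pi>"
  have fL: "f \<in> Lip" using f by (rule Lip_bs_Lip)
  have f\<pi>: "(\<lambda>x. f x * \<pi> x) \<in> Lip" using Lip_bs_mult[OF f \<pi>] by (rule Lip_bs_Lip)
  have L0: "0 \<le> Lf" "0 \<le> L\<pi>" using lip_const_nonneg fL \<pi> by (auto simp: Lf_def L\<pi>_def)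
  let ?g = current_density
  let ?D = "\<lambda>x. ?g (\<lambda>x. f x * \<pi> x) x - (f x * ?g \<pi> x + \<pi> x * ?g f x)"
  have cell: "AE x in M. \<bar>f x - s\<bar> \<le> e \<and> \<bar>\<pi> x - t\<bar> \<le> e \<longrightarrow> \<bar>?D x\<bar> \<le> 2 * e * (Lf + L\<pi>)" if e: "e > 0" for e s t
  proof -
    \<comment> \<open>Clipping makes the product of the two small factors globally Lipschitz with a
      constant of order \<open>e\<close>, and does nothing on the cell itself.\<close>
    define cl where "cl z = max (- e) (min e z)" for z :: real
    define \<rho> where "\<rho> x = cl (f x - s) * cl (\<pi> x - t)" for x
    have cl1: "\<bar>cl y - cl z\<bar> \<le> \<bar>y - z\<bar>" "\<bar>cl y\<bar> \<le> e" for y z using e by (auto simp: cl_def)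
    have "\<bar>\<rho> x - \<rho> y\<bar> \<le> e * (Lf + L\<pi>) * dist x y" for x y
    proof -
      have "\<rho> x - \<rho> y = cl (f x - s) * (cl (\<pi> x - t) - cl (\<pi> y - t)) + cl (\<pi> y - t) * (cl (f x - s) - cl (f y - s))"
        by (simp add: \<rho>_def algebra_simps)
      then have "\<bar>\<rho> x - \<rho> y\<bar> \<le> \<bar>cl (f x - s)\<bar> * \<bar>cl (\<pi> x - t) - cl (\<pi> y - t)\<bar> + \<bar>cl (\<pi> y - t)\<bar> * \<bar>cl (f x - s) - cl (f y - s)\<bar>"
        by (metis abs_mult abs_triangle_ineq)
      also have "\<dots> \<le> e * (L\<pi> * dist x y) + e * (Lf * dist x y)"
      proof (intro add_mono mult_mono cl1(2))
        show "\<bar>cl (\<pi> x - t) - cl (\<pi> y - t)\<bar> \<le> L\<pi> * dist x y"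
          using cl1(1)[of "\<pi> x - t" "\<pi> y - t"] lip_constD[OF \<pi>, of x y] by (simp add: L\<pi>_def)
        show "\<bar>cl (f x - s) - cl (f y - s)\<bar> \<le> Lf * dist x y"
          using cl1(1)[of "f x - s" "f y - s"] lip_constD[OF fL, of x y] by (simp add: Lf_def)
      qed (use e in auto)
      finally show ?thesis by (simp add: algebra_simps)
    qed
    then have \<rho>: "\<rho> \<in> Lip" "lip_const \<rho> \<le> e * (Lf + L\<pi>)"
      using e L0 by (auto intro!: LipI_real[of "e * (Lf + L\<pi>)"] lip_const_leI)
    define \<kappa> where "\<kappa> x = 1 * (f x * \<pi> x) + (-1) * (s * \<pi> x + t * f x)" for x
    define \<kappa>' where "\<kappa>' x = 1 * \<kappa> x + (s * t) * 1" for x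
    have st: "(\<lambda>x. s * \<pi> x + t * f x) \<in> Lip" by (rule Lip_lincomb[OF \<pi> fL])
    have \<kappa>: "\<kappa> \<in> Lip" unfolding \<kappa>_def[abs_def] by (rule Lip_lincomb[OF f\<pi> st])
    have \<kappa>': "\<kappa>' \<in> Lip" unfolding \<kappa>'_def[abs_def] by (rule Lip_lincomb[OF \<kappa> Lip_const])
    have "AE x in M. ?g \<kappa>' x = 1 * ?g \<kappa> x + (s * t) * ?g (\<lambda>x. 1) x"
      unfolding \<kappa>'_def[abs_def] by (rule current_density_lincomb[OF \<kappa> Lip_const])
    moreover have "AE x in M. ?g \<kappa> x = 1 * ?g (\<lambda>x. f x * \<pi> x) x + (-1) * ?g (\<lambda>x. s * \<pi> x + t * f x) x"
      unfolding \<kappa>_def[abs_def] by (rule current_density_lincomb[OF f\<pi> st])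
    moreover have "AE x in M. ?g (\<lambda>x. s * \<pi> x + t * f x) x = s * ?g \<pi> x + t * ?g f x"
      by (rule current_density_lincomb[OF \<pi> fL])
    moreover have "AE x in M. \<rho> x = \<kappa>' x \<longrightarrow> ?g \<rho> x = ?g \<kappa>' x" by (rule current_density_local[OF \<rho>(1) \<kappa>'])
    ultimately show ?thesis
    proof eventually_elim
      case (elim x)
      show ?case
      proof
        assume a: "\<bar>f x - s\<bar> \<le> e \<and> \<bar>\<pi> x - t\<bar> \<le> e"
        then have cl: "cl (f x - s) = f x - s" "cl (\<pi> x - t) = \<pi> x - t" by (auto simp: cl_def)
        have "\<rho> x = \<kappa>' x" unfolding \<rho>_def \<kappa>'_def \<kappa>_def cl by (simp add: algebra_simps)
        then have eq: "?g \<rho> x = ?g (\<lambda>x. f x * \<pi> x) x - (s * ?g \<pi> x + t * ?g f x)"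
          using elim by (simp add: current_density_const)
        have 1: "\<bar>?g \<rho> x\<bar> \<le> e * (Lf + L\<pi>)" using current_densityD(3)[OF \<rho>(1), of x] \<rho>(2) by linarith
        have 2: "\<bar>(f x - s) * ?g \<pi> x\<bar> \<le> e * L\<pi>"
          using a current_densityD(3)[OF \<pi>, of x] e unfolding abs_mult L\<pi>_def by (intro mult_mono) auto
        have 3: "\<bar>(\<pi> x - t) * ?g f x\<bar> \<le> e * Lf"
          using a current_densityD(3)[OF fL, of x] e unfolding abs_mult Lf_def by (intro mult_mono) auto
        have "?D x = ?g \<rho> x - (f x - s) * ?g \<pi> x - (\<pi> x - t) * ?g f x" unfolding eq by (simp add: algebra_simps)
        moreover have "2 * e * (Lf + L\<pi>) = e * (Lf + L\<pi>) + e * L\<pi> + e * Lf" by (simp add: algebra_simps)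
        ultimately show "\<bar>?D x\<bar> \<le> 2 * e * (Lf + L\<pi>)" using 1 2 3 by linarith
      qed
    qed
  qed
  have "AE x in M. \<bar>?D x\<bar> \<le> 2 * e * (Lf + L\<pi>)" if e: "e > 0" for e
  proof -
    \<comment> \<open>Cells centred at the points of a grid of width \<open>e\<close> suffice:
      countably many null sets are discarded, and rounding down finds a cell for every
      point.\<close>
    have "AE x in M. \<forall>i j :: int. \<bar>f x - e * of_int i\<bar> \<le> e \<and> \<bar>\<pi> x - e * of_int j\<bar> \<le> e \<longrightarrow> \<bar>?D x\<bar> \<le> 2 * e * (Lf + L\<pi>)"
      unfolding AE_all_countable using cell[OF e] by blast
    then show ?thesis
    proof eventually_elim
      case (elim x)
      have near: "\<bar>z - e * of_int \<lfloor>z / e\<rfloor>\<bar> \<le> e" for z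
      proof -
        have "of_int \<lfloor>z / e\<rfloor> \<le> z / e" "z / e \<le> of_int \<lfloor>z / e\<rfloor> + 1" by linarith+
        then have "of_int \<lfloor>z / e\<rfloor> * e \<le> z / e * e" "z / e * e \<le> (of_int \<lfloor>z / e\<rfloor> + 1) * e"
          using e by (intro mult_right_mono; simp)+
        then have "of_int \<lfloor>z / e\<rfloor> * e \<le> z" "z \<le> (of_int \<lfloor>z / e\<rfloor> + 1) * e" using e by auto
        then show ?thesis by (simp add: algebra_simps)
      qed
      show ?case using elim near by blast
    qed
  qed
  then have "AE x in M. \<forall>n. \<bar>?D x\<bar> \<le> 2 * inverse (real (Suc n)) * (Lf + L\<pi>)"
    unfolding AE_all_countable by (intro allI) simp
  then show ?thesis
  proof eventually_elim
    case (elim x)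
    have "(\<lambda>n. 2 * inverse (real (Suc n)) * (Lf + L\<pi>)) \<longlonglongrightarrow> 2 * 0 * (Lf + L\<pi>)"
      by (intro tendsto_intros LIMSEQ_inverse_real_of_nat)
    then have "\<bar>?D x\<bar> \<le> 2 * 0 * (Lf + L\<pi>)"
      by (rule LIMSEQ_le_const) (use elim in blast)
    then show ?case by simp
  qed
qed

end

section \<open>A normality criterion\<close>

text \<open>The continuity axiom of \<open>M\<^sub>1\<^sub>b\<close> does not pass to pointwise limits. The following conditions do,
  and together with bounds on \<open>S\<close> and \<open>boundary S\<close> they imply it: the last one rewrites
  \<open>S (f d\<pi>)\<close> as \<open>boundary S (f\<pi>) - S (\<sigma>\<pi> df)\<close>, where \<open>\<pi>\<close> is no longer differentiated.\<close>

definition pre_current :: "'a::metric_space current1 \<Rightarrow> bool"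
  where "pre_current S \<longleftrightarrow>
    (\<forall>\<pi> \<in> Lip. linear_on_Lip_bs (\<lambda>f. S f \<pi>)) \<and>
    (\<forall>f \<in> Lip_bs. linear_on_Lip (S f)) \<and>
    (\<forall>f \<in> Lip_bs. \<forall>\<pi> \<in> Lip. (\<forall>x \<in> supp f. \<pi> x = 0) \<longrightarrow> S f \<pi> = 0) \<and>
    (\<forall>f \<in> Lip_bs. \<forall>\<pi> \<in> Lip. \<forall>\<sigma> \<in> Lip_bs. (\<forall>x \<in> supp f. \<sigma> x = 1) \<longrightarrow>
      S f \<pi> = S \<sigma> (\<lambda>x. f x * \<pi> x) - S (\<lambda>x. \<sigma> x * \<pi> x) f)"

lemma pre_currentD:
  assumes "pre_current S"
  shows "\<pi> \<in> Lip \<Longrightarrow> f \<in> Lip_bs \<Longrightarrow> g \<in> Lip_bs \<Longrightarrow> S (\<lambda>x. a * f x + b * g x) \<pi> = a * S f \<pi> + b * S g \<pi>"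
    "f \<in> Lip_bs \<Longrightarrow> \<pi> \<in> Lip \<Longrightarrow> \<rho> \<in> Lip \<Longrightarrow> S f (\<lambda>x. a * \<pi> x + b * \<rho> x) = a * S f \<pi> + b * S f \<rho>"
    "f \<in> Lip_bs \<Longrightarrow> \<pi> \<in> Lip \<Longrightarrow> (\<And>x. x \<in> supp f \<Longrightarrow> \<pi> x = 0) \<Longrightarrow> S f \<pi> = 0"
    "f \<in> Lip_bs \<Longrightarrow> \<pi> \<in> Lip \<Longrightarrow> \<sigma> \<in> Lip_bs \<Longrightarrow> (\<And>x. x \<in> supp f \<Longrightarrow> \<sigma> x = 1) \<Longrightarrow>
      S f \<pi> = S \<sigma> (\<lambda>x. f x * \<pi> x) - S (\<lambda>x. \<sigma> x * \<pi> x) f"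
  using assms unfolding pre_current_def linear_on_Lip_bs_def linear_on_Lip_def by simp_all

text \<open>Two admissible \<sigma> differ only where \<phi> vanishes. The zero set of \<phi> is
  closed, so it contains the support of the difference, and the locality condition applies.\<close>

lemma boundary_eq:
  assumes S: "pre_current S" and \<phi>: "\<phi> \<in> Lip_bs" and \<sigma>: "\<sigma> \<in> Lip_bs" "\<And>x. x \<in> supp \<phi> \<Longrightarrow> \<sigma> x = 1"
  shows "boundary S \<phi> = S \<sigma> \<phi>"
proof -
  define \<tau> where "\<tau> = (SOME \<sigma>. \<sigma> \<in> Lip_bs \<and> (\<forall>x \<in> supp \<phi>. \<sigma> x = 1))"
  have \<tau>: "\<tau> \<in> Lip_bs \<and> (\<forall>x \<in> supp \<phi>. \<tau> x = 1)"
    unfolding \<tau>_def by (rule someI_ex[OF Lip_bs_has_cutoff[OF \<phi>]])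
  have \<phi>L: "\<phi> \<in> Lip" using \<phi> by (rule Lip_bs_Lip)
  have "supp (\<lambda>x. 1 * \<tau> x + (-1) * \<sigma> x) \<subseteq> {x. \<phi> x = 0}"
  proof (rule supp_subset)
    show "closed {x. \<phi> x = 0}" using Lip_continuous[OF \<phi>L] by (intro closed_Collect_eq continuous_intros) auto
    fix x assume "1 * \<tau> x + (-1) * \<sigma> x \<noteq> 0"
    then have "x \<notin> supp \<phi>" using \<tau> \<sigma> by auto
    then show "x \<in> {x. \<phi> x = 0}" by (simp add: supp_zero)
  qed
  then have "S (\<lambda>x. 1 * \<tau> x + (-1) * \<sigma> x) \<phi> = 0"
    using \<tau> \<sigma>(1) by (intro pre_currentD(3)[OF S _ \<phi>L] Lip_bs_lincomb) auto
  then have "S \<tau> \<phi> = S \<sigma> \<phi>" using pre_currentD(1)[OF S \<phi>L, of \<tau> \<sigma> 1 "-1"] \<tau> \<sigma>(1) by simp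
  then show ?thesis by (simp add: boundary_def \<tau>_def)
qed

lemma boundary_linear:
  assumes S: "pre_current S" shows "linear_on_Lip_bs (boundary S)"
  unfolding linear_on_Lip_bs_def
proof (intro ballI allI)
  fix f g :: "'a \<Rightarrow> real" and a b assume f: "f \<in> Lip_bs" and g: "g \<in> Lip_bs"
  have h: "(\<lambda>x. a * f x + b * g x) \<in> Lip_bs" by (rule Lip_bs_lincomb[OF f g])
  have "bounded (supp f \<union> supp g \<union> supp (\<lambda>x. a * f x + b * g x))"
    using f g h by (auto simp: Lip_bs_def)
  then obtain n where n: "\<And>x m. x \<in> supp f \<union> supp g \<union> supp (\<lambda>x. a * f x + b * g x) \<Longrightarrow> n \<le> m \<Longrightarrow> cutoff m x = 1"
    using cutoff_eventually_one by blast
  have "boundary S (\<lambda>x. a * f x + b * g x) = S (cutoff n) (\<lambda>x. a * f x + b * g x)"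
    "boundary S f = S (cutoff n) f" "boundary S g = S (cutoff n) g"
    using n by (auto intro!: boundary_eq[OF S] f g h cutoff_Lip_bs)
  then show "boundary S (\<lambda>x. a * f x + b * g x) = a * boundary S f + b * boundary S g"
    using pre_currentD(2)[OF S cutoff_Lip_bs Lip_bs_Lip[OF f] Lip_bs_Lip[OF g]] by simp
qed

lemma boundary_cong: "(\<And>f \<pi>. f \<in> Lip_bs \<Longrightarrow> \<pi> \<in> Lip \<Longrightarrow> S f \<pi> = S' f \<pi>) \<Longrightarrow> f \<in> Lip_bs \<Longrightarrow> boundary S f = boundary S' f"
  unfolding boundary_def using someI_ex[OF Lip_bs_has_cutoff, of f] by (simp add: Lip_bs_Lip)

text \<open>The chosen \<sigma> depends on \<open>f\<close> alone, so both boundaries are evaluated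
  with the same \<sigma> and no property of the currents enters.\<close>

lemma boundary_diff: "boundary (\<lambda>f \<pi>. S f \<pi> - S' f \<pi>) f = boundary S f - boundary S' f"
  by (simp add: boundary_def)

lemma boundary_uminus: "boundary (\<lambda>f \<pi>. - S f \<pi>) f = - boundary S f"
  by (simp add: boundary_def)

lemma pre_current_lincomb:
  assumes "pre_current S" "pre_current S'"
  shows "pre_current (\<lambda>f \<pi>. a * S f \<pi> + b * S' f \<pi>)"
  unfolding pre_current_def linear_on_Lip_bs_def linear_on_Lip_def
proof (safe, goal_cases)
  case (1 \<pi> f g c d)
  then show ?case using pre_currentD(1)[OF assms(1), of \<pi> f g c d] pre_currentD(1)[OF assms(2), of \<pi> f g c d] by (simp add: algebra_simps)
next
  case (2 f \<pi> \<rho> c d)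
  then show ?case using pre_currentD(2)[OF assms(1), of f \<pi> \<rho> c d] pre_currentD(2)[OF assms(2), of f \<pi> \<rho> c d] by (simp add: algebra_simps)
next
  case (3 f \<pi>)
  then show ?case using pre_currentD(3)[OF assms(1), of f \<pi>] pre_currentD(3)[OF assms(2), of f \<pi>] by simp
next
  case (4 f \<pi> \<sigma>)
  have "S f \<pi> = S \<sigma> (\<lambda>x. f x * \<pi> x) - S (\<lambda>x. \<sigma> x * \<pi> x) f" "S' f \<pi> = S' \<sigma> (\<lambda>x. f x * \<pi> x) - S' (\<lambda>x. \<sigma> x * \<pi> x) f"
    using 4 by (auto intro!: pre_currentD(4)[OF assms(1)] pre_currentD(4)[OF assms(2)])
  then show ?case by (simp only: right_diff_distrib)
qed

text \<open>Each condition is an identity between finitely many values of the functional.\<close>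

lemma pre_current_limit:
  assumes S: "\<And>n. pre_current (S n)"
    and lim: "\<And>f \<pi>. f \<in> Lip_bs \<Longrightarrow> \<pi> \<in> Lip \<Longrightarrow> (\<lambda>n. S n f \<pi>) \<longlonglongrightarrow> R f \<pi>"
  shows "pre_current R"
  unfolding pre_current_def linear_on_Lip_bs_def linear_on_Lip_def
proof (safe, goal_cases)
  case (1 \<pi> f g c d)
  have "(\<lambda>n. S n (\<lambda>x. c * f x + d * g x) \<pi>) \<longlonglongrightarrow> c * R f \<pi> + d * R g \<pi>"
    using 1 by (simp add: pre_currentD(1)[OF S] tendsto_intros lim)
  moreover have "(\<lambda>n. S n (\<lambda>x. c * f x + d * g x) \<pi>) \<longlonglongrightarrow> R (\<lambda>x. c * f x + d * g x) \<pi>"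
    using 1 by (intro lim Lip_bs_lincomb)
  ultimately show ?case using LIMSEQ_unique by blast
next
  case (2 f \<pi> \<rho> c d)
  have "(\<lambda>n. S n f (\<lambda>x. c * \<pi> x + d * \<rho> x)) \<longlonglongrightarrow> c * R f \<pi> + d * R f \<rho>"
    using 2 by (simp add: pre_currentD(2)[OF S] tendsto_intros lim)
  moreover have "(\<lambda>n. S n f (\<lambda>x. c * \<pi> x + d * \<rho> x)) \<longlonglongrightarrow> R f (\<lambda>x. c * \<pi> x + d * \<rho> x)"
    using 2 by (intro lim Lip_lincomb)
  ultimately show ?case using LIMSEQ_unique by blast
next
  case (3 f \<pi>)
  then show ?case using lim[of f \<pi>] pre_currentD(3)[OF S, of f \<pi>] LIMSEQ_unique[OF _ tendsto_const, of 0 "R f \<pi>"] by simp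
next
  case (4 f \<pi> \<sigma>)
  have p: "(\<lambda>x. f x * \<pi> x) \<in> Lip" "(\<lambda>x. \<sigma> x * \<pi> x) \<in> Lip_bs" using 4 Lip_bs_mult Lip_bs_Lip by blast+
  have "S n f \<pi> = S n \<sigma> (\<lambda>x. f x * \<pi> x) - S n (\<lambda>x. \<sigma> x * \<pi> x) f" for n
    using 4 by (intro pre_currentD(4)[OF S]) auto
  moreover have "(\<lambda>n. S n \<sigma> (\<lambda>x. f x * \<pi> x) - S n (\<lambda>x. \<sigma> x * \<pi> x) f) \<longlonglongrightarrow> R \<sigma> (\<lambda>x. f x * \<pi> x) - R (\<lambda>x. \<sigma> x * \<pi> x) f"
    using 4 p by (intro tendsto_diff lim) (auto simp: Lip_bs_Lip)
  ultimately show ?case using lim[of f \<pi>] 4 LIMSEQ_unique by simp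
qed

lemma mass_bounds1I:
  assumes "loc_finite M" "\<And>f \<pi>. f \<in> Lip_bs \<Longrightarrow> \<pi> \<in> Lip \<Longrightarrow> \<bar>S f \<pi>\<bar> \<le> lip_const \<pi> * (\<integral>x. \<bar>f x\<bar> \<partial>M)"
  shows "measure M \<in> mass_bounds1 S"
  using assms M0b_nonneg_measure by (auto simp: mass_bounds1_def borel_extension_measure)

lemma mass_bounds0I:
  assumes "loc_finite M" "\<And>f. f \<in> Lip_bs \<Longrightarrow> \<bar>S f\<bar> \<le> (\<integral>x. \<bar>f x\<bar> \<partial>M)"
  shows "measure M \<in> mass_bounds0 S"
  using assms M0b_nonneg_measure by (auto simp: mass_bounds0_def borel_extension_measure)

text \<open>By linearity the sequence may be replaced by differences \<open>q j\<close> tending to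
  0. Rewriting \<open>S f (q j)\<close> through the boundary bounds it by integrals of
  \<open>q j\<close> itself against \<open>P\<close> and \<open>M\<close>. Equi-Lipschitz functions
  that converge at one point are dominated by an affine function of the distance to it, integrable
  on bounded supports, so dominated convergence finishes.\<close>

lemma pre_current_N1b:
  fixes S :: "'a::metric_space current1"
  assumes S: "pre_current S" and M: "loc_finite M" and P: "loc_finite P"
    and bM: "\<And>f \<pi>. f \<in> Lip_bs \<Longrightarrow> \<pi> \<in> Lip \<Longrightarrow> \<bar>S f \<pi>\<bar> \<le> lip_const \<pi> * (\<integral>x. \<bar>f x\<bar> \<partial>M)"
    and bP: "\<And>f. f \<in> Lip_bs \<Longrightarrow> \<bar>boundary S f\<bar> \<le> (\<integral>x. \<bar>f x\<bar> \<partial>P)"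
  shows "S \<in> N\<^sub>1\<^sub>b"
proof -
  have cont: "(\<lambda>j. S f (p j)) \<longlonglongrightarrow> S f \<pi>"
    if f: "f \<in> Lip_bs" and \<pi>: "\<pi> \<in> Lip" and p: "\<And>j. p j \<in> Lip" and bdd: "bdd_above (range (\<lambda>j. lip_const (p j)))"
      and lim: "\<And>x. (\<lambda>j. p j x) \<longlonglongrightarrow> \<pi> x" for f \<pi> and p :: "nat \<Rightarrow> 'a \<Rightarrow> real"
  proof -
    obtain K where K: "\<And>j. lip_const (p j) \<le> K" using bdd by (auto simp: bdd_above_def)
    have K0: "0 \<le> K" using K[of 0] lip_const_nonneg[OF p[of 0]] by linarith
    have fL: "f \<in> Lip" using f by (rule Lip_bs_Lip)
    obtain \<sigma> where \<sigma>: "\<sigma> \<in> Lip_bs" "\<And>x. x \<in> supp f \<Longrightarrow> \<sigma> x = 1" using Lip_bs_has_cutoff[OF f] by blast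
    define q where "q j x = 1 * p j x + (-1) * \<pi> x" for j x
    have q: "q j \<in> Lip" for j unfolding q_def[abs_def] by (rule Lip_lincomb[OF p \<pi>])
    have qlim: "(\<lambda>j. q j x) \<longlonglongrightarrow> 0" for x using tendsto_diff[OF lim[of x] tendsto_const[of "\<pi> x"]] by (simp add: q_def)
    have qlip: "\<bar>q j x - q j y\<bar> \<le> (K + lip_const \<pi>) * dist x y" for j x y
    proof -
      have "\<bar>p j x - p j y\<bar> \<le> K * dist x y"
        using lip_constD[OF p, of j x y] mult_right_mono[OF K[of j] zero_le_dist, of x y] by linarith
      then show ?thesis using lip_constD[OF \<pi>, of x y] by (simp add: q_def algebra_simps)
    qed
    define a :: 'a where "a = undefined"
    obtain c where c: "\<And>j. \<bar>q j a\<bar> \<le> c"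
      using Bseq_eq_bounded[THEN iffD1, OF convergent_imp_Bseq[OF convergentI[OF qlim[of a]]]]
      by (auto simp: bounded_iff)
    have DCT: "(\<lambda>j. \<integral>x. \<bar>g x * q j x\<bar> \<partial>N) \<longlonglongrightarrow> 0" if g: "g \<in> Lip_bs" and N: "loc_finite N" for g N
    proof -
      have w: "(\<lambda>x. g x * (c + (K + lip_const \<pi>) * dist x a)) \<in> Lip_bs"
      proof (rule Lip_bs_mult[OF g])
        show "(\<lambda>x. c + (K + lip_const \<pi>) * dist x a) \<in> Lip"
        proof (intro Lip_add Lip_const Lip_cmult)
          show "(\<lambda>x. dist x a) \<in> Lip"
            by (rule LipI_real[of 1]) (use abs_dist_diff_le[of _ a] in \<open>auto simp: dist_commute\<close>)
        qed
      qed
      have "(\<lambda>j. \<integral>x. \<bar>g x * q j x\<bar> \<partial>N) \<longlonglongrightarrow> (\<integral>x. 0 \<partial>N)"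
      proof (rule integral_dominated_convergence[where w="\<lambda>x. \<bar>g x * (c + (K + lip_const \<pi>) * dist x a)\<bar>"])
        show "integrable N (\<lambda>x. \<bar>g x * (c + (K + lip_const \<pi>) * dist x a)\<bar>)"
          using integrable_Lip_bs[OF N w] by auto
        show "AE x in N. (\<lambda>j. \<bar>g x * q j x\<bar>) \<longlonglongrightarrow> 0"
          using qlim by (intro AE_I2 tendsto_rabs_zero tendsto_mult_right_zero)
        show "AE x in N. norm \<bar>g x * q j x\<bar> \<le> \<bar>g x * (c + (K + lip_const \<pi>) * dist x a)\<bar>" for j
        proof (rule AE_I2)
          fix x
          have "\<bar>q j x\<bar> \<le> c + (K + lip_const \<pi>) * dist x a" using qlip[of j x a] c[of j] by linarith
          then have "\<bar>q j x\<bar> \<le> \<bar>c + (K + lip_const \<pi>) * dist x a\<bar>" by linarith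
          then show "norm \<bar>g x * q j x\<bar> \<le> \<bar>g x * (c + (K + lip_const \<pi>) * dist x a)\<bar>"
            by (simp add: abs_mult mult_left_mono)
        qed
        show "(\<lambda>x. \<bar>g x * q j x\<bar>) \<in> borel_measurable N" for j
          using Lip_bs_measurable[OF g] Lip_measurable[OF q[of j]] unfolding loc_finite_measurable[OF N] by measurable
      qed simp
      then show ?thesis by simp
    qed
    have bnd: "\<bar>S f (q j)\<bar> \<le> (\<integral>x. \<bar>f x * q j x\<bar> \<partial>P) + lip_const f * (\<integral>x. \<bar>\<sigma> x * q j x\<bar> \<partial>M)" for j
    proof -
      have fq: "(\<lambda>x. f x * q j x) \<in> Lip_bs" "(\<lambda>x. \<sigma> x * q j x) \<in> Lip_bs" using f \<sigma>(1) q by (auto intro: Lip_bs_mult)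
      have "supp (\<lambda>x. f x * q j x) \<subseteq> supp f" by (rule supp_mono) simp
      then have "boundary S (\<lambda>x. f x * q j x) = S \<sigma> (\<lambda>x. f x * q j x)"
        using \<sigma>(2) by (intro boundary_eq[OF S fq(1) \<sigma>(1)]) auto
      then have "S f (q j) = boundary S (\<lambda>x. f x * q j x) - S (\<lambda>x. \<sigma> x * q j x) f"
        using pre_currentD(4)[OF S f q \<sigma>, of j] by simp
      then show ?thesis using bP[OF fq(1)] bM[OF fq(2) fL] by linarith
    qed
    have "(\<lambda>j. (\<integral>x. \<bar>f x * q j x\<bar> \<partial>P) + lip_const f * (\<integral>x. \<bar>\<sigma> x * q j x\<bar> \<partial>M)) \<longlonglongrightarrow> 0 + lip_const f * 0"
      by (intro tendsto_intros DCT f \<sigma>(1) M P)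
    then have z: "(\<lambda>j. (\<integral>x. \<bar>f x * q j x\<bar> \<partial>P) + lip_const f * (\<integral>x. \<bar>\<sigma> x * q j x\<bar> \<partial>M)) \<longlonglongrightarrow> 0"
      by simp
    have "(\<lambda>j. S f (q j)) \<longlonglongrightarrow> 0"
      by (rule Lim_null_comparison[OF always_eventually z]) (simp only: real_norm_def bnd, simp)
    moreover have "(\<lambda>j. S f (q j)) = (\<lambda>j. S f (p j) - S f \<pi>)"
    proof
      fix j
      show "S f (q j) = S f (p j) - S f \<pi>"
        using pre_currentD(2)[OF S f p[of j] \<pi>, of 1 "-1"] by (simp add: q_def[abs_def])
    qed
    ultimately show ?thesis by (simp only: LIM_zero_cancel)
  qed
  have "S \<in> M\<^sub>1\<^sub>b"
    unfolding M\<^sub>1\<^sub>b_def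
  proof (intro CollectI conjI)
    show "\<forall>\<pi>\<in>Lip. linear_on_Lip_bs (\<lambda>f. S f \<pi>)" "\<forall>f\<in>Lip_bs. linear_on_Lip (S f)"
      "\<forall>f\<in>Lip_bs. \<forall>\<pi>\<in>Lip. (\<forall>x\<in>supp f. \<pi> x = 0) \<longrightarrow> S f \<pi> = 0"
      using S by (simp_all add: pre_current_def)
    show "mass_bounds1 S \<noteq> {}" using mass_bounds1I[OF M bM] by blast
    show "\<forall>f\<in>Lip_bs. \<forall>\<pi>\<in>Lip. \<forall>p. (\<forall>j. p j \<in> Lip) \<and> bdd_above (range (\<lambda>j. lip_const (p j))) \<and>
        (\<forall>x. (\<lambda>j. p j x) \<longlonglongrightarrow> \<pi> x) \<longrightarrow> (\<lambda>j. S f (p j)) \<longlonglongrightarrow> S f \<pi>"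
      using cont by simp
  qed
  moreover have "boundary S \<in> currents0"
    unfolding currents0_def using boundary_linear[OF S] mass_bounds0I[OF P bP] by blast
  ultimately show ?thesis by (simp add: N\<^sub>1\<^sub>b_def)
qed

lemma pre_current_cong:
  assumes S: "pre_current S" and eq: "\<And>f \<pi>. f \<in> Lip_bs \<Longrightarrow> \<pi> \<in> Lip \<Longrightarrow> S' f \<pi> = S f \<pi>"
  shows "pre_current S'"
  by (rule pre_current_limit[where S="\<lambda>_. S"]) (simp_all add: S eq)

text \<open>The restriction of \<open>T\<close> to \<open>A\<close>. Each condition is an integrated
  form of an almost-everywhere rule for \<open>current_density\<close>, and such rules may be
  multiplied by an indicator. No bound on the boundary of the restriction is available in general,
  so it is claimed to be a \<open>pre_current\<close> only.\<close>

lemma pre_current_restrict: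
  fixes T :: "'a::metric_space current1"
  assumes ctx: "T \<in> M\<^sub>1\<^sub>b" "loc_finite M" "unit_density r" "mass1_le T M r" and A: "A \<in> sets borel"
  shows "pre_current (\<lambda>f \<pi>. \<integral>x. f x * (indicator A x * current_density T M r \<pi> x) \<partial>M)"
proof -
  let ?g = "current_density T M r"
  have [measurable_cong]: "sets M = sets borel" by (rule loc_finite_sets[OF ctx(2)])
  note [measurable] = A
  have gm[measurable]: "?g \<pi> \<in> borel_measurable borel" if "\<pi> \<in> Lip" for \<pi>
    by (rule current_densityD(1)[OF ctx that])
  have int: "integrable M (\<lambda>x. f x * (indicator A x * ?g \<pi> x))" if f: "f \<in> Lip_bs" and \<pi>: "\<pi> \<in> Lip" for f \<pi>
  proof (rule Lip_bs_integrable(1)[OF ctx(2) f, where C="lip_const \<pi>"])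
    show "(\<lambda>x. indicator A x * ?g \<pi> x) \<in> borel_measurable borel" using gm[OF \<pi>] by measurable
    show "\<bar>indicator A x * ?g \<pi> x\<bar> \<le> lip_const \<pi>" for x
      using current_densityD(3)[OF ctx \<pi>, of x] lip_const_nonneg[OF \<pi>] by (simp split: split_indicator)
  qed
  show ?thesis
    unfolding pre_current_def linear_on_Lip_bs_def linear_on_Lip_def
  proof (intro conjI ballI allI impI)
    fix \<pi> f g :: "'a \<Rightarrow> real" and a b assume \<pi>: "\<pi> \<in> Lip" and f: "f \<in> Lip_bs" and g: "g \<in> Lip_bs"
    have "(\<integral>x. (a * f x + b * g x) * (indicator A x * ?g \<pi> x) \<partial>M)
        = (\<integral>x. a * (f x * (indicator A x * ?g \<pi> x)) + b * (g x * (indicator A x * ?g \<pi> x)) \<partial>M)"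
      by (rule Bochner_Integration.integral_cong) (auto simp: algebra_simps)
    then show "(\<integral>x. (a * f x + b * g x) * (indicator A x * ?g \<pi> x) \<partial>M)
        = a * (\<integral>x. f x * (indicator A x * ?g \<pi> x) \<partial>M) + b * (\<integral>x. g x * (indicator A x * ?g \<pi> x) \<partial>M)"
      using int[OF f \<pi>] int[OF g \<pi>] by simp
  next
    fix f \<pi> \<rho> :: "'a \<Rightarrow> real" and a b assume f: "f \<in> Lip_bs" and \<pi>: "\<pi> \<in> Lip" and \<rho>: "\<rho> \<in> Lip"
    note [measurable] = gm[OF \<pi>] gm[OF \<rho>] gm[OF Lip_lincomb[OF \<pi> \<rho>, of a b]] Lip_bs_measurable[OF f]
    have "(\<integral>x. f x * (indicator A x * ?g (\<lambda>x. a * \<pi> x + b * \<rho> x) x) \<partial>M)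
        = (\<integral>x. a * (f x * (indicator A x * ?g \<pi> x)) + b * (f x * (indicator A x * ?g \<rho> x)) \<partial>M)"
    proof (rule integral_cong_AE)
      show "AE x in M. f x * (indicator A x * ?g (\<lambda>x. a * \<pi> x + b * \<rho> x) x)
          = a * (f x * (indicator A x * ?g \<pi> x)) + b * (f x * (indicator A x * ?g \<rho> x))"
        using current_density_lincomb[OF ctx \<pi> \<rho>, of a b] by eventually_elim (simp add: algebra_simps)
    qed measurable
    then show "(\<integral>x. f x * (indicator A x * ?g (\<lambda>x. a * \<pi> x + b * \<rho> x) x) \<partial>M)
        = a * (\<integral>x. f x * (indicator A x * ?g \<pi> x) \<partial>M) + b * (\<integral>x. f x * (indicator A x * ?g \<rho> x) \<partial>M)"
      using int[OF f \<pi>] int[OF f \<rho>] by simp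
  next
    fix f \<pi> :: "'a \<Rightarrow> real" assume f: "f \<in> Lip_bs" and \<pi>: "\<pi> \<in> Lip" and z: "\<forall>x\<in>supp f. \<pi> x = 0"
    note [measurable] = gm[OF \<pi>] Lip_bs_measurable[OF f]
    have "(\<integral>x. f x * (indicator A x * ?g \<pi> x) \<partial>M) = (\<integral>x. 0 \<partial>M)"
    proof (rule integral_cong_AE)
      show "AE x in M. f x * (indicator A x * ?g \<pi> x) = 0"
        using current_density_zero[OF ctx \<pi>]
      proof eventually_elim
        case (elim x)
        then show ?case using z supp_zero[of x f] by (cases "x \<in> supp f") auto
      qed
    qed measurable
    then show "(\<integral>x. f x * (indicator A x * ?g \<pi> x) \<partial>M) = 0" by simp
  next
    fix f \<pi> \<sigma> :: "'a \<Rightarrow> real" assume f: "f \<in> Lip_bs" and \<pi>: "\<pi> \<in> Lip" and \<sigma>: "\<sigma> \<in> Lip_bs" "\<forall>x\<in>supp f. \<sigma> x = 1"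
    have fL: "f \<in> Lip" using f by (rule Lip_bs_Lip)
    have \<sigma>\<pi>: "(\<lambda>x. \<sigma> x * \<pi> x) \<in> Lip_bs" using \<sigma>(1) \<pi> by (rule Lip_bs_mult)
    have f\<pi>: "(\<lambda>x. f x * \<pi> x) \<in> Lip" using Lip_bs_mult[OF f \<pi>] by (rule Lip_bs_Lip)
    note [measurable] = gm[OF \<pi>] gm[OF fL] gm[OF f\<pi>]
      Lip_bs_measurable[OF f] Lip_bs_measurable[OF \<sigma>(1)] Lip_measurable[OF \<pi>]
    have sf: "\<sigma> x * f x = f x" for x using \<sigma>(2) supp_zero[of x f] by (cases "x \<in> supp f") auto
    have "(\<integral>x. \<sigma> x * (indicator A x * ?g (\<lambda>x. f x * \<pi> x) x) \<partial>M)
        = (\<integral>x. f x * (indicator A x * ?g \<pi> x) + \<sigma> x * \<pi> x * (indicator A x * ?g f x) \<partial>M)"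
    proof (rule integral_cong_AE)
      show "AE x in M. \<sigma> x * (indicator A x * ?g (\<lambda>x. f x * \<pi> x) x)
          = f x * (indicator A x * ?g \<pi> x) + \<sigma> x * \<pi> x * (indicator A x * ?g f x)"
        using current_density_Leibniz[OF ctx f \<pi>]
      proof eventually_elim
        case (elim x)
        then have "\<sigma> x * (indicator A x * ?g (\<lambda>x. f x * \<pi> x) x)
            = (\<sigma> x * f x) * (indicator A x * ?g \<pi> x) + \<sigma> x * \<pi> x * (indicator A x * ?g f x)"
          by (simp add: algebra_simps)
        then show ?case by (simp only: sf)
      qed
    qed measurable
    then show "(\<integral>x. f x * (indicator A x * ?g \<pi> x) \<partial>M)
        = (\<integral>x. \<sigma> x * (indicator A x * ?g (\<lambda>x. f x * \<pi> x) x) \<partial>M) - (\<integral>x. \<sigma> x * \<pi> x * (indicator A x * ?g f x) \<partial>M)"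
      using int[OF f \<pi>] int[OF \<sigma>\<pi> fL] by simp
  qed
qed

text \<open>With \<open>A = UNIV\<close> the restriction is \<open>T\<close> itself. The content is
  the last condition, which comes from the Leibniz rule.\<close>

lemma M1b_pre_current:
  fixes T :: "'a::metric_space current1"
  assumes T: "T \<in> M\<^sub>1\<^sub>b" shows "pre_current T"
proof -
  obtain \<mu> where \<mu>: "\<mu> \<in> M\<^sub>0\<^sub>b_nonneg" and bd: "\<And>f \<pi>. f \<in> Lip_bs \<Longrightarrow> \<pi> \<in> Lip \<Longrightarrow>
      \<bar>T f \<pi>\<bar> \<le> lip_const \<pi> * (\<integral>x. \<bar>f x\<bar> \<partial>borel_extension \<mu>)"
    using M1bD(5)[OF T] by (auto simp: mass_bounds1_def)
  have M: "loc_finite (borel_extension \<mu>)" by (rule loc_finite_borel_extension[OF \<mu>])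
  have r: "unit_density (\<lambda>x::'a. 1)" by (simp add: unit_density_def)
  have "mass1_le T (borel_extension \<mu>) (\<lambda>x. 1)" using bd by (simp add: mass1_le_def)
  note ctx = T M r this
  show ?thesis
    by (rule pre_current_cong[OF pre_current_restrict[OF ctx, of UNIV]]) (simp_all add: current_densityD(4)[OF ctx])
qed

section \<open>Convex feasibility in a product of intervals\<close>

text \<open>Tychonoff's theorem for a product of intervals.\<close>

lemma compact_cube: "compact {x :: 'i \<Rightarrow> real. \<forall>i. \<bar>x i\<bar> \<le> b i}"
proof -
  have eq: "{x :: 'i \<Rightarrow> real. \<forall>i. \<bar>x i\<bar> \<le> b i} = PiE UNIV (\<lambda>i. {- b i..b i})"
    by (auto simp: PiE_def Pi_def abs_le_iff minus_le_iff)
  have "compactin (product_topology (\<lambda>i::'i. euclidean) UNIV) (PiE UNIV (\<lambda>i. {- b i..b i}))"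
    unfolding compactin_PiE by simp
  then show ?thesis unfolding eq by (simp add: euclidean_product_topology)
qed

text \<open>Finitely many constraints are solved by minimising the sum of their squares: at a minimiser
  the values of the constraints form a separating functional.\<close>

lemma convex_feasibility:
  fixes C :: "('i \<Rightarrow> real) set" and l :: "'p \<Rightarrow> ('i \<Rightarrow> real) \<Rightarrow> real"
  assumes clo: "closed C" and cube: "\<And>x i. x \<in> C \<Longrightarrow> \<bar>x i\<bar> \<le> b i"
    and conv: "\<And>x y t. x \<in> C \<Longrightarrow> y \<in> C \<Longrightarrow> 0 \<le> t \<Longrightarrow> t \<le> 1 \<Longrightarrow> (\<lambda>i. (1 - t) * x i + t * y i) \<in> C"
    and aff: "\<And>p x y t. p \<in> J \<Longrightarrow> l p (\<lambda>i. (1 - t) * x i + t * y i) = (1 - t) * l p x + t * l p y"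
    and cont: "\<And>p. p \<in> J \<Longrightarrow> continuous_on UNIV (l p)"
    and comb: "\<And>F c. finite F \<Longrightarrow> F \<subseteq> J \<Longrightarrow> \<exists>x\<in>C. 0 \<le> (\<Sum>p\<in>F. c p * l p x)"
  shows "\<exists>x\<in>C. \<forall>p\<in>J. l p x = 0"
proof -
  have "C = C \<inter> {x. \<forall>i. \<bar>x i\<bar> \<le> b i}" using cube by auto
  then have comp: "compact C" using closed_Int_compact[OF clo compact_cube, of b] by simp
  have "C \<inter> \<Inter>((\<lambda>p. {x. l p x = 0}) ` J) \<noteq> {}"
  proof (rule compact_imp_fip_image[OF comp])
    show "closed {x. l p x = 0}" if "p \<in> J" for p
      using cont[OF that] by (intro closed_Collect_eq continuous_intros) auto
    fix F assume F: "finite F" "F \<subseteq> J"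
    define Q where "Q x = (\<Sum>p\<in>F. (l p x)\<^sup>2)" for x
    have "continuous_on C Q" unfolding Q_def
      using F by (intro continuous_intros) (auto intro: continuous_on_subset[OF cont])
    moreover have "C \<noteq> {}" using comb[of "{}"] by auto
    ultimately obtain x where x: "x \<in> C" "\<And>y. y \<in> C \<Longrightarrow> Q x \<le> Q y"
      using continuous_attains_inf[OF comp] by blast
    obtain y where y: "y \<in> C" "0 \<le> (\<Sum>p\<in>F. - l p x * l p y)"
      using comb[OF F, of "\<lambda>p. - l p x"] by blast
    have Q0: "0 \<le> Q z" for z unfolding Q_def by (intro sum_nonneg) auto
    have "Q x \<le> 0"
    proof (rule ccontr)
      assume "\<not> Q x \<le> 0"
      then have pos: "Q x > 0" by simp
      \<comment> \<open>With the mixed term dropped, which \<open>y\<close> makes nonpositive, the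
        value on the segment is at most \<open>(1 - t)\<^sup>2 * Q x + t\<^sup>2 * Q y\<close>; this
        \<open>t\<close> minimises that bound and brings it below \<open>Q x\<close>.\<close>
      define t where "t = Q x / (Q x + Q y)"
      have t: "0 \<le> t" "t \<le> 1" "0 < t" using pos Q0[of y] by (auto simp: t_def)
      have "Q x \<le> Q (\<lambda>i. (1 - t) * x i + t * y i)" using x(2) conv[OF x(1) y(1) t(1,2)] .
      also have "\<dots> = (\<Sum>p\<in>F. ((1 - t) * l p x + t * l p y)\<^sup>2)" unfolding Q_def using F aff by (intro sum.cong) auto
      also have "\<dots> = (\<Sum>p\<in>F. (1 - t)\<^sup>2 * (l p x)\<^sup>2 + 2 * t * (1 - t) * (l p x * l p y) + t\<^sup>2 * (l p y)\<^sup>2)"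
        by (intro sum.cong refl) (simp add: power2_eq_square algebra_simps)
      also have "\<dots> = (1 - t)\<^sup>2 * Q x + 2 * t * (1 - t) * (\<Sum>p\<in>F. l p x * l p y) + t\<^sup>2 * Q y"
        by (simp add: sum.distrib sum_distrib_left Q_def)
      also have "\<dots> \<le> (1 - t)\<^sup>2 * Q x + t\<^sup>2 * Q y"
        using y(2) t by (simp add: sum_negf mult_nonneg_nonpos)
      finally have "0 \<le> t * (t * (Q x + Q y) - 2 * Q x)" by (simp add: power2_eq_square algebra_simps)
      then have "0 \<le> t * (Q x + Q y) - 2 * Q x" using t(3) by (simp add: zero_le_mult_iff)
      moreover have "t * (Q x + Q y) = Q x" using pos Q0[of y] by (simp add: t_def)
      ultimately show False using pos by simp
    qed
    then have "Q x = 0" using Q0[of x] by simp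
    then have "\<forall>p\<in>F. l p x = 0" unfolding Q_def using F(1) by (subst (asm) sum_nonneg_eq_0_iff) auto
    then show "C \<inter> \<Inter>((\<lambda>p. {x. l p x = 0}) ` F) \<noteq> {}" using x(1) by auto
  qed
  then show ?thesis by auto
qed

lemma linear_on_Lip_bs_sum:
  assumes L: "linear_on_Lip_bs L" and "finite F" "F \<subseteq> Lip_bs"
  shows "L (\<lambda>x. \<Sum>f\<in>F. c f * f x) = (\<Sum>f\<in>F. c f * L f)"
proof -
  have L': "L (\<lambda>x. a * f x + b * g x) = a * L f + b * L g" if "f \<in> Lip_bs" "g \<in> Lip_bs" for f g a b
    using L that by (simp add: linear_on_Lip_bs_def)
  show ?thesis using assms(2,3)
  proof (induction F rule: finite_induct)
    case empty
    show ?case using L'[OF Lip_bs_0 Lip_bs_0, of 0 0] by simp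
  next
    case (insert f F)
    have "(\<lambda>x. \<Sum>f\<in>F. c f * f x) \<in> Lip_bs" using insert by (intro Lip_bs_sum[where f="\<lambda>f. f"]) auto
    then have "L (\<lambda>x. c f * f x + 1 * (\<Sum>f\<in>F. c f * f x)) = c f * L f + 1 * L (\<lambda>x. \<Sum>f\<in>F. c f * f x)"
      using insert.prems by (intro L') auto
    then show ?case using insert by simp
  qed
qed

text \<open>A bathtub principle: fill from the top of \<phi> until the amount \<open>C\<close> of
  \<open>q\<close> is used. The last conclusion says that the allowance is used up unless the level
  has reached 0. The fraction \<open>b\<close> is needed since the level set at height
  \<open>c\<close> may carry mass.\<close>

lemma superlevel_selection:
  fixes P :: "'a::metric_space measure"
  assumes P: "loc_finite P" and q: "unit_density q" and \<phi>: "\<phi> \<in> Lip_bs" and C: "0 \<le> C"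
  obtains c :: real and b where "0 \<le> c" "unit_density b"
    "\<forall>x. (c < \<phi> x \<longrightarrow> b x = 1) \<and> (\<phi> x < c \<longrightarrow> b x = 0) \<and> (\<phi> x \<le> 0 \<longrightarrow> b x = 0)"
    "(\<integral>x. b x * q x \<partial>P) \<le> C" "c * (\<integral>x. b x * q x \<partial>P) = c * C"
proof -
  have [measurable_cong]: "sets P = sets borel" by (rule loc_finite_sets[OF P])
  note [measurable] = Lip_bs_measurable[OF \<phi>] unit_densityD(1)[OF q]
  have int: "integrable P (\<lambda>x. b x * q x)" if b: "unit_density b" "\<And>x. \<phi> x \<le> 0 \<Longrightarrow> b x = 0" for b
  proof (rule loc_finite_integrable[OF P _ Lip_bs_supp_bounded[OF \<phi>], where K=1])
    show "(\<lambda>x. b x * q x) \<in> borel_measurable borel" using unit_densityD(1)[OF b(1)] by measurable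
    show "\<bar>b x * q x\<bar> \<le> 1" for x
      unfolding abs_mult using mult_mono[OF unit_densityD(4)[OF b(1), of x] unit_densityD(4)[OF q, of x]] by simp
    show "b x * q x = 0" if "x \<notin> supp \<phi>" for x using b(2)[of x] supp_zero[OF that] by simp
  qed
  have ud: "unit_density (indicator {x. c < \<phi> x})" "unit_density (indicator {x. c \<le> \<phi> x})" for c
    by (auto simp: unit_density_def split: split_indicator)
  define m where "m c = (\<integral>x. indicator {x. c < \<phi> x} x * q x \<partial>P)" for c
  have mi: "integrable P (\<lambda>x. indicator {x. c < \<phi> x} x * q x)" if "0 \<le> c" for c
    using that by (intro int ud) auto
  have m_mono: "m d \<le> m c" if "0 \<le> c" "c \<le> d" for c d
    unfolding m_def using that unit_densityD(2)[OF q]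
    by (intro integral_mono mi mult_right_mono) (auto split: split_indicator)
  show ?thesis
  proof (cases "m 0 \<le> C")
    \<comment> \<open>The whole positive part of \<phi> fits into the allowance, so the level is 0
      and the last conclusion is trivial.\<close>
    case True
    show ?thesis
      by (rule that[of 0 "indicator {x. 0 < \<phi> x}"]) (use True ud m_def[of 0] in auto)
  next
    case False
    define A where "A = {c. 0 \<le> c \<and> m c \<le> C}"
    obtain K where K: "K > 0" "\<And>x. \<bar>\<phi> x\<bar> \<le> K" using Lip_bs_bounded[OF \<phi>] by blast
    have "indicator {x. K < \<phi> x} x = (0::real)" for x using K(2)[of x] by (auto split: split_indicator)
    then have "m K = 0" unfolding m_def by simp
    then have "K \<in> A" using K C by (simp add: A_def)
    then have Ane: "A \<noteq> {}" by auto
    have Abdd: "bdd_below A" by (auto simp: A_def intro!: bdd_belowI[of _ 0])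
    define c where "c = Inf A"
    have c0: "0 \<le> c" unfolding c_def by (rule cInf_greatest[OF Ane]) (simp add: A_def)
    have wi: "integrable P (\<lambda>x. indicator {x. 0 < \<phi> x} x * q x)" by (rule mi) simp
    have dom: "norm (indicator B x * q x) \<le> indicator {x. 0 < \<phi> x} x * q x" if "x \<in> B \<Longrightarrow> 0 < \<phi> x" for B x
      using that unit_densityD(2)[OF q, of x] by (auto split: split_indicator)
    \<comment> \<open>\<open>m\<close> is continuous from the right, because the sets above levels
      decreasing to \<open>c\<close> increase to the set above \<open>c\<close>.\<close>
    have mc: "m c \<le> C"
    proof (rule LIMSEQ_le_const2)
      show "(\<lambda>n. m (c + inverse (real (Suc n)))) \<longlonglongrightarrow> m c"
        unfolding m_def
      proof (rule integral_dominated_convergence[OF _ _ wi])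
        show "AE x in P. (\<lambda>n. indicator {x. c + inverse (real (Suc n)) < \<phi> x} x * q x) \<longlonglongrightarrow> indicator {x. c < \<phi> x} x * q x"
        proof (intro AE_I2 tendsto_mult tendsto_const)
          fix x
          show "(\<lambda>n. indicator {x. c + inverse (real (Suc n)) < \<phi> x} x) \<longlonglongrightarrow> (indicator {x. c < \<phi> x} x :: real)"
          proof (cases "c < \<phi> x")
            case True
            then have "\<forall>\<^sub>F n in sequentially. inverse (real (Suc n)) < \<phi> x - c"
              by (intro order_tendstoD(2)[OF LIMSEQ_inverse_real_of_nat]) simp
            then have "\<forall>\<^sub>F n in sequentially. indicator {x. c + inverse (real (Suc n)) < \<phi> x} x = (indicator {x. c < \<phi> x} x :: real)"
              by eventually_elim (use True in \<open>auto split: split_indicator\<close>)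
            then show ?thesis by (rule tendsto_eventually)
          next
            case False
            have "indicator {x. c + inverse (real (Suc n)) < \<phi> x} x = (0::real)" for n
            proof -
              have "inverse (real (Suc n)) > 0" by simp
              then have "\<not> c + inverse (real (Suc n)) < \<phi> x" using False by linarith
              then show ?thesis by simp
            qed
            then show ?thesis using False by simp
          qed
        qed
        show "AE x in P. norm (indicator {x. c + inverse (real (Suc n)) < \<phi> x} x * q x) \<le> indicator {x. 0 < \<phi> x} x * q x" for n
        proof (intro AE_I2 dom)
          fix x assume "x \<in> {x. c + inverse (real (Suc n)) < \<phi> x}"
          moreover have "inverse (real (Suc n)) > 0" by simp
          ultimately show "0 < \<phi> x" using c0 unfolding mem_Collect_eq by linarith
        qed
      qed measurable
      have "m (c + inverse (real (Suc n))) \<le> C" for n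
      proof -
        have "Inf A < c + inverse (real (Suc n))" by (simp add: c_def)
        from cInf_lessD[OF Ane this] obtain d where d: "d \<in> A" "d < c + inverse (real (Suc n))" by blast
        then have "m (c + inverse (real (Suc n))) \<le> m d" by (intro m_mono) (auto simp: A_def)
        then show ?thesis using d(1) by (simp add: A_def)
      qed
      then show "\<exists>N. \<forall>n\<ge>N. m (c + inverse (real (Suc n))) \<le> C" by blast
    qed
    then have cpos: "c > 0" using c0 False by (cases "c = 0") auto
    define m' where "m' = (\<integral>x. indicator {x. c \<le> \<phi> x} x * q x \<partial>P)"
    have m'i: "integrable P (\<lambda>x. indicator {x. c \<le> \<phi> x} x * q x)"
      using cpos by (intro int ud) auto
    \<comment> \<open>From the left the limit of \<open>m\<close> is \<open>m'\<close>, the amount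
      including the level set. Steps proportional to \<open>c\<close> keep the levels nonnegative,
      where domination by the set above 0 is available.\<close>
    have m'C: "C \<le> m'"
    proof (rule LIMSEQ_le_const)
      show "(\<lambda>n. m (c - c * inverse (real (Suc n)))) \<longlonglongrightarrow> m'"
        unfolding m_def m'_def
      proof (rule integral_dominated_convergence[OF _ _ wi])
        have dpos: "0 \<le> c - c * inverse (real (Suc n))" "c - c * inverse (real (Suc n)) < c" for n
          using cpos by (auto simp: mult_left_le inverse_le_1_iff)
        show "AE x in P. (\<lambda>n. indicator {x. c - c * inverse (real (Suc n)) < \<phi> x} x * q x) \<longlonglongrightarrow> indicator {x. c \<le> \<phi> x} x * q x"
        proof (intro AE_I2 tendsto_mult tendsto_const)
          fix x
          show "(\<lambda>n. indicator {x. c - c * inverse (real (Suc n)) < \<phi> x} x) \<longlonglongrightarrow> (indicator {x. c \<le> \<phi> x} x :: real)"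
          proof (cases "c \<le> \<phi> x")
            case True
            then have "indicator {x. c - c * inverse (real (Suc n)) < \<phi> x} x = (1::real)" for n
              using dpos(2)[of n] by simp
            then show ?thesis using True by simp
          next
            case False
            have "(\<lambda>n. c - c * inverse (real (Suc n))) \<longlonglongrightarrow> c - c * 0"
              by (intro tendsto_intros LIMSEQ_inverse_real_of_nat)
            then have "\<forall>\<^sub>F n in sequentially. \<phi> x < c - c * inverse (real (Suc n))"
              using False by (intro order_tendstoD(1)) auto
            then have "\<forall>\<^sub>F n in sequentially. indicator {x. c - c * inverse (real (Suc n)) < \<phi> x} x = (indicator {x. c \<le> \<phi> x} x :: real)"
              by eventually_elim (use False in \<open>auto split: split_indicator\<close>)
            then show ?thesis by (rule tendsto_eventually)
          qed
        qed
        show "AE x in P. norm (indicator {x. c - c * inverse (real (Suc n)) < \<phi> x} x * q x) \<le> indicator {x. 0 < \<phi> x} x * q x" for n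
          by (intro AE_I2 dom) (use dpos(1)[of n] in auto)
      qed measurable
      have "C \<le> m (c - c * inverse (real (Suc n)))" for n
      proof (rule ccontr)
        assume "\<not> C \<le> m (c - c * inverse (real (Suc n)))"
        moreover have "0 \<le> c - c * inverse (real (Suc n))" using cpos by (auto simp: mult_left_le inverse_le_1_iff)
        ultimately have "c - c * inverse (real (Suc n)) \<in> A" by (simp add: A_def)
        then have "c \<le> c - c * inverse (real (Suc n))" unfolding c_def by (rule cInf_lower[OF _ Abdd])
        then have "c * inverse (real (Suc n)) \<le> 0" by linarith
        moreover have "0 < c * inverse (real (Suc n))" using cpos by simp
        ultimately show False by linarith
      qed
      then show "\<exists>N. \<forall>n\<ge>N. C \<le> m (c - c * inverse (real (Suc n)))" by blast
    qed
    \<comment> \<open>The share of the level set to be included. If the level set carries nothing,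
      then \<open>m c = C = m'\<close> and any share would do.\<close>
    define \<theta> where "\<theta> = (if m' = m c then 0 else (C - m c) / (m' - m c))"
    have \<theta>: "0 \<le> \<theta>" "\<theta> \<le> 1" "m c + \<theta> * (m' - m c) = C"
      using mc m'C by (auto simp: \<theta>_def divide_simps)
    define b where "b x = indicator {x. c < \<phi> x} x + \<theta> * (indicator {x. c \<le> \<phi> x} x - indicator {x. c < \<phi> x} x)" for x
    have "(\<integral>x. b x * q x \<partial>P) = (\<integral>x. indicator {x. c < \<phi> x} x * q x + \<theta> * (indicator {x. c \<le> \<phi> x} x * q x - indicator {x. c < \<phi> x} x * q x) \<partial>P)"
      by (rule Bochner_Integration.integral_cong) (auto simp: b_def algebra_simps)
    also have "\<dots> = C" using mi[OF c0] m'i \<theta>(3) by (simp add: m_def m'_def)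
    finally have bC: "(\<integral>x. b x * q x \<partial>P) = C" .
    show ?thesis
    proof (rule that[OF c0])
      have "b \<in> borel_measurable borel" unfolding b_def by measurable
      then show "unit_density b" using \<theta>(1,2) by (auto simp: unit_density_def b_def split: split_indicator)
    qed (use bC cpos in \<open>auto simp: b_def\<close>)
  qed
qed

section \<open>Subcurrents draining the boundary in a bounded set\<close>

lemma closed_Collect_Ball: "(\<And>a. a \<in> A \<Longrightarrow> closed {x. Q a x}) \<Longrightarrow> closed {x. \<forall>a\<in>A. Q a x}"
proof -
  assume "\<And>a. a \<in> A \<Longrightarrow> closed {x. Q a x}"
  then have "closed (\<Inter>a\<in>A. {x. Q a x})" by (rule closed_INT[rule_format])
  moreover have "(\<Inter>a\<in>A. {x. Q a x}) = {x. \<forall>a\<in>A. Q a x}" by auto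
  ultimately show ?thesis by simp
qed

lemma closed_Collect_imp_const: "(A \<Longrightarrow> closed {x. Q x}) \<Longrightarrow> closed {x. A \<longrightarrow> Q x}"
  by (cases A) auto

lemma abs_convex_comb_le:
  fixes t :: real
  assumes "\<bar>a\<bar> \<le> u" "\<bar>b\<bar> \<le> v" "0 \<le> t" "t \<le> 1"
  shows "\<bar>(1 - t) * a + t * b\<bar> \<le> (1 - t) * u + t * v"
proof -
  have "\<bar>(1 - t) * a + t * b\<bar> \<le> \<bar>1 - t\<bar> * \<bar>a\<bar> + \<bar>t\<bar> * \<bar>b\<bar>" by (metis abs_mult abs_triangle_ineq)
  also have "\<dots> \<le> (1 - t) * u + t * v" using assms by (intro add_mono mult_mono) auto
  finally show ?thesis .
qed

lemma convex_comb_mono: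
  fixes t :: real
  assumes "a \<le> u" "b \<le> v" "0 \<le> t" "t \<le> 1"
  shows "(1 - t) * a + t * b \<le> (1 - t) * u + t * v"
  using assms by (intro add_mono mult_left_mono) auto

lemma linear_on_Lip_bs_convex_comb:
  assumes "linear_on_Lip_bs L" "linear_on_Lip_bs L'" shows "linear_on_Lip_bs (\<lambda>f. s * L f + t * L' f)"
  using assms by (simp add: linear_on_Lip_bs_def algebra_simps)

lemma linear_on_Lip_bs_integral:
  fixes g :: "'a::metric_space \<Rightarrow> real"
  assumes M: "loc_finite M" and g: "g \<in> borel_measurable borel" "\<And>x. \<bar>g x\<bar> \<le> C"
  shows "linear_on_Lip_bs (\<lambda>f. \<integral>x. f x * g x \<partial>M)"
  unfolding linear_on_Lip_bs_def
proof (intro ballI allI)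
  fix f h :: "'a \<Rightarrow> real" and a b assume f: "f \<in> Lip_bs" and h: "h \<in> Lip_bs"
  have "(\<integral>x. (a * f x + b * h x) * g x \<partial>M) = (\<integral>x. a * (f x * g x) + b * (h x * g x) \<partial>M)"
    by (rule Bochner_Integration.integral_cong) (auto simp: algebra_simps)
  then show "(\<integral>x. (a * f x + b * h x) * g x \<partial>M) = a * (\<integral>x. f x * g x \<partial>M) + b * (\<integral>x. h x * g x \<partial>M)"
    using Lip_bs_integrable(1)[OF M f g] Lip_bs_integrable(1)[OF M h g] by simp
qed

text \<open>A point \<open>x\<close> of the feasible set encodes a triple of functionals: the subcurrent \<open>S\<close>, its share \<open>H\<close>
  of the mass of \<open>T\<close>, and the part \<open>N\<close> of the negative boundary used by \<open>S\<close>.\<close>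

type_synonym 'a triple = "nat \<times> ('a \<Rightarrow> real) \<times> ('a \<Rightarrow> real) \<Rightarrow> real"

text \<open>One index type holds all three functionals, so the product of intervals applies
  directly: the first component is a tag, and the slot that \<open>H\<close> and \<open>N\<close>
  leave open is filled with the zero function.\<close>

definition tr_S :: "'a triple \<Rightarrow> 'a current1" where "tr_S x f \<pi> = x (0, f, \<pi>)"
definition tr_H :: "'a triple \<Rightarrow> 'a current0" where "tr_H x f = x (1, f, \<lambda>_. 0)"
definition tr_N :: "'a triple \<Rightarrow> 'a current0" where "tr_N x f = x (2, f, \<lambda>_. 0)"

context
  fixes T :: "'a::metric_space current1" and M P :: "'a measure" and r p q :: "'a \<Rightarrow> real" and U :: "'a set"
  assumes T: "T \<in> M\<^sub>1\<^sub>b" and M: "loc_finite M" and r: "unit_density r" and T_le: "mass1_le T M r"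
    and P: "loc_finite P" and p: "unit_density p" and q: "unit_density q"
    and bdT: "\<forall>f\<in>Lip_bs. boundary T f = (\<integral>x. f x * (p x - q x) \<partial>P)"
    and U: "U \<in> bounded_borel"
begin

private definition cap :: real where "cap = (\<integral>x. indicator U x * p x \<partial>P)"

text \<open>The bound 0 at indices without meaning confines the points there too; compactness needs
  an interval for every coordinate.\<close>

private definition box :: "nat \<times> ('a \<Rightarrow> real) \<times> ('a \<Rightarrow> real) \<Rightarrow> real"
  where "box = (\<lambda>(k, f, \<pi>).
    if f \<notin> Lip_bs \<or> \<pi> \<notin> Lip then 0
    else if k = 0 then lip_const \<pi> * (\<integral>x. \<bar>f x\<bar> * r x \<partial>M)
    else if k = 1 then (\<integral>x. \<bar>f x\<bar> * r x \<partial>M)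
    else if k = 2 then (\<integral>x. \<bar>f x\<bar> * q x \<partial>P) else 0)"

text \<open>The two bounds by \<open>tr_H\<close> express that \<open>S\<close> is a subcurrent in a
  form that is linear in the unknowns. The last line says that the total mass of the sinks is at
  most the mass of the sources in \<open>U\<close>, tested with functions of bounded support.
  Continuity in \<pi> is not imposed here; it is recovered at the end from
  \<open>pre_current_N1b\<close>.\<close>

private definition feasible :: "'a triple set"
  where "feasible = {x.
    (\<forall>i. \<bar>x i\<bar> \<le> box i) \<and> pre_current (tr_S x) \<and> linear_on_Lip_bs (tr_H x) \<and> linear_on_Lip_bs (tr_N x) \<and>
    (\<forall>f\<in>Lip_bs. \<forall>\<pi>\<in>Lip. \<bar>tr_S x f \<pi>\<bar> \<le> lip_const \<pi> * tr_H x (\<lambda>x. \<bar>f x\<bar>)) \<and>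
    (\<forall>f\<in>Lip_bs. \<forall>\<pi>\<in>Lip. \<bar>T f \<pi> - tr_S x f \<pi>\<bar> \<le> lip_const \<pi> * ((\<integral>x. \<bar>f x\<bar> * r x \<partial>M) - tr_H x (\<lambda>x. \<bar>f x\<bar>))) \<and>
    (\<forall>f\<in>Lip_bs. (\<forall>y. 0 \<le> f y) \<longrightarrow> 0 \<le> tr_H x f) \<and>
    (\<forall>f\<in>Lip_bs. (\<forall>y. 0 \<le> f y) \<longrightarrow> 0 \<le> tr_N x f) \<and>
    (\<forall>f\<in>Lip_bs. (\<forall>y. f y \<le> 1) \<longrightarrow> tr_N x f \<le> cap)}"

private lemma feasibleD:
  assumes "x \<in> feasible"
  shows "\<And>i. \<bar>x i\<bar> \<le> box i" "pre_current (tr_S x)" "linear_on_Lip_bs (tr_H x)" "linear_on_Lip_bs (tr_N x)"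
    "\<And>f \<pi>. f \<in> Lip_bs \<Longrightarrow> \<pi> \<in> Lip \<Longrightarrow> \<bar>tr_S x f \<pi>\<bar> \<le> lip_const \<pi> * tr_H x (\<lambda>x. \<bar>f x\<bar>)"
    "\<And>f \<pi>. f \<in> Lip_bs \<Longrightarrow> \<pi> \<in> Lip \<Longrightarrow>
      \<bar>T f \<pi> - tr_S x f \<pi>\<bar> \<le> lip_const \<pi> * ((\<integral>x. \<bar>f x\<bar> * r x \<partial>M) - tr_H x (\<lambda>x. \<bar>f x\<bar>))"
    "\<And>f. f \<in> Lip_bs \<Longrightarrow> (\<And>y. 0 \<le> f y) \<Longrightarrow> 0 \<le> tr_H x f"
    "\<And>f. f \<in> Lip_bs \<Longrightarrow> (\<And>y. 0 \<le> f y) \<Longrightarrow> 0 \<le> tr_N x f"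
    "\<And>f. f \<in> Lip_bs \<Longrightarrow> (\<And>y. f y \<le> 1) \<Longrightarrow> tr_N x f \<le> cap"
  using assms unfolding feasible_def mem_Collect_eq by (elim conjE; simp del: split_paired_All)+

private definition defect :: "('a \<Rightarrow> real) \<Rightarrow> 'a triple \<Rightarrow> real"
  where "defect \<phi> x = boundary (tr_S x) \<phi> - (\<integral>y. \<phi> y * (indicator U y * p y) \<partial>P) + tr_N x \<phi>"

text \<open>Every condition is an equality or inequality between continuous functions of finitely
  many coordinates, quantified over constants.\<close>

private lemma feasible_closed: "closed feasible"
  unfolding feasible_def pre_current_def linear_on_Lip_bs_def linear_on_Lip_def tr_S_def tr_H_def tr_N_def
  by (intro closed_Collect_conj closed_Collect_all closed_Collect_Ball closed_Collect_imp_const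
      closed_Collect_eq closed_Collect_le continuous_intros continuous_on_product_coordinates)

private lemma feasible_convex:
  assumes x: "x \<in> feasible" and y: "y \<in> feasible" and t: "0 \<le> t" "t \<le> 1"
  shows "(\<lambda>i. (1 - t) * x i + t * y i) \<in> feasible"
proof -
  define z where "z = (\<lambda>i. (1 - t) * x i + t * y i)"
  have S: "tr_S z = (\<lambda>f \<pi>. (1 - t) * tr_S x f \<pi> + t * tr_S y f \<pi>)"
    and H: "tr_H z = (\<lambda>f. (1 - t) * tr_H x f + t * tr_H y f)"
    and N: "tr_N z = (\<lambda>f. (1 - t) * tr_N x f + t * tr_N y f)"
    by (auto simp: z_def tr_S_def tr_H_def tr_N_def fun_eq_iff)
  have tt: "(1 - t) * u + t * u = u" for u :: real by (simp add: algebra_simps)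
  have "z \<in> feasible"
    unfolding feasible_def
  proof (intro CollectI conjI ballI allI impI)
    show "\<bar>z i\<bar> \<le> box i" for i
      using abs_convex_comb_le[OF feasibleD(1)[OF x] feasibleD(1)[OF y] t, of i i] by (simp add: z_def tt)
    show "pre_current (tr_S z)" unfolding S by (intro pre_current_lincomb feasibleD(2) x y)
    show "linear_on_Lip_bs (tr_H z)" "linear_on_Lip_bs (tr_N z)"
      unfolding H N by (intro linear_on_Lip_bs_convex_comb feasibleD(3,4) x y)+
  next
    fix f \<pi> :: "'a \<Rightarrow> real" assume f: "f \<in> Lip_bs" and \<pi>: "\<pi> \<in> Lip"
    have "\<bar>tr_S z f \<pi>\<bar> \<le> (1 - t) * (lip_const \<pi> * tr_H x (\<lambda>x. \<bar>f x\<bar>)) + t * (lip_const \<pi> * tr_H y (\<lambda>x. \<bar>f x\<bar>))"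
      unfolding S by (intro abs_convex_comb_le feasibleD(5) x y t f \<pi>)
    then show "\<bar>tr_S z f \<pi>\<bar> \<le> lip_const \<pi> * tr_H z (\<lambda>x. \<bar>f x\<bar>)" by (simp add: H algebra_simps)
    let ?I = "\<integral>x. \<bar>f x\<bar> * r x \<partial>M"
    have "\<bar>(1 - t) * (T f \<pi> - tr_S x f \<pi>) + t * (T f \<pi> - tr_S y f \<pi>)\<bar>
        \<le> (1 - t) * (lip_const \<pi> * (?I - tr_H x (\<lambda>x. \<bar>f x\<bar>))) + t * (lip_const \<pi> * (?I - tr_H y (\<lambda>x. \<bar>f x\<bar>)))"
      by (intro abs_convex_comb_le feasibleD(6) x y t f \<pi>)
    moreover have "(1 - t) * (T f \<pi> - tr_S x f \<pi>) + t * (T f \<pi> - tr_S y f \<pi>) = T f \<pi> - tr_S z f \<pi>"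
      by (simp add: S algebra_simps)
    moreover have "(1 - t) * (lip_const \<pi> * (?I - tr_H x (\<lambda>x. \<bar>f x\<bar>))) + t * (lip_const \<pi> * (?I - tr_H y (\<lambda>x. \<bar>f x\<bar>)))
        = lip_const \<pi> * (?I - tr_H z (\<lambda>x. \<bar>f x\<bar>))"
      by (simp add: H algebra_simps)
    ultimately show "\<bar>T f \<pi> - tr_S z f \<pi>\<bar> \<le> lip_const \<pi> * (?I - tr_H z (\<lambda>x. \<bar>f x\<bar>))" by simp
  next
    fix f :: "'a \<Rightarrow> real" assume f: "f \<in> Lip_bs" and nn: "\<forall>y. 0 \<le> f y"
    show "0 \<le> tr_H z f" "0 \<le> tr_N z f" unfolding H N
      using feasibleD(7,8)[OF x f] feasibleD(7,8)[OF y f] nn t by auto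
  next
    fix f :: "'a \<Rightarrow> real" assume f: "f \<in> Lip_bs" and le: "\<forall>y. f y \<le> 1"
    show "tr_N z f \<le> cap"
      using convex_comb_mono[OF feasibleD(9)[OF x f] feasibleD(9)[OF y f] t] le by (simp add: N tt)
  qed
  then show ?thesis by (simp add: z_def)
qed

private lemma integrable_Up: "integrable P (\<lambda>x. indicator U x * p x)"
proof (rule loc_finite_integrable[OF P, where A=U and K=1])
  show "(\<lambda>x. indicator U x * p x) \<in> borel_measurable borel"
    using U unit_densityD(1)[OF p] by (intro borel_measurable_times borel_measurable_indicator) (auto simp: bounded_borel_def)
  show "\<bar>indicator U x * p x\<bar> \<le> 1" for x using unit_densityD(4)[OF p, of x] by (simp split: split_indicator)
qed (use U in \<open>auto simp: bounded_borel_def\<close>)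

private lemma Up_measurable: "(\<lambda>x. indicator U x * p x) \<in> borel_measurable borel"
  using integrable_Up borel_measurable_integrable[OF integrable_Up] by (simp add: loc_finite_measurable[OF P])

private lemma Up_le: "\<bar>indicator U x * p x\<bar> \<le> 1"
  using unit_densityD(4)[OF p, of x] by (simp split: split_indicator)

text \<open>With \<open>\<psi> = max 0 (\<phi> - c)\<close>, the restriction to the set above
  \<open>c\<close> has boundary value \<open>\<integral> \<psi> (p - q)\<close>, and
  \<open>N \<phi>\<close> contributes \<open>\<integral> \<psi> q + c * cap\<close>. The
  \<open>q\<close> terms cancel, and the defect is the integral of
  \<open>(\<psi> - (\<phi> - c))\<close> over \<open>U\<close> and of \<psi> outside, both against
  \<open>p\<close>; the integrands are nonnegative.\<close>

private lemma feasible_witness: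
  assumes \<phi>: "\<phi> \<in> Lip_bs"
  shows "\<exists>x\<in>feasible. 0 \<le> defect \<phi> x"
proof -
  note ctx = T M r T_le
  let ?g = "current_density T M r"
  have sM[measurable_cong]: "sets M = sets borel" by (rule loc_finite_sets[OF M])
  have sP[measurable_cong]: "sets P = sets borel" by (rule loc_finite_sets[OF P])
  note [measurable] = Lip_bs_measurable[OF \<phi>] unit_densityD(1)[OF r] unit_densityD(1)[OF p] unit_densityD(1)[OF q]
  have cap0: "0 \<le> cap" unfolding cap_def using unit_densityD(2)[OF p] by (intro integral_nonneg_AE) auto
  obtain c b where c: "0 \<le> c" and b: "unit_density b"
    and bb: "\<forall>x. (c < \<phi> x \<longrightarrow> b x = 1) \<and> (\<phi> x < c \<longrightarrow> b x = 0) \<and> (\<phi> x \<le> 0 \<longrightarrow> b x = 0)"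
    and bC: "(\<integral>x. b x * q x \<partial>P) \<le> cap" "c * (\<integral>x. b x * q x \<partial>P) = c * cap"
    by (rule superlevel_selection[OF P q \<phi> cap0])
  have b1: "c < \<phi> x \<Longrightarrow> b x = 1" and b0: "\<phi> x < c \<Longrightarrow> b x = 0" "\<phi> x \<le> 0 \<Longrightarrow> b x = 0" for x using bb by auto
  note [measurable] = unit_densityD(1)[OF b]
  define A where "A = {x. c < \<phi> x}"
  have A[measurable]: "A \<in> sets borel" unfolding A_def by measurable
  define S where "S f \<pi> = (\<integral>x. f x * (indicator A x * ?g \<pi> x) \<partial>M)" for f \<pi>
  define H where "H f = (\<integral>x. f x * (indicator A x * r x) \<partial>M)" for f
  define N where "N f = (\<integral>x. f x * (b x * q x) \<partial>P)" for f
  have Ar: "unit_density (\<lambda>x. indicator A x * r x)" "unit_density (\<lambda>x. indicator (- A) x * r x)"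
    using unit_densityD[OF r] by (auto simp: unit_density_def split: split_indicator)
  have bq: "unit_density (\<lambda>x. b x * q x)"
    unfolding unit_density_def using unit_densityD(2,3)[OF b] unit_densityD(2,3)[OF q]
    by (auto intro!: mult_nonneg_nonneg mult_le_one)
  have Slin: "pre_current S" unfolding S_def[abs_def] by (rule pre_current_restrict[OF ctx A])
  have Hlin: "linear_on_Lip_bs H" unfolding H_def[abs_def] by (rule linear_on_Lip_bs_integral[OF M unit_densityD(1,4)[OF Ar(1)]])
  have Nlin: "linear_on_Lip_bs N" unfolding N_def[abs_def] by (rule linear_on_Lip_bs_integral[OF P unit_densityD(1,4)[OF bq]])
  have intr: "integrable M (\<lambda>x. \<bar>f x\<bar> * w x)" if "f \<in> Lip_bs" "unit_density w" for f w
    by (rule Lip_bs_integrable(1)[OF M Lip_bs_abs[OF that(1)] unit_densityD(1,4)[OF that(2)]])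
  have Sb: "\<bar>S f \<pi>\<bar> \<le> lip_const \<pi> * H (\<lambda>x. \<bar>f x\<bar>)"
    and TSb: "\<bar>T f \<pi> - S f \<pi>\<bar> \<le> lip_const \<pi> * ((\<integral>x. \<bar>f x\<bar> * r x \<partial>M) - H (\<lambda>x. \<bar>f x\<bar>))"
    if f: "f \<in> Lip_bs" and \<pi>: "\<pi> \<in> Lip" for f \<pi>
  proof -
    note [measurable] = current_densityD(1)[OF ctx \<pi>]
    have gen: "\<bar>\<integral>x. f x * (indicator B x * ?g \<pi> x) \<partial>M\<bar> \<le> lip_const \<pi> * (\<integral>x. \<bar>f x\<bar> * (indicator B x * r x) \<partial>M)"
      if B[measurable]: "B \<in> sets borel" for B
    proof -
      have "\<bar>\<integral>x. f x * (indicator B x * ?g \<pi> x) \<partial>M\<bar> \<le> (\<integral>x. \<bar>f x\<bar> * (lip_const \<pi> * (indicator B x * r x)) \<partial>M)"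
      proof (rule abs_integral_density_le[OF M f, where C="lip_const \<pi>"])
        show "\<bar>indicator B x * ?g \<pi> x\<bar> \<le> lip_const \<pi>" for x
          using current_densityD(3)[OF ctx \<pi>, of x] lip_const_nonneg[OF \<pi>] by (simp split: split_indicator)
        show "\<bar>lip_const \<pi> * (indicator B x * r x)\<bar> \<le> lip_const \<pi>" for x
          using unit_densityD(2,3)[OF r, of x] lip_const_nonneg[OF \<pi>] by (simp add: abs_mult mult_left_le split: split_indicator)
        show "AE x in M. \<bar>indicator B x * ?g \<pi> x\<bar> \<le> lip_const \<pi> * (indicator B x * r x)"
          using current_densityD(2)[OF ctx \<pi>] by (intro AE_I2) (simp split: split_indicator)
      qed measurable
      then show ?thesis by (simp add: mult.left_commute)
    qed
    show "\<bar>S f \<pi>\<bar> \<le> lip_const \<pi> * H (\<lambda>x. \<bar>f x\<bar>)" unfolding S_def H_def by (rule gen[OF A])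
    have gi: "integrable M (\<lambda>x. f x * (indicator B x * ?g \<pi> x))" if B[measurable]: "B \<in> sets borel" for B
      by (rule Lip_bs_integrable(1)[OF M f, where C="lip_const \<pi>"])
        (use current_densityD(3)[OF ctx \<pi>] lip_const_nonneg[OF \<pi>] in \<open>auto split: split_indicator\<close>)
    have "T f \<pi> = (\<integral>x. f x * (indicator A x * ?g \<pi> x) + f x * (indicator (- A) x * ?g \<pi> x) \<partial>M)"
      unfolding current_densityD(4)[OF ctx \<pi> f]
      by (rule Bochner_Integration.integral_cong) (auto split: split_indicator)
    then have 1: "T f \<pi> - S f \<pi> = (\<integral>x. f x * (indicator (- A) x * ?g \<pi> x) \<partial>M)"
      using gi[of A] gi[of "- A"] by (simp add: S_def)
    have "(\<integral>x. \<bar>f x\<bar> * r x \<partial>M) = (\<integral>x. \<bar>f x\<bar> * (indicator A x * r x) + \<bar>f x\<bar> * (indicator (- A) x * r x) \<partial>M)"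
      by (rule Bochner_Integration.integral_cong) (auto split: split_indicator)
    then have 2: "(\<integral>x. \<bar>f x\<bar> * r x \<partial>M) - H (\<lambda>x. \<bar>f x\<bar>) = (\<integral>x. \<bar>f x\<bar> * (indicator (- A) x * r x) \<partial>M)"
      using intr[OF f Ar(1)] intr[OF f Ar(2)] by (simp add: H_def)
    show "\<bar>T f \<pi> - S f \<pi>\<bar> \<le> lip_const \<pi> * ((\<integral>x. \<bar>f x\<bar> * r x \<partial>M) - H (\<lambda>x. \<bar>f x\<bar>))"
      unfolding 1 2 by (rule gen) simp
  qed
  \<comment> \<open>The value 0 off the meaningful indices meets the bound that \<open>box\<close>
    imposes there.\<close>
  define x :: "'a triple" where "x = (\<lambda>(k, f, \<pi>). if f \<notin> Lip_bs \<or> \<pi> \<notin> Lip then 0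
    else if k = 0 then S f \<pi> else if k = 1 then H f else if k = 2 then N f else 0)"
  have xS: "tr_S x f \<pi> = S f \<pi>" if "f \<in> Lip_bs" "\<pi> \<in> Lip" for f \<pi> using that by (simp add: x_def tr_S_def)
  have xH: "tr_H x f = H f" and xN: "tr_N x f = N f" if "f \<in> Lip_bs" for f
    using that by (simp_all add: x_def tr_H_def tr_N_def Lip_const)
  have Hle: "\<bar>H f\<bar> \<le> (\<integral>x. \<bar>f x\<bar> * r x \<partial>M)" if f: "f \<in> Lip_bs" for f
    unfolding H_def using unit_densityD[OF r] unit_densityD[OF Ar(1)]
    by (intro abs_integral_density_le[OF M f, where C=1]) (auto split: split_indicator)
  have Nle: "\<bar>N f\<bar> \<le> (\<integral>x. \<bar>f x\<bar> * q x \<partial>P)" if f: "f \<in> Lip_bs" for f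
    unfolding N_def
  proof (rule abs_integral_density_le[OF P f, where C=1])
    show "AE x in P. \<bar>b x * q x\<bar> \<le> q x"
      using unit_densityD[OF b] unit_densityD[OF q] by (intro AE_I2) (simp add: abs_mult mult_left_le_one_le)
  qed (use unit_densityD[OF q] unit_densityD[OF bq] in auto)
  have bqi: "integrable P (\<lambda>x. b x * q x)"
  proof (rule loc_finite_integrable[OF P _ Lip_bs_supp_bounded[OF \<phi>], where K=1])
    show "b x * q x = 0" if "x \<notin> supp \<phi>" for x using b0(2)[of x] supp_zero[OF that] by simp
  qed (use unit_densityD[OF bq] in auto)
  have "x \<in> feasible"
    unfolding feasible_def
  proof (intro CollectI conjI ballI allI impI)
    fix i :: "nat \<times> ('a \<Rightarrow> real) \<times> ('a \<Rightarrow> real)"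
    obtain k f \<pi> where i: "i = (k, f, \<pi>)" by (cases i) auto
    show "\<bar>x i\<bar> \<le> box i"
    proof (cases "f \<in> Lip_bs \<and> \<pi> \<in> Lip")
      case True
      then have f: "f \<in> Lip_bs" and \<pi>: "\<pi> \<in> Lip" by auto
      have "H (\<lambda>x. \<bar>f x\<bar>) \<le> (\<integral>x. \<bar>f x\<bar> * r x \<partial>M)" using Hle[OF Lip_bs_abs[OF f]] by simp
      then have "lip_const \<pi> * H (\<lambda>x. \<bar>f x\<bar>) \<le> lip_const \<pi> * (\<integral>x. \<bar>f x\<bar> * r x \<partial>M)"
        by (intro mult_left_mono lip_const_nonneg[OF \<pi>])
      then have "\<bar>S f \<pi>\<bar> \<le> lip_const \<pi> * (\<integral>x. \<bar>f x\<bar> * r x \<partial>M)" using Sb[OF f \<pi>] by linarith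
      then show ?thesis using True Hle[OF f] Nle[OF f] by (simp add: i x_def box_def)
    qed (auto simp: i x_def box_def)
  next
    show "pre_current (tr_S x)" by (rule pre_current_cong[OF Slin xS])
    show "linear_on_Lip_bs (tr_H x)" "linear_on_Lip_bs (tr_N x)"
      using Hlin Nlin by (simp_all add: linear_on_Lip_bs_def xH xN Lip_bs_lincomb)
  next
    fix f \<pi> :: "'a \<Rightarrow> real" assume f: "f \<in> Lip_bs" and \<pi>: "\<pi> \<in> Lip"
    show "\<bar>tr_S x f \<pi>\<bar> \<le> lip_const \<pi> * tr_H x (\<lambda>x. \<bar>f x\<bar>)"
      "\<bar>T f \<pi> - tr_S x f \<pi>\<bar> \<le> lip_const \<pi> * ((\<integral>x. \<bar>f x\<bar> * r x \<partial>M) - tr_H x (\<lambda>x. \<bar>f x\<bar>))"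
      using Sb[OF f \<pi>] TSb[OF f \<pi>] by (simp_all add: xS[OF f \<pi>] xH[OF Lip_bs_abs[OF f]])
  next
    fix f :: "'a \<Rightarrow> real" assume f: "f \<in> Lip_bs" and nn: "\<forall>y. 0 \<le> f y"
    show "0 \<le> tr_H x f" "0 \<le> tr_N x f"
      unfolding xH[OF f] xN[OF f] H_def N_def using nn unit_densityD(2)[OF Ar(1)] unit_densityD(2)[OF bq]
      by (auto intro!: integral_nonneg_AE)
  next
    fix f :: "'a \<Rightarrow> real" assume f: "f \<in> Lip_bs" and le: "\<forall>y. f y \<le> 1"
    have "N f \<le> (\<integral>x. b x * q x \<partial>P)" unfolding N_def
    proof (rule integral_mono[OF Lip_bs_integrable(1)[OF P f unit_densityD(1,4)[OF bq]] bqi])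
      fix x show "f x * (b x * q x) \<le> b x * q x"
        using mult_right_mono[OF le[rule_format, of x] unit_densityD(2)[OF bq, of x]] by simp
    qed
    then show "tr_N x f \<le> cap" using bC(1) xN[OF f] by simp
  qed
  moreover have "0 \<le> defect \<phi> x"
  proof -
    define \<psi> where "\<psi> x = max 0 (\<phi> x - c)" for x
    have \<psi>: "\<psi> \<in> Lip_bs" unfolding \<psi>_def using c by (intro Lip_bs_comp[OF \<phi>, of "\<lambda>t. max 0 (t - c)"]) auto
    have \<phi>L: "\<phi> \<in> Lip" "\<psi> \<in> Lip" using \<phi> \<psi> by (auto simp: Lip_bs_Lip)
    obtain \<sigma> where \<sigma>: "\<sigma> \<in> Lip_bs" "\<And>x. x \<in> supp \<phi> \<Longrightarrow> \<sigma> x = 1" using Lip_bs_has_cutoff[OF \<phi>] by blast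
    have sub: "supp \<psi> \<subseteq> supp \<phi>" by (rule supp_mono) (use c in \<open>auto simp: \<psi>_def\<close>)
    note [measurable] = current_densityD(1)[OF ctx \<phi>L(1)] current_densityD(1)[OF ctx \<phi>L(2)] Lip_bs_measurable[OF \<sigma>(1)]
    have shift: "(\<lambda>x. 1 * \<phi> x + (- c) * 1) \<in> Lip" by (rule Lip_lincomb[OF \<phi>L(1) Lip_const])
    have "boundary (tr_S x) \<phi> = S \<sigma> \<phi>"
      using boundary_cong[of "tr_S x" S \<phi>, OF xS \<phi>] boundary_eq[OF Slin \<phi> \<sigma>] by simp
    \<comment> \<open>On \<open>A\<close> the function \<psi> differs from \<phi> by the constant
      \<open>c\<close>, and off \<open>A\<close> it vanishes. By locality the density of \<psi> is
      that of \<phi> cut to \<open>A\<close>, so restricting \<open>T\<close> amounts to truncating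
      the test function.\<close>
    also have "\<dots> = (\<integral>x. \<sigma> x * ?g \<psi> x \<partial>M)" unfolding S_def
    proof (rule integral_cong_AE)
      have "AE x in M. ?g (\<lambda>x. 1 * \<phi> x + (- c) * 1) x = 1 * ?g \<phi> x + (- c) * ?g (\<lambda>x. 1) x"
        by (rule current_density_lincomb[OF ctx \<phi>L(1) Lip_const])
      moreover have "AE x in M. \<psi> x = 1 * \<phi> x + (- c) * 1 \<longrightarrow> ?g \<psi> x = ?g (\<lambda>x. 1 * \<phi> x + (- c) * 1) x"
        by (rule current_density_local[OF ctx \<phi>L(2) shift])
      moreover have "AE x in M. \<psi> x = 0 \<longrightarrow> ?g \<psi> x = 0" by (rule current_density_zero[OF ctx \<phi>L(2)])
      ultimately show "AE x in M. \<sigma> x * (indicator A x * ?g \<phi> x) = \<sigma> x * ?g \<psi> x"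
      proof eventually_elim
        case (elim x)
        show ?case
        proof (cases "x \<in> A")
          case True
          then have "\<psi> x = 1 * \<phi> x + (- c) * 1" by (simp add: \<psi>_def A_def)
          then have "?g \<psi> x = ?g \<phi> x" using elim by (simp add: current_density_const[OF ctx])
          then show ?thesis using True by simp
        next
          case False
          then have "\<psi> x = 0" by (simp add: \<psi>_def A_def)
          then show ?thesis using elim False by simp
        qed
      qed
    qed measurable
    also have "\<dots> = T \<sigma> \<psi>" by (rule current_densityD(4)[OF ctx \<phi>L(2) \<sigma>(1), symmetric])
    also have "\<dots> = boundary T \<psi>"
      using boundary_eq[OF M1b_pre_current[OF T] \<psi> \<sigma>(1)] \<sigma>(2) sub by (auto simp: subset_eq)
    also have "\<dots> = (\<integral>x. \<psi> x * (p x - q x) \<partial>P)" using bdT \<psi> by blast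
    also have "\<dots> = (\<integral>x. \<psi> x * p x - \<psi> x * q x \<partial>P)" by (simp add: right_diff_distrib)
    finally have 1: "boundary (tr_S x) \<phi> = (\<integral>x. \<psi> x * p x \<partial>P) - (\<integral>x. \<psi> x * q x \<partial>P)"
      using Lip_bs_integrable(1)[OF P \<psi> unit_densityD(1,4)[OF p]] Lip_bs_integrable(1)[OF P \<psi> unit_densityD(1,4)[OF q]] by simp
    have "N \<phi> = (\<integral>x. \<psi> x * q x + c * (b x * q x) \<partial>P)" unfolding N_def
    proof (rule Bochner_Integration.integral_cong[OF refl])
      fix x
      \<comment> \<open>Above the level \<open>b\<close> is 1, below it both \<open>b\<close> and
        \<psi> are 0, and on it \<psi> is 0 while \<phi> equals \<open>c\<close>; the fraction taken
        there does not matter.\<close>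
      have "\<phi> x * b x = \<psi> x + c * b x"
        using b1[of x] b0(1)[of x] by (cases "\<phi> x" c rule: linorder_cases) (auto simp: \<psi>_def)
      then have "\<phi> x * b x * q x = (\<psi> x + c * b x) * q x" by simp
      then show "\<phi> x * (b x * q x) = \<psi> x * q x + c * (b x * q x)" by (simp add: algebra_simps)
    qed
    \<comment> \<open>Here the allowance must be used exactly or the level be 0.\<close>
    also have "\<dots> = (\<integral>x. \<psi> x * q x \<partial>P) + c * cap"
      using Lip_bs_integrable(1)[OF P \<psi> unit_densityD(1,4)[OF q]] bqi bC(2) by simp
    finally have 2: "N \<phi> = (\<integral>x. \<psi> x * q x \<partial>P) + c * cap" .
    have i: "integrable P (\<lambda>x. \<psi> x * p x)" "integrable P (\<lambda>x. \<phi> x * (indicator U x * p x))" "integrable P (\<lambda>x. c * (indicator U x * p x))"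
      using Lip_bs_integrable(1)[OF P \<psi> unit_densityD(1,4)[OF p]] Lip_bs_integrable(1)[OF P \<phi> Up_measurable Up_le] integrable_Up by auto
    have "defect \<phi> x = (\<integral>x. \<psi> x * p x \<partial>P) - (\<integral>y. \<phi> y * (indicator U y * p y) \<partial>P) + (\<integral>x. c * (indicator U x * p x) \<partial>P)"
      unfolding defect_def 1 xN[OF \<phi>] 2 by (simp add: cap_def)
    also have "\<dots> = (\<integral>x. \<psi> x * p x - \<phi> x * (indicator U x * p x) + c * (indicator U x * p x) \<partial>P)"
      using i by simp
    also have "\<dots> \<ge> 0"
    proof (rule integral_nonneg_AE, rule AE_I2)
      fix x
      have "0 \<le> (\<psi> x - indicator U x * \<phi> x + c * indicator U x) * p x"
        using unit_densityD(2)[OF p, of x] by (intro mult_nonneg_nonneg) (auto simp: \<psi>_def split: split_indicator)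
      then show "0 \<le> \<psi> x * p x - \<phi> x * (indicator U x * p x) + c * (indicator U x * p x)" by (simp add: algebra_simps)
    qed
    finally show ?thesis .
  qed
  ultimately show ?thesis by blast
qed

text \<open>Applies \<open>convex_feasibility\<close> with one constraint for each function of
  \<open>Lip_bs\<close>. For a feasible point the defect is linear in the test function, so a
  combination of constraints is the defect of the combined test function, which
  \<open>feasible_witness\<close> handles. The functionals \<open>H\<close> and \<open>N\<close> of
  the solution then become the densities \<open>h\<close> and \<open>n\<close>.\<close>

lemma drain_positive_boundary:
  "\<exists>S h n. S \<in> N\<^sub>1\<^sub>b \<and> unit_density h \<and> (\<forall>x. h x \<le> r x) \<and> mass1_le S M h \<and>
    mass1_le (\<lambda>f \<pi>. T f \<pi> - S f \<pi>) M (\<lambda>x. r x - h x) \<and>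
    unit_density n \<and> (\<forall>x. n x \<le> q x) \<and> emeasure (density P (\<lambda>x. ennreal (n x))) UNIV < \<infinity> \<and>
    (\<forall>f\<in>Lip_bs. boundary S f = (\<integral>x. f x * (indicator U x * p x - n x) \<partial>P))"
proof -
  have "\<exists>x\<in>feasible. \<forall>\<phi>\<in>Lip_bs. defect \<phi> x = 0"
  proof (rule convex_feasibility[where b=box])
    show "closed feasible" by (rule feasible_closed)
    show "\<bar>x i\<bar> \<le> box i" if "x \<in> feasible" for x i using that by (rule feasibleD(1))
    show "defect \<phi> (\<lambda>i. (1 - t) * x i + t * y i) = (1 - t) * defect \<phi> x + t * defect \<phi> y" for \<phi> x y t
      unfolding defect_def boundary_def tr_S_def tr_N_def by (simp add: algebra_simps)
    show "continuous_on UNIV (defect \<phi>)" for \<phi>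
      unfolding defect_def boundary_def tr_S_def tr_N_def
      by (intro continuous_intros continuous_on_product_coordinates)
    fix F :: "('a \<Rightarrow> real) set" and c :: "('a \<Rightarrow> real) \<Rightarrow> real" assume F: "finite F" "F \<subseteq> Lip_bs"
    define \<phi> where "\<phi> x = (\<Sum>f\<in>F. c f * f x)" for x
    have "\<phi> \<in> Lip_bs" unfolding \<phi>_def using F by (intro Lip_bs_sum[where f="\<lambda>f. f"]) auto
    then obtain x where x: "x \<in> feasible" "0 \<le> defect \<phi> x" using feasible_witness by blast
    have "linear_on_Lip_bs (\<lambda>f. boundary (tr_S x) f)" "linear_on_Lip_bs (tr_N x)"
      using feasibleD(2,4)[OF x(1)] by (auto intro: boundary_linear)
    moreover have "linear_on_Lip_bs (\<lambda>f. \<integral>y. f y * (indicator U y * p y) \<partial>P)"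
      by (rule linear_on_Lip_bs_integral[OF P Up_measurable Up_le])
    ultimately have "linear_on_Lip_bs (\<lambda>f. defect f x)"
      by (simp add: defect_def linear_on_Lip_bs_def algebra_simps)
    from linear_on_Lip_bs_sum[OF this F, of c] x
    show "\<exists>x\<in>feasible. 0 \<le> (\<Sum>f\<in>F. c f * defect f x)" by (intro bexI[of _ x]) (simp_all add: \<phi>_def[abs_def])
  qed (rule feasible_convex)
  then obtain x where x: "x \<in> feasible" and d0: "\<And>\<phi>. \<phi> \<in> Lip_bs \<Longrightarrow> defect \<phi> x = 0" by blast
  define S where "S = tr_S x"
  note box = feasibleD(1)[OF x] and pre = feasibleD(2)[OF x, folded S_def] and Hlin = feasibleD(3)[OF x]
    and Nlin = feasibleD(4)[OF x] and Sb = feasibleD(5)[OF x, folded S_def] and TSb = feasibleD(6)[OF x, folded S_def]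
    and H0 = feasibleD(7)[OF x] and N0 = feasibleD(8)[OF x] and Ncap = feasibleD(9)[OF x]
  have Hr: "tr_H x f \<le> (\<integral>x. f x * r x \<partial>M)" and Nq: "tr_N x f \<le> (\<integral>x. f x * q x \<partial>P)"
    if "f \<in> Lip_bs" "\<And>y. 0 \<le> f y" for f
    using box[of "(1, f, \<lambda>_. 0)"] box[of "(2, f, \<lambda>_. 0)"] that
    by (simp_all add: box_def tr_H_def tr_N_def Lip_const)
  obtain h where h: "h \<in> borel_measurable borel" "\<And>x. 0 \<le> h x \<and> h x \<le> r x" "\<And>f. f \<in> Lip_bs \<Longrightarrow> tr_H x f = (\<integral>x. f x * h x \<partial>M)"
    using positive_functional_density[OF M Hlin unit_densityD(1-3)[OF r] H0 Hr] by blast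
  obtain n where n: "n \<in> borel_measurable borel" "\<And>x. 0 \<le> n x \<and> n x \<le> q x" "\<And>f. f \<in> Lip_bs \<Longrightarrow> tr_N x f = (\<integral>x. f x * n x \<partial>P)"
    using positive_functional_density[OF P Nlin unit_densityD(1-3)[OF q] N0 Nq] by blast
  have hu: "unit_density h" using h(1,2) unit_densityD(3)[OF r] by (auto simp: unit_density_def intro: order_trans)
  have nu: "unit_density n" using n(1,2) unit_densityD(3)[OF q] by (auto simp: unit_density_def intro: order_trans)
  have Sle: "mass1_le S M h" unfolding mass1_le_def using Sb h(3)[OF Lip_bs_abs] by simp
  have TSle: "mass1_le (\<lambda>f \<pi>. T f \<pi> - S f \<pi>) M (\<lambda>x. r x - h x)"
    unfolding mass1_le_def
  proof (intro ballI)
    fix f \<pi> :: "'a \<Rightarrow> real" assume f: "f \<in> Lip_bs" and \<pi>: "\<pi> \<in> Lip"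
    have "(\<integral>x. \<bar>f x\<bar> * (r x - h x) \<partial>M) = (\<integral>x. \<bar>f x\<bar> * r x \<partial>M) - (\<integral>x. \<bar>f x\<bar> * h x \<partial>M)"
      using Lip_bs_integrable(1)[OF M Lip_bs_abs[OF f] unit_densityD(1,4)[OF r]] Lip_bs_integrable(1)[OF M Lip_bs_abs[OF f] unit_densityD(1,4)[OF hu]]
      by (simp add: right_diff_distrib)
    then show "\<bar>T f \<pi> - S f \<pi>\<bar> \<le> lip_const \<pi> * (\<integral>x. \<bar>f x\<bar> * (r x - h x) \<partial>M)"
      using TSb[OF f \<pi>] h(3)[OF Lip_bs_abs[OF f]] by simp
  qed
  have bdS: "boundary S f = (\<integral>x. f x * (indicator U x * p x - n x) \<partial>P)" if f: "f \<in> Lip_bs" for f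
  proof -
    have "(\<integral>x. f x * (indicator U x * p x - n x) \<partial>P) = (\<integral>x. f x * (indicator U x * p x) \<partial>P) - (\<integral>x. f x * n x \<partial>P)"
      using Lip_bs_integrable(1)[OF P f Up_measurable Up_le] Lip_bs_integrable(1)[OF P f unit_densityD(1,4)[OF nu]]
      by (simp add: right_diff_distrib)
    then show ?thesis using d0[OF f] n(3)[OF f] by (simp add: defect_def S_def)
  qed
  have "S \<in> N\<^sub>1\<^sub>b"
  proof (rule pre_current_N1b[OF pre M P])
    fix f \<pi> :: "'a \<Rightarrow> real" assume f: "f \<in> Lip_bs" and \<pi>: "\<pi> \<in> Lip"
    have "(\<integral>x. \<bar>f x\<bar> * h x \<partial>M) \<le> (\<integral>x. \<bar>f x\<bar> \<partial>M)"
      using Lip_bs_integrable[OF M Lip_bs_abs[OF f] unit_densityD(1,4)[OF hu]] unit_densityD(2,3)[OF hu]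
      by (intro integral_mono) (auto intro: mult_left_le)
    then have "lip_const \<pi> * (\<integral>x. \<bar>f x\<bar> * h x \<partial>M) \<le> lip_const \<pi> * (\<integral>x. \<bar>f x\<bar> \<partial>M)"
      by (intro mult_left_mono lip_const_nonneg[OF \<pi>])
    then show "\<bar>S f \<pi>\<bar> \<le> lip_const \<pi> * (\<integral>x. \<bar>f x\<bar> \<partial>M)" using Sle f \<pi> unfolding mass1_le_def by fastforce
  next
    fix f :: "'a \<Rightarrow> real" assume f: "f \<in> Lip_bs"
    have le: "\<bar>indicator U x * p x - n x\<bar> \<le> 1" for x
      using unit_densityD(2,3)[OF p, of x] unit_densityD(2,3)[OF nu, of x] by (auto simp: abs_le_iff split: split_indicator)
    have "\<bar>boundary S f\<bar> \<le> (\<integral>x. \<bar>f x\<bar> * 1 \<partial>P)" unfolding bdS[OF f]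
      using le Up_measurable n(1) by (intro abs_integral_density_le[OF P f, where C=1]) auto
    then show "\<bar>boundary S f\<bar> \<le> (\<integral>x. \<bar>f x\<bar> \<partial>P)" by simp
  qed
  moreover have "emeasure (density P (\<lambda>x. ennreal (n x))) UNIV < \<infinity>"
  proof -
    have sP[measurable_cong]: "sets P = sets borel" by (rule loc_finite_sets[OF P])
    note [measurable] = n(1)
    \<comment> \<open>The bound by \<open>cap\<close> only tests functions of bounded support with
      values at most 1; cutoffs that are 1 on larger and larger balls recover the total
      mass.\<close>
    have "emeasure (density P (\<lambda>x. ennreal (n x))) (UNIV \<inter> ball undefined (real k)) \<le> ennreal cap" for k
    proof -
      note [measurable] = Lip_bs_measurable[OF cutoff_Lip_bs[of k]]
      have "emeasure (density P (\<lambda>x. ennreal (n x))) (UNIV \<inter> ball undefined (real k))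
          = (\<integral>\<^sup>+x. ennreal (n x) * indicator (ball undefined (real k)) x \<partial>P)"
        by (subst emeasure_density) auto
      also have "\<dots> \<le> (\<integral>\<^sup>+x. ennreal (cutoff k x * n x) \<partial>P)"
      proof (intro nn_integral_mono)
        fix x
        show "ennreal (n x) * indicator (ball undefined (real k)) x \<le> ennreal (cutoff k x * n x)"
          using cutoff_one[of x k] by (auto split: split_indicator)
      qed
      also have "\<dots> = ennreal (\<integral>x. cutoff k x * n x \<partial>P)"
        using Lip_bs_integrable(1)[OF P cutoff_Lip_bs unit_densityD(1,4)[OF nu]] cutoff_range(1) n(2)
        by (intro nn_integral_eq_integral AE_I2 mult_nonneg_nonneg) auto
      also have "\<dots> \<le> ennreal cap"
        using Ncap[OF cutoff_Lip_bs[of k] cutoff_range(2)] n(3)[OF cutoff_Lip_bs[of k]] by (simp add: ennreal_leI)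
      finally show ?thesis .
    qed
    then have "emeasure (density P (\<lambda>x. ennreal (n x))) UNIV \<le> ennreal cap"
      by (subst emeasure_SUP_balls[of _ _ undefined]) (auto intro!: SUP_least simp: sP)
    then show ?thesis by (rule le_less_trans) simp
  qed
  ultimately show ?thesis using hu h(2) Sle TSle nu n(2) bdS
    by (intro exI[of _ S] exI[of _ h] exI[of _ n]) simp
qed

end

section \<open>Repeated removal of boundary\<close>

text \<open>The state of what remains. Mass and both signs of the boundary are recorded as densities
  against two fixed measures, so that removing a piece means subtracting densities, and the pieces
  themselves are again described by a \<open>flow_state\<close>.\<close>

definition flow_state :: "'a::metric_space measure \<Rightarrow> 'a measure \<Rightarrow> 'a current1 \<Rightarrow> ('a \<Rightarrow> real) \<Rightarrow> ('a \<Rightarrow> real) \<Rightarrow> ('a \<Rightarrow> real) \<Rightarrow> bool"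
  where "flow_state M P R r p q \<longleftrightarrow> pre_current R \<and> unit_density r \<and> mass1_le R M r \<and> unit_density p \<and> unit_density q \<and>
    (\<forall>f\<in>Lip_bs. boundary R f = (\<integral>x. f x * (p x - q x) \<partial>P))"

lemma flow_stateD:
  assumes "flow_state M P R r p q"
  shows "pre_current R" "unit_density r" "mass1_le R M r" "unit_density p" "unit_density q"
    "f \<in> Lip_bs \<Longrightarrow> boundary R f = (\<integral>x. f x * (p x - q x) \<partial>P)"
  using assms by (simp_all add: flow_state_def)

lemma mass1_le_total:
  assumes M: "loc_finite M" and r: "unit_density r" and le: "mass1_le R M r" and f: "f \<in> Lip_bs" and \<pi>: "\<pi> \<in> Lip"
  shows "\<bar>R f \<pi>\<bar> \<le> lip_const \<pi> * (\<integral>x. \<bar>f x\<bar> \<partial>M)"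
proof -
  have "(\<integral>x. \<bar>f x\<bar> * r x \<partial>M) \<le> (\<integral>x. \<bar>f x\<bar> \<partial>M)"
    using Lip_bs_integrable[OF M Lip_bs_abs[OF f] unit_densityD(1,4)[OF r]] unit_densityD(2,3)[OF r]
    by (intro integral_mono) (auto intro: mult_left_le)
  then have "lip_const \<pi> * (\<integral>x. \<bar>f x\<bar> * r x \<partial>M) \<le> lip_const \<pi> * (\<integral>x. \<bar>f x\<bar> \<partial>M)"
    by (intro mult_left_mono lip_const_nonneg[OF \<pi>])
  then show ?thesis using le f \<pi> unfolding mass1_le_def by (meson order_trans)
qed

lemma abs_integral_diff_le:
  assumes P: "loc_finite P" and p: "unit_density p" and q: "unit_density q" and f: "f \<in> Lip_bs"
  shows "\<bar>\<integral>x. f x * (p x - q x) \<partial>P\<bar> \<le> (\<integral>x. \<bar>f x\<bar> * (p x + q x) \<partial>P)" "\<bar>\<integral>x. f x * (p x - q x) \<partial>P\<bar> \<le> (\<integral>x. \<bar>f x\<bar> \<partial>P)"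
proof -
  note pq = unit_densityD(1-3)[OF p] unit_densityD(1-3)[OF q]
  have 1: "\<bar>p x - q x\<bar> \<le> 2" "\<bar>p x + q x\<bar> \<le> 2" "\<bar>p x - q x\<bar> \<le> p x + q x" "\<bar>p x - q x\<bar> \<le> 1" for x
    using pq(2,3,5,6)[of x] by auto
  show "\<bar>\<integral>x. f x * (p x - q x) \<partial>P\<bar> \<le> (\<integral>x. \<bar>f x\<bar> * (p x + q x) \<partial>P)"
    using pq(1,4) 1 by (intro abs_integral_density_le[OF P f, where C=2]) auto
  have "\<bar>\<integral>x. f x * (p x - q x) \<partial>P\<bar> \<le> (\<integral>x. \<bar>f x\<bar> * 1 \<partial>P)"
    using pq(1,4) 1 by (intro abs_integral_density_le[OF P f, where C=2]) auto
  then show "\<bar>\<integral>x. f x * (p x - q x) \<partial>P\<bar> \<le> (\<integral>x. \<bar>f x\<bar> \<partial>P)" by simp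
qed

lemma flow_state_N1b:
  assumes M: "loc_finite M" and P: "loc_finite P" and st: "flow_state M P R r p q"
  shows "R \<in> N\<^sub>1\<^sub>b"
  by (rule pre_current_N1b[OF flow_stateD(1)[OF st] M P])
    (use mass1_le_total[OF M flow_stateD(2,3)[OF st]] flow_stateD(6)[OF st]
      abs_integral_diff_le(2)[OF P flow_stateD(4,5)[OF st]] in auto)

lemma mass1_le_uminus: "mass1_le R M r \<Longrightarrow> mass1_le (\<lambda>f \<pi>. - R f \<pi>) M r"
  by (simp add: mass1_le_def)

lemma mass1_le_add:
  assumes M: "loc_finite M" and r: "unit_density r" "unit_density s" and le: "mass1_le R M r" "mass1_le S M s"
  shows "mass1_le (\<lambda>f \<pi>. R f \<pi> + S f \<pi>) M (\<lambda>x. r x + s x)"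
  unfolding mass1_le_def
proof (intro ballI)
  fix f \<pi> :: "'a \<Rightarrow> real" assume f: "f \<in> Lip_bs" and \<pi>: "\<pi> \<in> Lip"
  have "(\<integral>x. \<bar>f x\<bar> * (r x + s x) \<partial>M) = (\<integral>x. \<bar>f x\<bar> * r x \<partial>M) + (\<integral>x. \<bar>f x\<bar> * s x \<partial>M)"
    using Lip_bs_integrable(1)[OF M Lip_bs_abs[OF f] unit_densityD(1,4)[OF r(1)]] Lip_bs_integrable(1)[OF M Lip_bs_abs[OF f] unit_densityD(1,4)[OF r(2)]]
    by (simp add: distrib_left)
  moreover have "\<bar>R f \<pi>\<bar> \<le> lip_const \<pi> * (\<integral>x. \<bar>f x\<bar> * r x \<partial>M)" "\<bar>S f \<pi>\<bar> \<le> lip_const \<pi> * (\<integral>x. \<bar>f x\<bar> * s x \<partial>M)"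
    using le f \<pi> by (auto simp: mass1_le_def)
  ultimately show "\<bar>R f \<pi> + S f \<pi>\<bar> \<le> lip_const \<pi> * (\<integral>x. \<bar>f x\<bar> * (r x + s x) \<partial>M)"
    by (simp add: distrib_left)
qed

lemma pre_current_diff: "pre_current R \<Longrightarrow> pre_current S \<Longrightarrow> pre_current (\<lambda>f \<pi>. R f \<pi> - S f \<pi>)"
  using pre_current_lincomb[of R S 1 "-1"] by simp

lemma pre_current_uminus: "pre_current R \<Longrightarrow> pre_current (\<lambda>f \<pi>. - R f \<pi>)"
  using pre_current_lincomb[of R R "-1" 0] by simp

lemma N1b_pre_current: "R \<in> N\<^sub>1\<^sub>b \<Longrightarrow> pre_current R"
  by (rule M1b_pre_current) (simp add: N\<^sub>1\<^sub>b_def)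

text \<open>The sources in \<open>U\<close> are drained first; then the remainder is negated, which
  turns sinks into sources, and drained again. The second step uses up part of the remaining sources
  \<open>p1\<close>, which vanish on \<open>U\<close> already, so it cannot bring any back into
  \<open>U\<close>.\<close>

lemma drain_boundary:
  fixes R :: "'a::metric_space current1"
  assumes M: "loc_finite M" and P: "loc_finite P" and U: "U \<in> bounded_borel" and st: "flow_state M P R r p q"
  shows "\<exists>R' r' p' q'. flow_state M P R' r' p' q' \<and>
    flow_state M P (\<lambda>f \<pi>. R f \<pi> - R' f \<pi>) (\<lambda>x. r x - r' x) (\<lambda>x. p x - p' x) (\<lambda>x. q x - q' x) \<and>
    (\<forall>x\<in>U. p' x = 0 \<and> q' x = 0) \<and>
    emeasure (density P (\<lambda>x. ennreal ((p x - p' x) + (q x - q' x)))) UNIV < \<infinity>"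
proof -
  have sP[measurable_cong]: "sets P = sets borel" by (rule loc_finite_sets[OF P])
  have Us[measurable]: "U \<in> sets borel" using U by (simp add: bounded_borel_def)
  note r = flow_stateD(2)[OF st] and p = flow_stateD(4)[OF st] and q = flow_stateD(5)[OF st]
  have RM: "R \<in> M\<^sub>1\<^sub>b" using flow_state_N1b[OF M P st] by (simp add: N\<^sub>1\<^sub>b_def)
  have "\<forall>f\<in>Lip_bs. boundary R f = (\<integral>x. f x * (p x - q x) \<partial>P)" using flow_stateD(6)[OF st] by blast
  from drain_positive_boundary[OF RM M r flow_stateD(3)[OF st] P p q this U]
  obtain S1 h1 n1 where S1: "S1 \<in> N\<^sub>1\<^sub>b" and h1: "unit_density h1" "\<And>x. h1 x \<le> r x" and S1M: "mass1_le S1 M h1"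
    and R1M: "mass1_le (\<lambda>f \<pi>. R f \<pi> - S1 f \<pi>) M (\<lambda>x. r x - h1 x)"
    and n1: "unit_density n1" "\<And>x. n1 x \<le> q x" and n1f: "emeasure (density P (\<lambda>x. ennreal (n1 x))) UNIV < \<infinity>"
    and bS1: "\<And>f. f \<in> Lip_bs \<Longrightarrow> boundary S1 f = (\<integral>x. f x * (indicator U x * p x - n1 x) \<partial>P)"
    by blast
  have bounds: "0 \<le> r x" "r x \<le> 1" "0 \<le> p x" "p x \<le> 1" "0 \<le> q x" "q x \<le> 1" "0 \<le> h1 x" "0 \<le> n1 x" for x
    using unit_densityD(2,3)[OF r] unit_densityD(2,3)[OF p] unit_densityD(2,3)[OF q] unit_densityD(2)[OF h1(1)] unit_densityD(2)[OF n1(1)] by auto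
  note [measurable] = unit_densityD(1)[OF r] unit_densityD(1)[OF p] unit_densityD(1)[OF q] unit_densityD(1)[OF h1(1)] unit_densityD(1)[OF n1(1)]
  define r1 p1 q1 where "r1 x = r x - h1 x" and "p1 x = p x - indicator U x * p x" and "q1 x = q x - n1 x" for x
  have u1: "unit_density r1" "unit_density p1" "unit_density q1"
  proof -
    have "r1 \<in> borel_measurable borel" "p1 \<in> borel_measurable borel" "q1 \<in> borel_measurable borel"
      unfolding r1_def p1_def q1_def by measurable
    moreover have "0 \<le> r1 x \<and> r1 x \<le> 1" "0 \<le> p1 x \<and> p1 x \<le> 1" "0 \<le> q1 x \<and> q1 x \<le> 1" for x
      using bounds[of x] h1(2)[of x] n1(2)[of x] by (auto simp: r1_def p1_def q1_def split: split_indicator)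
    ultimately show "unit_density r1" "unit_density p1" "unit_density q1" by (auto simp: unit_density_def)
  qed
  have int: "integrable P (\<lambda>x. f x * w x)" if "f \<in> Lip_bs" "w \<in> borel_measurable borel" "\<And>x. \<bar>w x\<bar> \<le> 4" for f w
    by (rule Lip_bs_integrable(1)[OF P that])
  \<comment> \<open>The sign change exchanges the roles of \<open>p1\<close> and \<open>q1\<close>;
    it is undone in the definition of \<open>R'\<close>.\<close>
  define R1 where "R1 f \<pi> = - (R f \<pi> - S1 f \<pi>)" for f \<pi>
  have R1le: "mass1_le R1 M r1" unfolding R1_def[abs_def] r1_def[abs_def] by (rule mass1_le_uminus[OF R1M])
  have R1pre: "pre_current R1" unfolding R1_def[abs_def]
    by (intro pre_current_uminus pre_current_diff flow_stateD(1)[OF st] N1b_pre_current S1)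
  have bR1: "boundary R1 f = (\<integral>x. f x * (q1 x - p1 x) \<partial>P)" if f: "f \<in> Lip_bs" for f
  proof -
    have "boundary R1 f = - (boundary R f - boundary S1 f)"
      unfolding R1_def[abs_def] boundary_uminus boundary_diff ..
    also have "\<dots> = (\<integral>x. f x * (indicator U x * p x - n1 x) \<partial>P) - (\<integral>x. f x * (p x - q x) \<partial>P)"
      using flow_stateD(6)[OF st f] bS1[OF f] by simp
    also have "\<dots> = (\<integral>x. f x * (indicator U x * p x - n1 x) - f x * (p x - q x) \<partial>P)"
    proof (rule Bochner_Integration.integral_diff[symmetric]; rule int[OF f])
      show "\<bar>indicator U x * p x - n1 x\<bar> \<le> 4" "\<bar>p x - q x\<bar> \<le> 4" for x
        using bounds[of x] n1(2)[of x] by (auto split: split_indicator)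
    qed measurable
    also have "\<dots> = (\<integral>x. f x * (q1 x - p1 x) \<partial>P)"
      by (rule Bochner_Integration.integral_cong) (auto simp: q1_def p1_def algebra_simps)
    finally show ?thesis .
  qed
  have st1: "flow_state M P R1 r1 q1 p1"
    unfolding flow_state_def using R1pre u1 R1le bR1 by blast
  have R1M': "R1 \<in> M\<^sub>1\<^sub>b" using flow_state_N1b[OF M P st1] by (simp add: N\<^sub>1\<^sub>b_def)
  have "\<forall>f\<in>Lip_bs. boundary R1 f = (\<integral>x. f x * (q1 x - p1 x) \<partial>P)" using bR1 by blast
  from drain_positive_boundary[OF R1M' M u1(1) R1le P u1(3,2) this U]
  obtain S2 h2 n2 where S2: "S2 \<in> N\<^sub>1\<^sub>b" and h2: "unit_density h2" "\<And>x. h2 x \<le> r1 x" and S2M: "mass1_le S2 M h2"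
    and R2M: "mass1_le (\<lambda>f \<pi>. R1 f \<pi> - S2 f \<pi>) M (\<lambda>x. r1 x - h2 x)"
    and n2: "unit_density n2" "\<And>x. n2 x \<le> p1 x" and n2f: "emeasure (density P (\<lambda>x. ennreal (n2 x))) UNIV < \<infinity>"
    and bS2: "\<And>f. f \<in> Lip_bs \<Longrightarrow> boundary S2 f = (\<integral>x. f x * (indicator U x * q1 x - n2 x) \<partial>P)"
    by blast
  note [measurable] = unit_densityD(1)[OF u1(1)] unit_densityD(1)[OF u1(2)] unit_densityD(1)[OF u1(3)]
    unit_densityD(1)[OF h2(1)] unit_densityD(1)[OF n2(1)]
  have bounds1: "0 \<le> r1 x" "r1 x \<le> 1" "0 \<le> p1 x" "p1 x \<le> 1" "0 \<le> q1 x" "q1 x \<le> 1" "0 \<le> h2 x" "0 \<le> n2 x" for x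
    using unit_densityD(2,3)[OF u1(1)] unit_densityD(2,3)[OF u1(2)] unit_densityD(2,3)[OF u1(3)] unit_densityD(2)[OF h2(1)] unit_densityD(2)[OF n2(1)] by auto
  define R' where "R' f \<pi> = - (R1 f \<pi> - S2 f \<pi>)" for f \<pi>
  define r' p' q' where "r' x = r1 x - h2 x" and "p' x = p1 x - n2 x" and "q' x = q1 x - indicator U x * q1 x" for x
  have u2: "unit_density r'" "unit_density p'" "unit_density q'"
  proof -
    have "r' \<in> borel_measurable borel" "p' \<in> borel_measurable borel" "q' \<in> borel_measurable borel"
      unfolding r'_def p'_def q'_def by measurable
    moreover have "0 \<le> r' x \<and> r' x \<le> 1" "0 \<le> p' x \<and> p' x \<le> 1" "0 \<le> q' x \<and> q' x \<le> 1" for x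
      using bounds1[of x] h2(2)[of x] n2(2)[of x] by (auto simp: r'_def p'_def q'_def split: split_indicator)
    ultimately show "unit_density r'" "unit_density p'" "unit_density q'" by (auto simp: unit_density_def)
  qed
  note [measurable] = unit_densityD(1)[OF u2(1)] unit_densityD(1)[OF u2(2)] unit_densityD(1)[OF u2(3)]
  have bR': "boundary R' f = (\<integral>x. f x * (p' x - q' x) \<partial>P)" if f: "f \<in> Lip_bs" for f
  proof -
    have "boundary R' f = - (boundary R1 f - boundary S2 f)"
      unfolding R'_def[abs_def] boundary_uminus boundary_diff ..
    also have "\<dots> = (\<integral>x. f x * (indicator U x * q1 x - n2 x) \<partial>P) - (\<integral>x. f x * (q1 x - p1 x) \<partial>P)"
      using bR1[OF f] bS2[OF f] by simp
    also have "\<dots> = (\<integral>x. f x * (indicator U x * q1 x - n2 x) - f x * (q1 x - p1 x) \<partial>P)"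
    proof (rule Bochner_Integration.integral_diff[symmetric]; rule int[OF f])
      show "\<bar>indicator U x * q1 x - n2 x\<bar> \<le> 4" "\<bar>q1 x - p1 x\<bar> \<le> 4" for x
        using bounds1[of x] n2(2)[of x] by (auto split: split_indicator)
    qed measurable
    also have "\<dots> = (\<integral>x. f x * (p' x - q' x) \<partial>P)"
      by (rule Bochner_Integration.integral_cong) (auto simp: q'_def p'_def algebra_simps)
    finally show ?thesis .
  qed
  have R'pre: "pre_current R'" unfolding R'_def[abs_def]
    by (intro pre_current_uminus pre_current_diff R1pre N1b_pre_current S2)
  have R'le: "mass1_le R' M r'" unfolding R'_def[abs_def] r'_def[abs_def] by (rule mass1_le_uminus[OF R2M])
  have st2: "flow_state M P R' r' p' q'"
    unfolding flow_state_def using R'pre u2 R'le bR' by blast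
  \<comment> \<open>The removed current is \<open>S1 - S2\<close>. These are the densities of its
    mass and of the two signs of its boundary.\<close>
  have d: "r x - r' x = h1 x + h2 x" "p x - p' x = indicator U x * p x + n2 x" "q x - q' x = n1 x + indicator U x * q1 x" for x
    by (auto simp: r'_def r1_def p'_def p1_def q'_def q1_def)
  have ud: "unit_density (\<lambda>x. r x - r' x)" "unit_density (\<lambda>x. p x - p' x)" "unit_density (\<lambda>x. q x - q' x)"
  proof -
    have "0 \<le> r x - r' x" "r x - r' x \<le> 1" "0 \<le> p x - p' x" "p x - p' x \<le> 1" "0 \<le> q x - q' x" "q x - q' x \<le> 1" for x
      unfolding d using bounds[of x] bounds1[of x] h2(2)[of x] n2(2)[of x]
      by (auto simp: r1_def p1_def q1_def split: split_indicator)
    then show "unit_density (\<lambda>x. r x - r' x)" "unit_density (\<lambda>x. p x - p' x)" "unit_density (\<lambda>x. q x - q' x)"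
      by (auto simp: unit_density_def)
  qed
  have "mass1_le (\<lambda>f \<pi>. S1 f \<pi> + - S2 f \<pi>) M (\<lambda>x. h1 x + h2 x)"
    by (rule mass1_le_add[OF M h1(1) h2(1) S1M mass1_le_uminus[OF S2M]])
  moreover have "(\<lambda>f \<pi>. R f \<pi> - R' f \<pi>) = (\<lambda>f \<pi>. S1 f \<pi> + - S2 f \<pi>)"
    by (simp add: R'_def R1_def fun_eq_iff)
  ultimately have le3: "mass1_le (\<lambda>f \<pi>. R f \<pi> - R' f \<pi>) M (\<lambda>x. r x - r' x)" by (simp add: d)
  have b3: "boundary (\<lambda>f \<pi>. R f \<pi> - R' f \<pi>) f = (\<integral>x. f x * ((p x - p' x) - (q x - q' x)) \<partial>P)" if f: "f \<in> Lip_bs" for f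
  proof -
    have "boundary (\<lambda>f \<pi>. R f \<pi> - R' f \<pi>) f = (\<integral>x. f x * (p x - q x) \<partial>P) - (\<integral>x. f x * (p' x - q' x) \<partial>P)"
      unfolding boundary_diff using bR'[OF f] flow_stateD(6)[OF st f] by simp
    also have "\<dots> = (\<integral>x. f x * (p x - q x) - f x * (p' x - q' x) \<partial>P)"
    proof (rule Bochner_Integration.integral_diff[symmetric]; rule int[OF f])
      show "\<bar>p x - q x\<bar> \<le> 4" "\<bar>p' x - q' x\<bar> \<le> 4" for x
        using bounds[of x] unit_densityD(2,3)[OF u2(2), of x] unit_densityD(2,3)[OF u2(3), of x] by auto
    qed measurable
    also have "\<dots> = (\<integral>x. f x * ((p x - p' x) - (q x - q' x)) \<partial>P)"
      by (rule Bochner_Integration.integral_cong) (auto simp: algebra_simps)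
    finally show ?thesis .
  qed
  have st3: "flow_state M P (\<lambda>f \<pi>. R f \<pi> - R' f \<pi>) (\<lambda>x. r x - r' x) (\<lambda>x. p x - p' x) (\<lambda>x. q x - q' x)"
    unfolding flow_state_def using pre_current_diff[OF flow_stateD(1)[OF st] R'pre] ud le3 b3 by blast
  have zero: "p' x = 0 \<and> q' x = 0" if "x \<in> U" for x
    using that n2(2)[of x] bounds1[of x] by (simp add: p'_def q'_def p1_def)
  have fin: "emeasure (density P (\<lambda>x. ennreal ((p x - p' x) + (q x - q' x)))) UNIV < \<infinity>"
  proof -
    have "emeasure (density P (\<lambda>x. ennreal ((p x - p' x) + (q x - q' x)))) UNIV
        = (\<integral>\<^sup>+x. ennreal ((p x - p' x) + (q x - q' x)) \<partial>P)"
      by (subst emeasure_density) (auto simp: sP)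
    \<comment> \<open>Inside the bounded set \<open>U\<close> at most density 2 is removed; the far
      ends of the drained flow are accounted for by \<open>n1\<close> and \<open>n2\<close>, which
      have finite total mass.\<close>
    also have "\<dots> \<le> (\<integral>\<^sup>+x. ennreal 2 * indicator U x + (ennreal (n1 x) + ennreal (n2 x)) \<partial>P)"
    proof (rule nn_integral_mono)
      fix x
      have "(p x - p' x) + (q x - q' x) \<le> 2 * indicator U x + (n1 x + n2 x)"
        unfolding d using bounds[of x] bounds1[of x] by (auto split: split_indicator)
      then have "ennreal ((p x - p' x) + (q x - q' x)) \<le> ennreal (2 * indicator U x + (n1 x + n2 x))"
        by (rule ennreal_leI)
      also have "\<dots> = ennreal 2 * indicator U x + (ennreal (n1 x) + ennreal (n2 x))"
        using bounds(8)[of x] bounds1(8)[of x] by (auto simp: ennreal_plus split: split_indicator)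
      finally show "ennreal ((p x - p' x) + (q x - q' x)) \<le> ennreal 2 * indicator U x + (ennreal (n1 x) + ennreal (n2 x))" .
    qed
    also have "\<dots> = ennreal 2 * emeasure P U + (emeasure (density P (\<lambda>x. ennreal (n1 x))) UNIV + emeasure (density P (\<lambda>x. ennreal (n2 x))) UNIV)"
      by (subst (1 2) emeasure_density) (auto simp: sP nn_integral_add nn_integral_cmult)
    also have "\<dots> < \<infinity>"
      using n1f n2f loc_finite_emeasure[OF P U] by (simp add: ennreal_mult_less_top)
    finally show ?thesis .
  qed
  show ?thesis using st2 st3 zero fin by blast
qed

lemma drain_sequence:
  fixes T :: "'a::metric_space current1"
  assumes M: "loc_finite M" and P: "loc_finite P" and st: "flow_state M P T r p q"
  shows "\<exists>R :: nat \<Rightarrow> 'a current1. \<exists>rr pp qq. R 0 = T \<and> rr 0 = r \<and> pp 0 = p \<and> qq 0 = q \<and>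
    (\<forall>m. flow_state M P (R m) (rr m) (pp m) (qq m) \<and>
      flow_state M P (\<lambda>f \<pi>. R m f \<pi> - R (Suc m) f \<pi>) (\<lambda>x. rr m x - rr (Suc m) x) (\<lambda>x. pp m x - pp (Suc m) x) (\<lambda>x. qq m x - qq (Suc m) x) \<and>
      (\<forall>x\<in>ball undefined (real m). pp (Suc m) x = 0 \<and> qq (Suc m) x = 0) \<and>
      emeasure (density P (\<lambda>x. ennreal ((pp m x - pp (Suc m) x) + (qq m x - qq (Suc m) x)))) UNIV < \<infinity>)"
proof -
  define St where "St n = (\<lambda>(R :: 'a current1, r, p', q'). flow_state M P R r p' q')" for n :: nat
  define Tr where "Tr n = (\<lambda>(R :: 'a current1, r, p, q) (R' :: 'a current1, r', p', q').
    flow_state M P (\<lambda>f \<pi>. R f \<pi> - R' f \<pi>) (\<lambda>x. r x - r' x) (\<lambda>x. p x - p' x) (\<lambda>x. q x - q' x) \<and>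
    (\<forall>x\<in>ball undefined (real n). p' x = 0 \<and> q' x = 0) \<and>
    emeasure (density P (\<lambda>x. ennreal ((p x - p' x) + (q x - q' x)))) UNIV < \<infinity>)" for n
  \<comment> \<open>The clause for \<open>n = 0\<close> fixes the initial state within the dependent
    choice.\<close>
  have "\<exists>F. \<forall>n. (St n (F n) \<and> (n = 0 \<longrightarrow> F n = (T, r, p, q))) \<and> Tr n (F n) (F (Suc n))"
  proof (rule dependent_nat_choice)
    show "\<exists>x. St 0 x \<and> (0 = 0 \<longrightarrow> x = (T, r, p, q))" using st by (simp add: St_def)
    fix x n assume "St n x \<and> (n = 0 \<longrightarrow> x = (T, r, p, q))"
    moreover obtain R s u v where x: "x = (R, s, u, v)" by (cases x) auto
    ultimately have "flow_state M P R s u v" by (simp add: St_def)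
    from drain_boundary[OF M P ball_bounded_borel[of undefined "real n"] this]
    obtain R' r' p' q' where "St (Suc n) (R', r', p', q')" "Tr n x (R', r', p', q')"
      unfolding St_def Tr_def x prod.case by blast
    then show "\<exists>y. (St (Suc n) y \<and> (Suc n = 0 \<longrightarrow> y = (T, r, p, q))) \<and> Tr n x y" by blast
  qed
  then obtain F where F: "\<And>n. St n (F n)" "F 0 = (T, r, p, q)" "\<And>n. Tr n (F n) (F (Suc n))" by blast
  show ?thesis
    by (rule exI[of _ "\<lambda>n. fst (F n)"], rule exI[of _ "\<lambda>n. fst (snd (F n))"], rule exI[of _ "\<lambda>n. fst (snd (snd (F n)))"],
        rule exI[of _ "\<lambda>n. snd (snd (snd (F n)))"])
      (use F in \<open>simp add: St_def Tr_def case_prod_beta\<close>)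
qed

section \<open>Subcurrents via densities\<close>

lemma mass0_fam: "mass0 D = fam_mass {()} (\<lambda>_. D)"
  by (simp add: mass0_def fam_mass_def mass_bounds0_def fam_bound_def)

text \<open>Rescaling \<pi> to Lipschitz constant at most 1 makes the mass in dimension 1 the mass
  of a family of functionals.\<close>

lemma mass1_bound_iff:
  fixes S :: "'a::metric_space current1"
  assumes S: "\<And>f. f \<in> Lip_bs \<Longrightarrow> linear_on_Lip (S f)"
  shows "(\<forall>f\<in>Lip_bs. \<forall>\<pi>\<in>Lip. \<bar>S f \<pi>\<bar> \<le> lip_const \<pi> * (\<integral>x. \<bar>f x\<bar> \<partial>N)) \<longleftrightarrow>
      fam_bound {\<pi> \<in> Lip. lip_const \<pi> \<le> 1} (\<lambda>\<pi> f. S f \<pi>) N"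
proof
  assume a: "\<forall>f\<in>Lip_bs. \<forall>\<pi>\<in>Lip. \<bar>S f \<pi>\<bar> \<le> lip_const \<pi> * (\<integral>x. \<bar>f x\<bar> \<partial>N)"
  show "fam_bound {\<pi> \<in> Lip. lip_const \<pi> \<le> 1} (\<lambda>\<pi> f. S f \<pi>) N"
    unfolding fam_bound_def
  proof (intro ballI)
    fix \<pi> f :: "'a \<Rightarrow> real" assume \<pi>: "\<pi> \<in> {\<pi> \<in> Lip. lip_const \<pi> \<le> 1}" and f: "f \<in> Lip_bs"
    have "lip_const \<pi> * (\<integral>x. \<bar>f x\<bar> \<partial>N) \<le> 1 * (\<integral>x. \<bar>f x\<bar> \<partial>N)"
      using \<pi> by (intro mult_right_mono integral_nonneg_AE) auto
    then show "\<bar>S f \<pi>\<bar> \<le> (\<integral>x. \<bar>f x\<bar> \<partial>N)" using a f \<pi> by fastforce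
  qed
next
  assume b: "fam_bound {\<pi> \<in> Lip. lip_const \<pi> \<le> 1} (\<lambda>\<pi> f. S f \<pi>) N"
  show "\<forall>f\<in>Lip_bs. \<forall>\<pi>\<in>Lip. \<bar>S f \<pi>\<bar> \<le> lip_const \<pi> * (\<integral>x. \<bar>f x\<bar> \<partial>N)"
  proof (intro ballI, rule field_le_epsilon)
    fix f \<pi> :: "'a \<Rightarrow> real" and e :: real assume f: "f \<in> Lip_bs" and \<pi>: "\<pi> \<in> Lip" and e: "0 < e"
    define I where "I = (\<integral>x. \<bar>f x\<bar> \<partial>N)"
    have I0: "0 \<le> I" unfolding I_def by (intro integral_nonneg_AE) auto
    \<comment> \<open>Slightly more than the Lipschitz constant, which may be 0; the excess costs at
      most \<open>e\<close> after multiplication by \<open>I\<close>.\<close>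
    define c where "c = lip_const \<pi> + e / (I + 1)"
    have c: "c > 0" using lip_const_nonneg[OF \<pi>] e I0 by (simp add: c_def add_nonneg_pos)
    have \<rho>: "(\<lambda>x. (1 / c) * \<pi> x) \<in> Lip" by (rule Lip_cmult[OF \<pi>])
    have "lip_const (\<lambda>x. (1 / c) * \<pi> x) \<le> \<bar>1 / c\<bar> * lip_const \<pi>" by (rule lip_const_cmult[OF \<pi>])
    also have "\<dots> \<le> 1" using c e I0 by (simp add: c_def)
    finally have "\<bar>S f (\<lambda>x. (1 / c) * \<pi> x)\<bar> \<le> I" using b f \<rho> by (auto simp: fam_bound_def I_def)
    moreover have "S f (\<lambda>x. (1 / c) * \<pi> x + 0 * \<pi> x) = (1 / c) * S f \<pi> + 0 * S f \<pi>"
      using S[OF f] \<pi> unfolding linear_on_Lip_def by blast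
    ultimately have "\<bar>(1 / c) * S f \<pi>\<bar> \<le> I" by simp
    then have "\<bar>S f \<pi>\<bar> / c \<le> I" using c by (simp add: abs_mult)
    then have "\<bar>S f \<pi>\<bar> \<le> c * I" using c by (simp add: pos_divide_le_eq mult.commute)
    also have "\<dots> = lip_const \<pi> * I + e * (I / (I + 1))" by (simp add: c_def algebra_simps)
    also have "\<dots> \<le> lip_const \<pi> * I + e"
      using e I0 by (intro add_left_mono mult_left_le) auto
    finally show "\<bar>S f \<pi>\<bar> \<le> lip_const \<pi> * (\<integral>x. \<bar>f x\<bar> \<partial>N) + e" by (simp add: I_def)
  qed
qed

lemma mass1_fam:
  fixes S :: "'a::metric_space current1"
  assumes "\<And>f. f \<in> Lip_bs \<Longrightarrow> linear_on_Lip (S f)"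
  shows "mass1 S = fam_mass {\<pi> \<in> Lip. lip_const \<pi> \<le> 1} (\<lambda>\<pi> f. S f \<pi>)"
proof -
  have "(\<forall>f\<in>Lip_bs. \<forall>\<pi>\<in>Lip. \<bar>S f \<pi>\<bar> \<le> lip_const \<pi> * (\<integral>x. \<bar>f x\<bar> \<partial>N)) \<longleftrightarrow>
      fam_bound {\<pi> \<in> Lip. lip_const \<pi> \<le> 1} (\<lambda>\<pi> f. S f \<pi>) N" for N
    by (rule mass1_bound_iff) (rule assms)
  then show ?thesis by (simp add: mass1_def fam_mass_def mass_bounds1_def)
qed

text \<open>An instance of \<open>fam_mass_add\<close>: \<open>a\<close> belongs to the piece
  \<open>A\<close>, \<open>b\<close> to the rest of \<open>Q\<close>, and \<open>c\<close> to what
  had been taken from \<open>T\<close> before \<open>Q\<close> was left.\<close>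

lemma subcurrent1I:
  fixes T :: "'a::metric_space current1"
  assumes M: "loc_finite M" "mass1 T = M" "mass1_le T M (\<lambda>_. 1)"
    and pre: "pre_current T" "pre_current A" "pre_current Q"
    and u: "unit_density a" "unit_density b" "unit_density c" and sum: "\<And>x. a x + b x + c x \<le> 1"
    and le: "mass1_le A M a" "mass1_le (\<lambda>f \<pi>. Q f \<pi> - A f \<pi>) M b" "mass1_le (\<lambda>f \<pi>. T f \<pi> - Q f \<pi>) M c"
  shows "subcurrent1 A Q"
proof -
  have m: "mass1 S = fam_mass {\<pi> \<in> Lip. lip_const \<pi> \<le> 1} (\<lambda>\<pi> f. S f \<pi>)" if "pre_current S" for S :: "'a current1"
    using that by (intro mass1_fam) (simp add: pre_current_def)
  have lin2: "linear_on_Lip_bs (\<lambda>f. S f \<pi>)" if "pre_current S" "\<pi> \<in> {\<pi> \<in> Lip. lip_const \<pi> \<le> 1}" for S \<pi>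
    using that by (simp add: pre_current_def)
  have bnd: "\<bar>S f \<pi>\<bar> \<le> (\<integral>x. \<bar>f x\<bar> * s x \<partial>M)"
    if S: "mass1_le S M s" and s: "unit_density s" and \<pi>: "\<pi> \<in> {\<pi> \<in> Lip. lip_const \<pi> \<le> 1}" and f: "f \<in> Lip_bs" for S s \<pi> f
  proof -
    have "lip_const \<pi> * (\<integral>x. \<bar>f x\<bar> * s x \<partial>M) \<le> 1 * (\<integral>x. \<bar>f x\<bar> * s x \<partial>M)"
      using \<pi> unit_densityD(2)[OF s] by (intro mult_right_mono integral_nonneg_AE) auto
    then show ?thesis using S f \<pi> unfolding mass1_le_def by fastforce
  qed
  have D: "pre_current (\<lambda>f \<pi>. Q f \<pi> - A f \<pi>)" by (rule pre_current_diff[OF pre(3,2)])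
  show ?thesis
    unfolding subcurrent1_def
  proof (intro ballI)
    fix X :: "'a set" assume X: "X \<in> sets borel"
    show "emeasure (mass1 Q) X = emeasure (mass1 A) X + emeasure (mass1 (\<lambda>f \<pi>. Q f \<pi> - A f \<pi>)) X"
      unfolding m[OF pre(2)] m[OF pre(3)] m[OF D]
    proof (rule fam_mass_add[OF M(1), where T="\<lambda>\<pi> f. T f \<pi>" and a=a and b=b and c=c])
      show "fam_mass {\<pi> \<in> Lip. lip_const \<pi> \<le> 1} (\<lambda>\<pi> f. T f \<pi>) = M"
        using M(2) m[OF pre(1)] by simp
      have "unit_density (\<lambda>_. 1)" by (simp add: unit_density_def)
      from bnd[OF M(3) this] show "fam_bound {\<pi> \<in> Lip. lip_const \<pi> \<le> 1} (\<lambda>\<pi> f. T f \<pi>) M"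
        by (simp add: fam_bound_def)
    next
      fix \<pi> :: "'a \<Rightarrow> real" assume \<pi>: "\<pi> \<in> {\<pi> \<in> Lip. lip_const \<pi> \<le> 1}"
      show "linear_on_Lip_bs (\<lambda>f. A f \<pi>)" "linear_on_Lip_bs (\<lambda>f. Q f \<pi>)" "linear_on_Lip_bs (\<lambda>f. T f \<pi>)"
        using lin2[OF _ \<pi>] pre by auto
      fix f :: "'a \<Rightarrow> real" assume f: "f \<in> Lip_bs"
      show "\<bar>A f \<pi>\<bar> \<le> (\<integral>x. \<bar>f x\<bar> * a x \<partial>M)" by (rule bnd[OF le(1) u(1) \<pi> f])
      show "\<bar>Q f \<pi> - A f \<pi>\<bar> \<le> (\<integral>x. \<bar>f x\<bar> * b x \<partial>M)" by (rule bnd[OF le(2) u(2) \<pi> f])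
      show "\<bar>T f \<pi> - Q f \<pi>\<bar> \<le> (\<integral>x. \<bar>f x\<bar> * c x \<partial>M)" by (rule bnd[OF le(3) u(3) \<pi> f])
    qed (rule unit_densityD(1,2)[OF u(1)] unit_densityD(1,2)[OF u(2)] unit_densityD(1,2)[OF u(3)] sum X)+
  qed
qed

lemma subcurrent0I:
  fixes D :: "'a::metric_space current0"
  assumes P: "loc_finite P" "mass0 D = P" "\<And>f. f \<in> Lip_bs \<Longrightarrow> \<bar>D f\<bar> \<le> (\<integral>x. \<bar>f x\<bar> \<partial>P)"
    and lin: "linear_on_Lip_bs D" "linear_on_Lip_bs A" "linear_on_Lip_bs Q"
    and meas: "a \<in> borel_measurable borel" "b \<in> borel_measurable borel" "c \<in> borel_measurable borel"
    and nn: "\<And>x. 0 \<le> a x" "\<And>x. 0 \<le> b x" "\<And>x. 0 \<le> c x" and sum: "\<And>x. a x + b x + c x \<le> 1"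
    and le: "\<And>f. f \<in> Lip_bs \<Longrightarrow> \<bar>A f\<bar> \<le> (\<integral>x. \<bar>f x\<bar> * a x \<partial>P)"
      "\<And>f. f \<in> Lip_bs \<Longrightarrow> \<bar>Q f - A f\<bar> \<le> (\<integral>x. \<bar>f x\<bar> * b x \<partial>P)"
      "\<And>f. f \<in> Lip_bs \<Longrightarrow> \<bar>D f - Q f\<bar> \<le> (\<integral>x. \<bar>f x\<bar> * c x \<partial>P)"
  shows "subcurrent0 A Q"
  unfolding subcurrent0_def mass0_fam
proof (intro ballI)
  fix X :: "'a set" assume X: "X \<in> sets borel"
  show "emeasure (fam_mass {()} (\<lambda>_. Q)) X = emeasure (fam_mass {()} (\<lambda>_. A)) X + emeasure (fam_mass {()} (\<lambda>_ f. Q f - A f)) X"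
  proof (rule fam_mass_add[OF P(1), where T="\<lambda>_. D" and a=a and b=b and c=c])
    show "fam_mass {()} (\<lambda>_. D) = P" using P(2) by (simp add: mass0_fam)
    show "fam_bound {()} (\<lambda>_. D) P" using P(3) by (simp add: fam_bound_def)
  qed (rule lin meas nn sum le X; assumption)+
qed

text \<open>Relative to the given bound, the mass has a density that is at most 1.\<close>

lemma emeasure_mass0_le:
  fixes D :: "'a::metric_space current0"
  assumes P: "loc_finite P" and D: "linear_on_Lip_bs D" and k: "k \<in> borel_measurable borel" "\<And>x. 0 \<le> k x" "\<And>x. k x \<le> C"
    and le: "\<And>f. f \<in> Lip_bs \<Longrightarrow> \<bar>D f\<bar> \<le> (\<integral>x. \<bar>f x\<bar> * k x \<partial>P)"
  shows "emeasure (mass0 D) UNIV \<le> emeasure (density P (\<lambda>x. ennreal (k x))) UNIV"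
proof -
  let ?N = "density P (\<lambda>x. ennreal (k x))"
  have N: "loc_finite ?N" by (rule loc_finite_density[OF P k(1,3)])
  have fb: "fam_bound {()} (\<lambda>_. D) ?N" using le by (simp add: fam_bound_density[OF P k(1,2)])
  obtain h where h: "least_density {()} (\<lambda>_. D) ?N h" "fam_mass {()} (\<lambda>_. D) = density ?N (\<lambda>x. ennreal (h x))"
    by (rule fam_mass_density[OF N D fb])
  have "emeasure (density ?N (\<lambda>x. ennreal (h x))) UNIV \<le> emeasure (density ?N (\<lambda>x. ennreal 1)) UNIV"
    using least_densityD(1,3)[OF h(1)] by (intro emeasure_density_mono[OF N]) auto
  also have "\<dots> = emeasure ?N UNIV" by (simp add: density_1)
  finally show ?thesis using h(2) by (simp add: mass0_fam)
qed

text \<open>The least measure is itself a mass bound. This makes the density of \<open>T\<close>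
  equal to the constant 1, the normalisation under which \<open>fam_mass_add\<close> is
  used.\<close>

lemma mass1_attained:
  assumes T: "T \<in> M\<^sub>1\<^sub>b"
  obtains M where "loc_finite M" "mass1 T = M" "mass1_le T M (\<lambda>_. 1)"
proof -
  let ?I = "{\<pi> \<in> Lip. lip_const \<pi> \<le> 1}" and ?L = "\<lambda>\<pi> f. T f \<pi>"
  have pre: "pre_current T" by (rule M1b_pre_current[OF T])
  have eq: "mass1 T = fam_mass ?I ?L" using pre by (intro mass1_fam) (simp add: pre_current_def)
  obtain \<mu> where \<mu>: "\<mu> \<in> mass_bounds1 T" using M1bD(5)[OF T] by blast
  let ?N = "borel_extension \<mu>"
  have N: "loc_finite ?N" using \<mu> by (intro loc_finite_borel_extension) (simp add: mass_bounds1_def)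
  have bdN: "\<bar>T f \<pi>\<bar> \<le> lip_const \<pi> * (\<integral>x. \<bar>f x\<bar> \<partial>?N)" if "f \<in> Lip_bs" "\<pi> \<in> Lip" for f \<pi>
    using \<mu> that by (simp add: mass_bounds1_def)
  have fb: "fam_bound ?I ?L ?N" unfolding fam_bound_def
  proof (intro ballI)
    fix \<pi> f :: "'a \<Rightarrow> real" assume \<pi>: "\<pi> \<in> ?I" and f: "f \<in> Lip_bs"
    have "lip_const \<pi> * (\<integral>x. \<bar>f x\<bar> \<partial>?N) \<le> 1 * (\<integral>x. \<bar>f x\<bar> \<partial>?N)"
      using \<pi> by (intro mult_right_mono integral_nonneg_AE) auto
    then show "\<bar>T f \<pi>\<bar> \<le> (\<integral>x. \<bar>f x\<bar> \<partial>?N)" using bdN[OF f, of \<pi>] \<pi> by simp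
  qed
  have lin: "linear_on_Lip_bs (?L \<pi>)" if "\<pi> \<in> ?I" for \<pi> using pre that by (simp add: pre_current_def)
  obtain k where k: "least_density ?I ?L ?N k" "fam_mass ?I ?L = density ?N (\<lambda>x. ennreal (k x))"
    by (rule fam_mass_density[OF N lin fb])
  let ?M = "density ?N (\<lambda>x. ennreal (k x))"
  have M: "loc_finite ?M" by (rule loc_finite_density[OF N least_densityD(1,3)[OF k(1)]])
  have "measure ?M \<in> mass_bounds1 T"
  proof -
    have "fam_bound ?I ?L ?M" by (rule least_densityD(4)[OF k(1)])
    then have "\<forall>f\<in>Lip_bs. \<forall>\<pi>\<in>Lip. \<bar>T f \<pi>\<bar> \<le> lip_const \<pi> * (\<integral>x. \<bar>f x\<bar> \<partial>?M)"
      using pre by (subst mass1_bound_iff) (auto simp: pre_current_def)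
    then show ?thesis by (intro mass_bounds1I[OF M]) auto
  qed
  then have "mass1_le T ?M (\<lambda>_. 1)"
    by (simp add: mass_bounds1_def mass1_le_def borel_extension_measure[OF M])
  then show ?thesis using eq k(2) M by (intro that[of ?M]) auto
qed

lemma mass0_attained:
  assumes D: "D \<in> currents0"
  obtains P where "loc_finite P" "mass0 D = P" "\<forall>f\<in>Lip_bs. \<bar>D f\<bar> \<le> (\<integral>x. \<bar>f x\<bar> \<partial>P)"
proof -
  have lin: "linear_on_Lip_bs D" using D by (simp add: currents0_def)
  obtain \<mu> where \<mu>: "\<mu> \<in> mass_bounds0 D" using D by (auto simp: currents0_def)
  let ?N = "borel_extension \<mu>"
  have N: "loc_finite ?N" using \<mu> by (intro loc_finite_borel_extension) (simp add: mass_bounds0_def)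
  have fb: "fam_bound {()} (\<lambda>_. D) ?N" using \<mu> by (simp add: fam_bound_def mass_bounds0_def)
  obtain k where k: "least_density {()} (\<lambda>_. D) ?N k" "fam_mass {()} (\<lambda>_. D) = density ?N (\<lambda>x. ennreal (k x))"
    by (rule fam_mass_density[OF N lin fb])
  show ?thesis
    by (rule that[of "density ?N (\<lambda>x. ennreal (k x))"])
      (use loc_finite_density[OF N least_densityD(1,3)[OF k(1)]] k(2) least_densityD(4)[OF k(1)] in
        \<open>auto simp: mass0_fam fam_bound_def\<close>)
qed

text \<open>The Jordan decomposition of the boundary, read off the signed density \<open>g\<close>.
  Its bound by 1 gives \<open>p + q \<le> 1\<close>, which later makes the boundary densities of all
  pieces fit under 1.\<close>

lemma initial_flow_state:
  fixes T :: "'a::metric_space current1"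
  assumes T: "T \<in> N\<^sub>1\<^sub>b" and M: "mass1_le T M (\<lambda>_. 1)" and P: "loc_finite P"
    and bd: "\<And>f. f \<in> Lip_bs \<Longrightarrow> \<bar>boundary T f\<bar> \<le> (\<integral>x. \<bar>f x\<bar> \<partial>P)"
  obtains p q where "flow_state M P T (\<lambda>_. 1) p q" "\<forall>x. p x + q x \<le> 1"
proof -
  have pre: "pre_current T" by (rule N1b_pre_current[OF T])
  obtain g where g: "g \<in> borel_measurable borel" "\<And>x. \<bar>g x\<bar> \<le> 1" "\<And>f. f \<in> Lip_bs \<Longrightarrow> boundary T f = (\<integral>x. f x * g x \<partial>P)"
    using functional_density[OF P boundary_linear[OF pre] bd] by blast
  define p q where "p x = max 0 (g x)" and "q x = max 0 (- g x)" for x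
  have pq: "unit_density p" "unit_density q"
    using g(1,2) by (auto simp: unit_density_def p_def[abs_def] q_def[abs_def] abs_le_iff minus_le_iff)
  have d: "p x - q x = g x" "p x + q x \<le> 1" for x using g(2)[of x] by (auto simp: p_def q_def)
  have "unit_density (\<lambda>_::'a. 1)" by (simp add: unit_density_def)
  then have "flow_state M P T (\<lambda>_. 1) p q"
    using pre M pq g(3) by (simp add: flow_state_def d)
  then show ?thesis using d by (intro that) auto
qed

lemma unit_density_diff:
  assumes a: "unit_density a" and b: "unit_density b" and le: "\<And>x. b x \<le> a x"
  shows "unit_density (\<lambda>x. a x - b x)"
proof -
  have "0 \<le> a x - b x \<and> a x - b x \<le> 1" for x
    using unit_densityD(3)[OF a, of x] unit_densityD(2)[OF b, of x] le[of x] by linarith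
  then show ?thesis using unit_densityD(1)[OF a] unit_densityD(1)[OF b] by (simp add: unit_density_def)
qed

theorem theorem9:
  fixes T :: "'a::metric_space current1"
  assumes "T \<in> N\<^sub>1\<^sub>b"
  shows "\<exists>S :: nat \<Rightarrow> 'a current1.
    (\<forall>i. S i \<in> N\<^sub>1\<^sub>b) \<and>
    (\<forall>f \<in> Lip_bs. \<forall>\<pi> \<in> Lip. (\<lambda>i. S i f \<pi>) sums T f \<pi>) \<and>
    (\<forall>f \<in> Lip_bs. boundary (S 0) f = 0) \<and>
    (\<forall>m. emeasure (mass0 (boundary (S m))) UNIV < \<infinity> \<and>
         subcurrent1 (S m) (\<lambda>f \<pi>. T f \<pi> - (\<Sum>i<m. S i f \<pi>)) \<and>
         subcurrent0 (boundary (S m)) (\<lambda>f. boundary T f - (\<Sum>i<m. boundary (S i) f)))"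
proof -
  have TM: "T \<in> M\<^sub>1\<^sub>b" "boundary T \<in> currents0" using assms by (auto simp: N\<^sub>1\<^sub>b_def)
  obtain M where M: "loc_finite M" "mass1 T = M" "mass1_le T M (\<lambda>_. 1)" by (rule mass1_attained[OF TM(1)])
  obtain P where P: "loc_finite P" "mass0 (boundary T) = P" and bdT: "\<forall>f\<in>Lip_bs. \<bar>boundary T f\<bar> \<le> (\<integral>x. \<bar>f x\<bar> \<partial>P)"
    by (rule mass0_attained[OF TM(2)])
  obtain p0 q0 where init: "flow_state M P T (\<lambda>_. 1) p0 q0" and pq1: "\<forall>x. p0 x + q0 x \<le> 1"
    by (rule initial_flow_state[OF assms M(3) P(1) bdT[rule_format]])
  obtain R :: "nat \<Rightarrow> 'a current1" and r p q where R0: "R 0 = T" "r 0 = (\<lambda>_. 1)" "p 0 = p0" "q 0 = q0"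
    and all: "\<forall>m. flow_state M P (R m) (r m) (p m) (q m) \<and>
      flow_state M P (\<lambda>f \<pi>. R m f \<pi> - R (Suc m) f \<pi>) (\<lambda>x. r m x - r (Suc m) x) (\<lambda>x. p m x - p (Suc m) x) (\<lambda>x. q m x - q (Suc m) x) \<and>
      (\<forall>x\<in>ball undefined (real m). p (Suc m) x = 0 \<and> q (Suc m) x = 0) \<and>
      emeasure (density P (\<lambda>x. ennreal ((p m x - p (Suc m) x) + (q m x - q (Suc m) x)))) UNIV < \<infinity>"
    using drain_sequence[OF M(1) P(1) init] by blast
  have st: "flow_state M P (R m) (r m) (p m) (q m)"
    and dst: "flow_state M P (\<lambda>f \<pi>. R m f \<pi> - R (Suc m) f \<pi>) (\<lambda>x. r m x - r (Suc m) x) (\<lambda>x. p m x - p (Suc m) x) (\<lambda>x. q m x - q (Suc m) x)"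
    and zero: "x \<in> ball undefined (real m) \<Longrightarrow> p (Suc m) x = 0 \<and> q (Suc m) x = 0"
    and fin: "emeasure (density P (\<lambda>x. ennreal ((p m x - p (Suc m) x) + (q m x - q (Suc m) x)))) UNIV < \<infinity>" for m x
    using all by auto
  have [measurable_cong]: "sets M = sets borel" "sets P = sets borel" using loc_finite_sets M(1) P(1) by auto
  note u = flow_stateD(2,4,5)[OF st] and du = flow_stateD(2,4,5)[OF dst]
  have [measurable]: "r m \<in> borel_measurable borel" "p m \<in> borel_measurable borel" "q m \<in> borel_measurable borel" for m
    using u unit_densityD(1) by blast+
  have r01: "0 \<le> r m x" "r m x \<le> 1" "r (Suc m) x \<le> r m x" for m x
    using unit_densityD(2,3)[OF u(1)] unit_densityD(2)[OF du(1)[of m], of x] by auto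
  have pq01: "0 \<le> p m x" "0 \<le> q m x" "p (Suc m) x \<le> p m x" "q (Suc m) x \<le> q m x" for m x
    using unit_densityD(2)[OF u(2)] unit_densityD(2)[OF u(3)] unit_densityD(2)[OF du(2)[of m], of x] unit_densityD(2)[OF du(3)[of m], of x] by auto
  have rdec: "r n x \<le> r m x" "p n x \<le> p m x" "q n x \<le> q m x" if "m \<le> n" for m n x
    using r01(3) pq01(3,4) that lift_Suc_antimono_le[of "\<lambda>m. r m x"] lift_Suc_antimono_le[of "\<lambda>m. p m x"] lift_Suc_antimono_le[of "\<lambda>m. q m x"] by auto
  have ru: "unit_density (\<lambda>x. r m x - r n x)" if "m \<le> n" for m n
    by (rule unit_density_diff[OF u(1) u(1) rdec(1)[OF that]])
  have diff_le: "mass1_le (\<lambda>f \<pi>. R m f \<pi> - R n f \<pi>) M (\<lambda>x. r m x - r n x)" if "m \<le> n" for m n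
    using that
  proof (induction n rule: dec_induct)
    case base
    then show ?case by (simp add: mass1_le_def)
  next
    case (step n)
    have "mass1_le (\<lambda>f \<pi>. (R m f \<pi> - R n f \<pi>) + (R n f \<pi> - R (Suc n) f \<pi>)) M (\<lambda>x. (r m x - r n x) + (r n x - r (Suc n) x))"
      using step by (intro mass1_le_add[OF M(1) ru du(1) _ flow_stateD(3)[OF dst]]) auto
    then show ?case by simp
  qed
  \<comment> \<open>The density of the mass that is never removed; it exists because the
    \<open>r m\<close> decrease.\<close>
  define ri where "ri x = lim (\<lambda>m. r m x)" for x
  have rlim: "(\<lambda>m. r m x) \<longlonglongrightarrow> ri x" for x
  proof -
    have "convergent (\<lambda>m. r m x)" by (rule Bseq_monoseq_convergent)
        (use r01 in \<open>auto intro!: BseqI'[where K=1] decseq_imp_monoseq decseq_SucI\<close>)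
    then show ?thesis by (simp add: ri_def convergent_LIMSEQ_iff)
  qed
  have ri[measurable]: "ri \<in> borel_measurable borel" by (rule borel_measurable_LIMSEQ_real[OF rlim]) measurable
  have ri01: "0 \<le> ri x" "ri x \<le> 1" "ri x \<le> r m x" for m x
  proof -
    show "0 \<le> ri x" by (rule LIMSEQ_le_const[OF rlim]) (use r01 in blast)
    show "ri x \<le> 1" by (rule LIMSEQ_le_const2[OF rlim]) (use r01 in blast)
    show "ri x \<le> r m x" by (rule LIMSEQ_le_const2[OF rlim]) (use rdec(1) in blast)
  qed
  have Ilim: "(\<lambda>n. \<integral>x. \<bar>f x\<bar> * r n x \<partial>M) \<longlonglongrightarrow> (\<integral>x. \<bar>f x\<bar> * ri x \<partial>M)" if f: "f \<in> Lip_bs" for f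
  proof (rule integral_dominated_convergence[where w="\<lambda>x. \<bar>f x\<bar>"])
    note [measurable] = Lip_bs_measurable[OF f]
    show "integrable M (\<lambda>x. \<bar>f x\<bar>)" using integrable_Lip_bs[OF M(1) Lip_bs_abs[OF f]] by simp
    show "AE x in M. (\<lambda>n. \<bar>f x\<bar> * r n x) \<longlonglongrightarrow> \<bar>f x\<bar> * ri x" by (intro AE_I2 tendsto_intros rlim)
    show "AE x in M. norm (\<bar>f x\<bar> * r n x) \<le> \<bar>f x\<bar>" for n
      using r01 by (intro AE_I2) (simp add: abs_mult mult_left_le)
    show "(\<lambda>x. \<bar>f x\<bar> * ri x) \<in> borel_measurable M" "\<And>n. (\<lambda>x. \<bar>f x\<bar> * r n x) \<in> borel_measurable M" by measurable
  qed
  have Iint: "integrable M (\<lambda>x. \<bar>f x\<bar> * w x)" if "f \<in> Lip_bs" "unit_density w" for f w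
    by (rule Lip_bs_integrable(1)[OF M(1) Lip_bs_abs[OF that(1)] unit_densityD(1,4)[OF that(2)]])
  have riu: "unit_density ri" using ri01 by (auto simp: unit_density_def)
  \<comment> \<open>The increments of \<open>R\<close> are dominated by those of the convergent
    sequence \<open>a\<close>, so convergence needs no compactness and no passage to a
    subsequence.\<close>
  have conv: "convergent (\<lambda>m. R m f \<pi>)" if f: "f \<in> Lip_bs" and \<pi>: "\<pi> \<in> Lip" for f \<pi>
  proof -
    define a where "a m = lip_const \<pi> * (\<integral>x. \<bar>f x\<bar> * r m x \<partial>M)" for m
    have "\<bar>R m f \<pi> - R n f \<pi>\<bar> \<le> a m - a n" if "m \<le> n" for m n
    proof -
      have "\<bar>R m f \<pi> - R n f \<pi>\<bar> \<le> lip_const \<pi> * (\<integral>x. \<bar>f x\<bar> * (r m x - r n x) \<partial>M)"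
        using diff_le[OF that] f \<pi> by (simp add: mass1_le_def)
      then show ?thesis using Iint[OF f u(1)] by (simp add: a_def right_diff_distrib)
    qed
    then have le: "\<bar>R m f \<pi> - R n f \<pi>\<bar> \<le> \<bar>a m - a n\<bar>" for m n
      using nle_le[of m n] by (metis abs_ge_self abs_minus_commute order_trans)
    have "Cauchy a"
      unfolding a_def by (rule LIMSEQ_imp_Cauchy[OF tendsto_mult[OF tendsto_const Ilim[OF f]]])
    have "Cauchy (\<lambda>m. R m f \<pi>)"
    proof (rule CauchyI)
      fix e :: real assume "0 < e"
      then obtain N where "\<forall>m\<ge>N. \<forall>n\<ge>N. norm (a m - a n) < e" using CauchyD[OF \<open>Cauchy a\<close>] by blast
      then show "\<exists>N. \<forall>m\<ge>N. \<forall>n\<ge>N. norm (R m f \<pi> - R n f \<pi>) < e"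
      proof (intro exI[of _ N] allI impI)
        fix m n assume "N \<le> m" "N \<le> n"
        then have "\<bar>a m - a n\<bar> < e" using \<open>\<forall>m\<ge>N. \<forall>n\<ge>N. norm (a m - a n) < e\<close> by simp
        then show "norm (R m f \<pi> - R n f \<pi>) < e" using le[of m n] by simp
      qed
    qed
    then show ?thesis by (rule Cauchy_convergent)
  qed
  define Z where "Z f \<pi> = lim (\<lambda>m. R m f \<pi>)" for f \<pi>
  have Zlim: "(\<lambda>m. R m f \<pi>) \<longlonglongrightarrow> Z f \<pi>" if "f \<in> Lip_bs" "\<pi> \<in> Lip" for f \<pi>
    using conv[OF that] by (simp add: Z_def convergent_LIMSEQ_iff)
  have Zpre: "pre_current Z" by (rule pre_current_limit[OF flow_stateD(1)[OF st] Zlim])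
  have Zle: "mass1_le Z M ri"
    unfolding mass1_le_def
  proof (intro ballI)
    fix f \<pi> :: "'a \<Rightarrow> real" assume f: "f \<in> Lip_bs" and \<pi>: "\<pi> \<in> Lip"
    show "\<bar>Z f \<pi>\<bar> \<le> lip_const \<pi> * (\<integral>x. \<bar>f x\<bar> * ri x \<partial>M)"
    proof (rule LIMSEQ_le[OF tendsto_rabs[OF Zlim[OF f \<pi>]] tendsto_mult[OF tendsto_const Ilim[OF f]]])
      show "\<exists>N. \<forall>n\<ge>N. \<bar>R n f \<pi>\<bar> \<le> lip_const \<pi> * (\<integral>x. \<bar>f x\<bar> * r n x \<partial>M)"
        using flow_stateD(3)[OF st] f \<pi> by (auto simp: mass1_le_def)
    qed
  qed
  have RZu: "unit_density (\<lambda>x. r m x - ri x)" for m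
    by (rule unit_density_diff[OF u(1) riu ri01(3)])
  have RZle: "mass1_le (\<lambda>f \<pi>. R m f \<pi> - Z f \<pi>) M (\<lambda>x. r m x - ri x)" for m
    unfolding mass1_le_def
  proof (intro ballI)
    fix f \<pi> :: "'a \<Rightarrow> real" assume f: "f \<in> Lip_bs" and \<pi>: "\<pi> \<in> Lip"
    have "(\<lambda>n. \<bar>R m f \<pi> - R n f \<pi>\<bar>) \<longlonglongrightarrow> \<bar>R m f \<pi> - Z f \<pi>\<bar>"
      by (intro tendsto_intros Zlim f \<pi>)
    moreover have "(\<lambda>n. lip_const \<pi> * ((\<integral>x. \<bar>f x\<bar> * r m x \<partial>M) - (\<integral>x. \<bar>f x\<bar> * r n x \<partial>M)))
        \<longlonglongrightarrow> lip_const \<pi> * ((\<integral>x. \<bar>f x\<bar> * r m x \<partial>M) - (\<integral>x. \<bar>f x\<bar> * ri x \<partial>M))"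
      by (rule tendsto_mult[OF tendsto_const tendsto_diff[OF tendsto_const Ilim[OF f]]])
    moreover have "\<bar>R m f \<pi> - R n f \<pi>\<bar> \<le> lip_const \<pi> * ((\<integral>x. \<bar>f x\<bar> * r m x \<partial>M) - (\<integral>x. \<bar>f x\<bar> * r n x \<partial>M))" if "m \<le> n" for n
    proof -
      have "(\<integral>x. \<bar>f x\<bar> * (r m x - r n x) \<partial>M) = (\<integral>x. \<bar>f x\<bar> * r m x \<partial>M) - (\<integral>x. \<bar>f x\<bar> * r n x \<partial>M)"
        using Iint[OF f u(1)] by (simp add: right_diff_distrib)
      moreover have "\<bar>R m f \<pi> - R n f \<pi>\<bar> \<le> lip_const \<pi> * (\<integral>x. \<bar>f x\<bar> * (r m x - r n x) \<partial>M)"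
        using diff_le[OF that] f \<pi> unfolding mass1_le_def by blast
      ultimately show ?thesis by simp
    qed
    ultimately have "\<bar>R m f \<pi> - Z f \<pi>\<bar> \<le> lip_const \<pi> * ((\<integral>x. \<bar>f x\<bar> * r m x \<partial>M) - (\<integral>x. \<bar>f x\<bar> * ri x \<partial>M))"
      by (intro LIMSEQ_le[where X="\<lambda>n. \<bar>R m f \<pi> - R n f \<pi>\<bar>"] exI[of _ m]) auto
    then show "\<bar>R m f \<pi> - Z f \<pi>\<bar> \<le> lip_const \<pi> * (\<integral>x. \<bar>f x\<bar> * (r m x - ri x) \<partial>M)"
      using Iint[OF f u(1)] Iint[OF f riu] by (simp add: right_diff_distrib)
  qed
  have bZ: "boundary Z f = 0" if f: "f \<in> Lip_bs" for f
  proof -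
    obtain \<sigma> where \<sigma>: "\<sigma> \<in> Lip_bs" "\<And>x. x \<in> supp f \<Longrightarrow> \<sigma> x = 1" using Lip_bs_has_cutoff[OF f] by blast
    obtain n where n: "supp f \<subseteq> ball undefined (real n)" using bounded_subset_ball[OF Lip_bs_supp_bounded[OF f]] by blast
    \<comment> \<open>The state with index \<open>Suc k\<close> has no boundary in the ball of
      radius \<open>k\<close>, which explains the shift by one.\<close>
    have "boundary (R m) f = 0" if m: "Suc n \<le> m" for m
    proof -
      obtain k where k: "m = Suc k" "n \<le> k" using m by (cases m) auto
      have z: "f x * (p m x - q m x) = 0" for x
      proof (cases "x \<in> supp f")
        case True
        then have "x \<in> ball undefined (real n)" using n by blast
        then have "x \<in> ball undefined (real k)" using k(2) by simp
        then show ?thesis using zero[of x k] k(1) by simp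
      qed (simp add: supp_zero)
      show ?thesis unfolding flow_stateD(6)[OF st f] z by simp
    qed
    then have "(\<lambda>m. boundary (R m) f) \<longlonglongrightarrow> 0"
      by (intro tendsto_eventually eventually_sequentiallyI[of "Suc n"]) auto
    moreover have "(\<lambda>m. boundary (R m) f) \<longlonglongrightarrow> boundary Z f"
      using Zlim[OF \<sigma>(1) Lip_bs_Lip[OF f]] boundary_eq[OF flow_stateD(1)[OF st] f \<sigma>] boundary_eq[OF Zpre f \<sigma>] by simp
    ultimately show ?thesis by (rule LIMSEQ_unique[symmetric])
  qed
  \<comment> \<open>The limit comes first, the piece removed in step \<open>k\<close> gets index
    \<open>Suc k\<close>.\<close>
  define S where "S m = (case m of 0 \<Rightarrow> Z | Suc k \<Rightarrow> (\<lambda>f \<pi>. R k f \<pi> - R (Suc k) f \<pi>))" for m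
  have S0: "S 0 = Z" and SS: "S (Suc k) = (\<lambda>f \<pi>. R k f \<pi> - R (Suc k) f \<pi>)" for k by (simp_all add: S_def)
  have Rpre: "pre_current (R m)" for m by (rule flow_stateD(1)[OF st])
  have ZN: "Z \<in> N\<^sub>1\<^sub>b"
    by (rule pre_current_N1b[OF Zpre M(1) P(1)]) (use mass1_le_total[OF M(1) riu Zle] bZ in auto)
  \<comment> \<open>Since the limit is subtracted first, what is left after \<open>Suc k\<close>
    terms is the state \<open>R k\<close> without its limit part.\<close>
  have tel: "T f \<pi> - (\<Sum>i<m. S i f \<pi>) = (case m of 0 \<Rightarrow> T f \<pi> | Suc k \<Rightarrow> R k f \<pi> - Z f \<pi>)" for m f \<pi>
  proof (cases m)
    case (Suc k)
    have "(\<Sum>i<k. S (Suc i) f \<pi>) = T f \<pi> - R k f \<pi>"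
      unfolding SS by (subst sum_lessThan_telescope') (simp add: R0)
    then show ?thesis unfolding Suc sum.lessThan_Suc_shift by (simp add: S0)
  qed simp
  have btel: "boundary T f - (\<Sum>i<m. boundary (S i) f) = (case m of 0 \<Rightarrow> boundary T f | Suc k \<Rightarrow> boundary (R k) f - boundary Z f)" for m f
    unfolding boundary_def by (rule tel)
  have SN: "S i \<in> N\<^sub>1\<^sub>b" for i
    by (cases i) (simp_all add: S0 SS ZN flow_state_N1b[OF M(1) P(1) dst])
  moreover have "(\<lambda>i. S i f \<pi>) sums T f \<pi>" if f: "f \<in> Lip_bs" and \<pi>: "\<pi> \<in> Lip" for f \<pi>
  proof -
    have "(\<lambda>i. S (Suc i) f \<pi>) sums (R 0 f \<pi> - Z f \<pi>)"
      unfolding SS by (rule telescope_sums'[OF Zlim[OF f \<pi>]])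
    then have "(\<lambda>i. S i f \<pi>) sums (R 0 f \<pi> - Z f \<pi> + S 0 f \<pi>)" by (rule sums_Suc)
    then show ?thesis by (simp add: S0 R0)
  qed
  moreover have "boundary (S 0) f = 0" if "f \<in> Lip_bs" for f using bZ[OF that] by (simp add: S0)
  moreover have "emeasure (mass0 (boundary (S m))) UNIV < \<infinity>" for m
  proof (cases m)
    case 0
    have "emeasure (mass0 (boundary Z)) UNIV \<le> emeasure (density P (\<lambda>x. ennreal 0)) UNIV"
      by (rule emeasure_mass0_le[OF P(1) boundary_linear[OF Zpre], where C=0]) (use bZ in auto)
    also have "\<dots> = 0" by (subst emeasure_density) auto
    finally show ?thesis using 0 by (simp add: S0)
  next
    case (Suc k)
    have "emeasure (mass0 (boundary (S m))) UNIV
        \<le> emeasure (density P (\<lambda>x. ennreal ((p k x - p (Suc k) x) + (q k x - q (Suc k) x)))) UNIV"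
    proof (rule emeasure_mass0_le[OF P(1), where C=2])
      show "linear_on_Lip_bs (boundary (S m))" unfolding Suc SS by (rule boundary_linear[OF flow_stateD(1)[OF dst]])
      show "0 \<le> (p k x - p (Suc k) x) + (q k x - q (Suc k) x)" "(p k x - p (Suc k) x) + (q k x - q (Suc k) x) \<le> 2" for x
        using unit_densityD(2,3)[OF du(2)[of k], of x] unit_densityD(2,3)[OF du(3)[of k], of x] by auto
      show "\<bar>boundary (S m) f\<bar> \<le> (\<integral>x. \<bar>f x\<bar> * ((p k x - p (Suc k) x) + (q k x - q (Suc k) x)) \<partial>P)" if f: "f \<in> Lip_bs" for f
        unfolding Suc SS flow_stateD(6)[OF dst f] by (rule abs_integral_diff_le(1)[OF P(1) du(2,3) f])
    qed measurable
    then show ?thesis using fin[of k] by (rule le_less_trans)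
  qed
  moreover have "subcurrent1 (S m) (\<lambda>f \<pi>. T f \<pi> - (\<Sum>i<m. S i f \<pi>))" for m
  proof (cases m)
    case 0
    have u0: "unit_density (\<lambda>x::'a. 0)" by (simp add: unit_density_def)
    have z: "mass1_le (\<lambda>f \<pi>. T f \<pi> - T f \<pi>) M (\<lambda>x. 0)" by (simp add: mass1_le_def)
    have "mass1_le (\<lambda>f \<pi>. T f \<pi> - Z f \<pi>) M (\<lambda>x. 1 - ri x)" using RZle[of 0] by (simp add: R0)
    moreover have "unit_density (\<lambda>x. 1 - ri x)" using RZu[of 0] by (simp add: R0)
    \<comment> \<open>The densities are \<open>ri\<close> for the piece, \<open>1 - ri\<close> for
      the rest, and 0 since nothing has been taken before.\<close>
    ultimately have "subcurrent1 Z T"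
      using Rpre[of 0] by (intro subcurrent1I[OF M _ Zpre _ riu _ u0 _ Zle _ z]) (simp_all add: R0)
    then show ?thesis using 0 by (simp add: S0)
  next
    case (Suc k)
    \<comment> \<open>The three densities add up to exactly 1. The last one,
      \<open>(1 - r k) + ri\<close>, covers the pieces removed before together with the limit, which
      has already been subtracted.\<close>
    have "subcurrent1 (\<lambda>f \<pi>. R k f \<pi> - R (Suc k) f \<pi>) (\<lambda>f \<pi>. R k f \<pi> - Z f \<pi>)"
    proof (rule subcurrent1I[OF M _ flow_stateD(1)[OF dst] pre_current_diff[OF Rpre Zpre] du(1) RZu[of "Suc k"] _ _ flow_stateD(3)[OF dst]])
      show "pre_current T" using Rpre[of 0] by (simp add: R0)
      have u1: "unit_density (\<lambda>x. 1 - r k x)" using ru[of 0 k] by (simp add: R0)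
      show "unit_density (\<lambda>x. (1 - r k x) + ri x)"
      proof -
        have "0 \<le> (1 - r k x) + ri x \<and> (1 - r k x) + ri x \<le> 1" for x
          using ri01(1)[of x] ri01(3)[of x k] r01(2)[of k x] by linarith
        then show ?thesis by (simp add: unit_density_def)
      qed
      show "r k x - r (Suc k) x + (r (Suc k) x - ri x) + (1 - r k x + ri x) \<le> 1" for x by simp
      show "mass1_le (\<lambda>f \<pi>. R k f \<pi> - Z f \<pi> - (R k f \<pi> - R (Suc k) f \<pi>)) M (\<lambda>x. r (Suc k) x - ri x)"
        using RZle[of "Suc k"] by simp
      have "mass1_le (\<lambda>f \<pi>. (T f \<pi> - R k f \<pi>) + Z f \<pi>) M (\<lambda>x. (1 - r k x) + ri x)"
        using diff_le[of 0 k] by (intro mass1_le_add[OF M(1) u1 riu _ Zle]) (simp add: R0)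
      then show "mass1_le (\<lambda>f \<pi>. T f \<pi> - (R k f \<pi> - Z f \<pi>)) M (\<lambda>x. (1 - r k x) + ri x)"
        by (simp only: diff_diff_eq2 add_diff_eq diff_add_eq)
    qed
    then show ?thesis using Suc unfolding tel by (simp add: SS)
  qed
  moreover have "subcurrent0 (boundary (S m)) (\<lambda>f. boundary T f - (\<Sum>i<m. boundary (S i) f))" for m
  proof -
    have Tpre: "pre_current T" using Rpre[of 0] by (simp add: R0)
    have bT: "boundary T f = boundary (R 0) f" for f by (simp add: R0)
    have bR: "\<bar>boundary (R k) f\<bar> \<le> (\<integral>x. \<bar>f x\<bar> * (p k x + q k x) \<partial>P)" if f: "f \<in> Lip_bs" for k f
      unfolding flow_stateD(6)[OF st f] by (rule abs_integral_diff_le(1)[OF P(1) u(2,3) f])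
    have sum1: "p 0 x + q 0 x \<le> 1" for x using pq1 by (simp add: R0)
    show ?thesis
    proof (cases m)
      case 0
      \<comment> \<open>The limit has no boundary, so its density is 0 and the whole boundary
        density goes to the rest.\<close>
      have "subcurrent0 (boundary Z) (boundary T)"
      proof (rule subcurrent0I[OF P bdT[rule_format], where a="\<lambda>x. 0" and b="\<lambda>x. p 0 x + q 0 x" and c="\<lambda>x. 0"])
        show "\<bar>boundary T f - boundary Z f\<bar> \<le> (\<integral>x. \<bar>f x\<bar> * (p 0 x + q 0 x) \<partial>P)" if "f \<in> Lip_bs" for f
          using bR[OF that, of 0] bZ[OF that] by (simp add: bT)
      qed (use Tpre Zpre boundary_linear sum1 pq01 bZ in auto)
      then show ?thesis using 0 by (simp add: S0)
    next
      case (Suc k)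
      \<comment> \<open>The boundary densities of the piece, the remainder and the earlier pieces
        telescope to \<open>p 0 + q 0\<close>, which is at most 1. The limit contributes
        nothing.\<close>
      have "subcurrent0 (boundary (\<lambda>f \<pi>. R k f \<pi> - R (Suc k) f \<pi>)) (\<lambda>f. boundary (R k) f - boundary Z f)"
      proof (rule subcurrent0I[OF P bdT[rule_format], where a="\<lambda>x. (p k x - p (Suc k) x) + (q k x - q (Suc k) x)"
            and b="\<lambda>x. p (Suc k) x + q (Suc k) x" and c="\<lambda>x. (p 0 x - p k x) + (q 0 x - q k x)"])
        show "linear_on_Lip_bs (boundary T)" by (rule boundary_linear[OF Tpre])
        show "linear_on_Lip_bs (boundary (\<lambda>f \<pi>. R k f \<pi> - R (Suc k) f \<pi>))" by (rule boundary_linear[OF flow_stateD(1)[OF dst]])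
        show "linear_on_Lip_bs (\<lambda>f. boundary (R k) f - boundary Z f)"
          using boundary_linear[OF pre_current_diff[OF Rpre Zpre]] unfolding boundary_diff .
        show "0 \<le> (p k x - p (Suc k) x) + (q k x - q (Suc k) x)" "0 \<le> p (Suc k) x + q (Suc k) x"
          "0 \<le> (p 0 x - p k x) + (q 0 x - q k x)" for x
          using pq01[where m=k and x=x] pq01[where m="Suc k" and x=x] rdec[of 0 k x] by auto
        show "(p k x - p (Suc k) x) + (q k x - q (Suc k) x) + (p (Suc k) x + q (Suc k) x) + ((p 0 x - p k x) + (q 0 x - q k x)) \<le> 1" for x
          using sum1[of x] by simp
      next
        fix f :: "'a \<Rightarrow> real" assume f: "f \<in> Lip_bs"
        show "\<bar>boundary (\<lambda>f \<pi>. R k f \<pi> - R (Suc k) f \<pi>) f\<bar> \<le> (\<integral>x. \<bar>f x\<bar> * ((p k x - p (Suc k) x) + (q k x - q (Suc k) x)) \<partial>P)"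
          unfolding flow_stateD(6)[OF dst f] by (rule abs_integral_diff_le(1)[OF P(1) du(2,3) f])
        show "\<bar>boundary (R k) f - boundary Z f - boundary (\<lambda>f \<pi>. R k f \<pi> - R (Suc k) f \<pi>) f\<bar> \<le> (\<integral>x. \<bar>f x\<bar> * (p (Suc k) x + q (Suc k) x) \<partial>P)"
          using bR[OF f, of "Suc k"] bZ[OF f] by (simp add: boundary_diff)
        have pu: "unit_density (\<lambda>x. p 0 x - p k x)" "unit_density (\<lambda>x. q 0 x - q k x)"
          by (rule unit_density_diff[OF u(2) u(2) rdec(2)] unit_density_diff[OF u(3) u(3) rdec(3)]; simp)+
        have i: "integrable P (\<lambda>x. f x * (p j x - q j x))" for j
        proof (rule Lip_bs_integrable(1)[OF P(1) f, where C=1])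
          show "\<bar>p j x - q j x\<bar> \<le> 1" for x
            using unit_densityD(2,3)[OF u(2)[of j], of x] unit_densityD(2,3)[OF u(3)[of j], of x] by linarith
        qed measurable
        have "boundary (R 0) f - boundary (R k) f = (\<integral>x. f x * (p 0 x - q 0 x) - f x * (p k x - q k x) \<partial>P)"
          unfolding flow_stateD(6)[OF st f] using i by simp
        also have "\<dots> = (\<integral>x. f x * ((p 0 x - p k x) - (q 0 x - q k x)) \<partial>P)"
          by (rule Bochner_Integration.integral_cong) (auto simp: algebra_simps)
        finally show "\<bar>boundary T f - (boundary (R k) f - boundary Z f)\<bar> \<le> (\<integral>x. \<bar>f x\<bar> * ((p 0 x - p k x) + (q 0 x - q k x)) \<partial>P)"
          using abs_integral_diff_le(1)[OF P(1) pu f] bZ[OF f] by (simp add: bT)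
      qed measurable
      then show ?thesis using Suc unfolding btel by (simp add: SS)
    qed
  qed
  ultimately show ?thesis by (intro exI[of _ S]) blast
qed

end
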